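(* Let $(M_n)_n$ be a sequence of $\sigma$-finite von Neumann algebras with normal faithful states $\varphi_n$ on $M_n$, each $M_n$ acting standardly on $H_n=L^2(M_n,\varphi_n)$. Let $N=\prod^\omega M_n\subset\mathbb{B}((H_n)_\omega)$, let $\xi_\omega=(\xi_{\varphi_n})_\omega$, let $\varphi_\omega$ be the normal state $x\mapsto\langle x\xi_\omega,\xi_\omega\rangle$ on $N$, and let $p\in N$ be its support projection. Let $(x_n)_n\in\ell^\infty(\mathbb{N},M_n)$. Then $(x_n)_n\in\mathcal{M}^\omega(M_n,\varphi_n)$ if and only if $p(x_n)_\omega=(x_n)_\omega p$. Moreover, the map $$(M_n,\varphi_n)^\omega\to pNp,\qquad (x_n)^\omega\mapsto (x_n)_\omega p,$$ is a $*$-isomorphism. Therefore the Ocneanu ultraproduct $(M_n,\varphi_n)^\omega$ is isomorphic to the reduction of the Groh–Raynaud ultraproduct $\prod^\omega M_n$ by the support projection $p$ of $\varphi_\omega\in N_*$.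
   Context: $\omega$ is a fixed free ultrafilter on $\mathbb{N}$. $\xi_{\varphi_n}$ is the canonical cyclic vector of $L^2(M_n,\varphi_n)$. Ocneanu ultraproduct. Let $\|x\|_{\varphi}^{\sharp}=\varphi(x^*x+xx^* )^{1/2}$. Let $\ell^\infty(\mathbb{N},M_n)$ be the C$^*$-algebra of bounded sequences $(x_n)_n\in\prod_n M_n$; $\mathcal{I}_\omega(M_n,\varphi_n)=\{(x_n)_n\in\ell^\infty(\mathbb{N},M_n):\lim_{n\to\omega}\|x_n\|^\sharp_{\varphi_n}=0\}$; writing $\mathcal{I}_\omega$ for this set, $\mathcal{M}^\omega(M_n,\varphi_n)=\{(x_n)_n\in\ell^\infty(\mathbb{N},M_n): (x_n)_n\mathcal{I}_\omega\subset\mathcal{I}_\omega,\ \mathcal{I}_\omega(x_n)_n\subset\mathcal{I}_\omega\}$. Then $(M_n,\varphi_n)^\omega:=\mathcal{M}^\omega(M_n,\varphi_n)/\mathcal{I}_\omega(M_n,\varphi_n)$, and the class of $(x_n)_n$ is written $(x_n)^\omega$. Groh–Raynaud ultraproduct. $(H_n)_\omega$ is the Hilbert space ultraproduct, with elements $(\xi_n)_\omega$. For a bounded sequence $(a_n)_n$, $a_n\in\mathbb{B}(H_n)$, the class $(a_n)_\omega$ in the Banach space ultraproduct is identified with the operator $(\xi_n)_\omega\mapsto(a_n\xi_n)_\omega$ on $(H_n)_\omega$. With each $M_n$ acting standardly on $H_n$, $\prod^\omega M_n$ is the strong operator closure of $\{(a_n)_\omega:(a_n)_n\in\ell^\infty(\mathbb{N},M_n)\}$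 in $\mathbb{B}((H_n)_\omega)$. *)

theory Defs
  imports
    "HOL-Analysis.Analysis"
    "HOL-Algebra.QuotRing"
    "HOL-Algebra.Module"
begin

section \<open>Complex Hilbert spaces\<close>

text \<open>
  Hilbert spaces are records with an explicit carrier, so that a sequence of pairwise different
  Hilbert spaces is just a function on \<^typ>\<open>nat\<close>, and the ultraproduct, which depends on
  the spaces and on the ultrafilter, is again such a record. As usual for
  \<^const>\<open>module\<close>, the inherited fields \<open>mult\<close> and \<open>one\<close> are
  meaningless for Hilbert spaces. The inner product is linear in the first argument.
\<close>

record 'a hilbert = "(complex, 'a) module" +
  ip :: "'a \<Rightarrow> 'a \<Rightarrow> complex"

definition hnorm :: "'a hilbert \<Rightarrow> 'a \<Rightarrow> real" where
  "hnorm H x = sqrt (Re (ip H x x))"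

definition complex_ring :: "complex ring" where
  "complex_ring = \<lparr>carrier = UNIV, mult = (*), one = 1, zero = 0, add = (+)\<rparr>"

locale hilbert_space = module complex_ring H
  for H :: "'a hilbert" (structure) +
  assumes ip_add_left:
      "\<lbrakk>x \<in> carrier H; y \<in> carrier H; z \<in> carrier H\<rbrakk>
        \<Longrightarrow> ip H (x \<oplus> y) z = ip H x z + ip H y z"
    and ip_scale_left:
      "\<lbrakk>x \<in> carrier H; y \<in> carrier H\<rbrakk> \<Longrightarrow> ip H (c \<odot> x) y = c * ip H x y"
    and ip_commute:
      "\<lbrakk>x \<in> carrier H; y \<in> carrier H\<rbrakk> \<Longrightarrow> ip H x y = cnj (ip H y x)"
    and ip_nonneg: "x \<in> carrier H \<Longrightarrow> ip H x x \<in> \<real>\<^sub>\<ge>\<^sub>0"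
    and ip_definite: "\<lbrakk>x \<in> carrier H; ip H x x = 0\<rbrakk> \<Longrightarrow> x = \<zero>"
    and complete:
      "\<lbrakk>\<And>n. u n \<in> carrier H;
        \<And>e. e > 0 \<Longrightarrow> \<exists>k. \<forall>m\<ge>k. \<forall>n\<ge>k. hnorm H (u m \<ominus> u n) < e\<rbrakk>
        \<Longrightarrow> \<exists>x\<in>carrier H. (\<lambda>n. hnorm H (u n \<ominus> x)) \<longlonglongrightarrow> 0"

section \<open>*-algebras and bounded operators\<close>

record 'a star_algebra = "(complex, 'a) module" +
  adj :: "'a \<Rightarrow> 'a"

definition star_hom :: "'a star_algebra \<Rightarrow> 'b star_algebra \<Rightarrow> ('a \<Rightarrow> 'b) set" where
  "star_hom A B = {h \<in> ring_hom A B.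
     (\<forall>c. \<forall>x\<in>carrier A. h (c \<odot>\<^bsub>A\<^esub> x) = c \<odot>\<^bsub>B\<^esub> h x) \<and>
     (\<forall>x\<in>carrier A. h (adj A x) = adj B (h x))}"

definition star_iso :: "'a star_algebra \<Rightarrow> 'b star_algebra \<Rightarrow> ('a \<Rightarrow> 'b) set" where
  "star_iso A B = {h \<in> star_hom A B. bij_betw h (carrier A) (carrier B)}"

definition star_isomorphic :: "'a star_algebra \<Rightarrow> 'b star_algebra \<Rightarrow> bool" where
  "star_isomorphic A B \<longleftrightarrow> star_iso A B \<noteq> {}"

text \<open>Operators are taken to be undefined outside the carrier, so that equality of operators
  is equality of functions.\<close>

definition bounded_ops :: "'a hilbert \<Rightarrow> ('a \<Rightarrow> 'a) set" where
  "bounded_ops H = {T \<in> carrier H \<rightarrow>\<^sub>E carrier H.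
     (\<forall>x\<in>carrier H. \<forall>y\<in>carrier H. T (x \<oplus>\<^bsub>H\<^esub> y) = T x \<oplus>\<^bsub>H\<^esub> T y) \<and>
     (\<forall>c. \<forall>x\<in>carrier H. T (c \<odot>\<^bsub>H\<^esub> x) = c \<odot>\<^bsub>H\<^esub> T x) \<and>
     (\<exists>C. \<forall>x\<in>carrier H. hnorm H (T x) \<le> C * hnorm H x)}"

definition opnorm :: "'a hilbert \<Rightarrow> ('a \<Rightarrow> 'a) \<Rightarrow> real" where
  "opnorm H T = Sup {hnorm H (T x) | x. x \<in> carrier H \<and> hnorm H x \<le> 1}"

definition adjoint :: "'a hilbert \<Rightarrow> ('a \<Rightarrow> 'a) \<Rightarrow> ('a \<Rightarrow> 'a)" where
  "adjoint H T = (THE S. S \<in> bounded_ops H \<and>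
     (\<forall>x\<in>carrier H. \<forall>y\<in>carrier H. ip H (T x) y = ip H x (S y)))"

definition op_algebra :: "'a hilbert \<Rightarrow> ('a \<Rightarrow> 'a) star_algebra" where
  "op_algebra H =
     \<lparr>carrier = bounded_ops H,
      mult = (\<lambda>S T. compose (carrier H) S T),
      one = (\<lambda>x\<in>carrier H. x),
      zero = (\<lambda>x\<in>carrier H. \<zero>\<^bsub>H\<^esub>),
      add = (\<lambda>S T. \<lambda>x\<in>carrier H. S x \<oplus>\<^bsub>H\<^esub> T x),
      smult = (\<lambda>c T. \<lambda>x\<in>carrier H. c \<odot>\<^bsub>H\<^esub> T x),
      adj = adjoint H\<rparr>"

definition positive_op :: "'a hilbert \<Rightarrow> ('a \<Rightarrow> 'a) \<Rightarrow> bool" where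
  "positive_op H T \<longleftrightarrow> T \<in> bounded_ops H \<and> (\<forall>x\<in>carrier H. ip H (T x) x \<in> \<real>\<^sub>\<ge>\<^sub>0)"

text \<open>The closure in the strong operator topology, spelled out with the basic neighbourhoods
  given by finitely many vectors.\<close>

definition sot_closure :: "'a hilbert \<Rightarrow> ('a \<Rightarrow> 'a) set \<Rightarrow> ('a \<Rightarrow> 'a) set" where
  "sot_closure H A = {T \<in> bounded_ops H.
     \<forall>F e. finite F \<and> F \<subseteq> carrier H \<and> e > 0 \<longrightarrow>
       (\<exists>S\<in>A. \<forall>x\<in>F. hnorm H (T x \<ominus>\<^bsub>H\<^esub> S x) < e)}"

section \<open>Von Neumann algebras and normal states\<close>

locale von_neumann_algebra = hilbert_space H
  for H :: "'a hilbert" (structure) and M :: "('a \<Rightarrow> 'a) set" +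
  assumes subset: "M \<subseteq> bounded_ops H"
    and one_mem: "\<one>\<^bsub>op_algebra H\<^esub> \<in> M"
    and add_mem: "\<lbrakk>S \<in> M; T \<in> M\<rbrakk> \<Longrightarrow> S \<oplus>\<^bsub>op_algebra H\<^esub> T \<in> M"
    and mult_mem: "\<lbrakk>S \<in> M; T \<in> M\<rbrakk> \<Longrightarrow> S \<otimes>\<^bsub>op_algebra H\<^esub> T \<in> M"
    and smult_mem: "T \<in> M \<Longrightarrow> c \<odot>\<^bsub>op_algebra H\<^esub> T \<in> M"
    and adj_mem: "T \<in> M \<Longrightarrow> adj (op_algebra H) T \<in> M"
    and sot_closed: "sot_closure H M \<subseteq> M"

definition projections :: "'a hilbert \<Rightarrow> ('a \<Rightarrow> 'a) set \<Rightarrow> ('a \<Rightarrow> 'a) set" where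
  "projections H M =
     {e \<in> M. e \<otimes>\<^bsub>op_algebra H\<^esub> e = e \<and> adj (op_algebra H) e = e}"

definition sigma_finite_vna :: "'a hilbert \<Rightarrow> ('a \<Rightarrow> 'a) set \<Rightarrow> bool" where
  "sigma_finite_vna H M \<longleftrightarrow>
     (\<forall>P \<subseteq> projections H M - {\<zero>\<^bsub>op_algebra H\<^esub>}.
       pairwise (\<lambda>e f. e \<otimes>\<^bsub>op_algebra H\<^esub> f = \<zero>\<^bsub>op_algebra H\<^esub>) P \<longrightarrow> countable P)"

text \<open>The predual consists of the \<open>\<sigma>\<close>-weakly continuous functionals.\<close>

definition in_predual :: "'a hilbert \<Rightarrow> ('a \<Rightarrow> 'a) set \<Rightarrow> (('a \<Rightarrow> 'a) \<Rightarrow> complex) \<Rightarrow> bool" where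
  "in_predual H M \<phi> \<longleftrightarrow>
     (\<exists>f g :: nat \<Rightarrow> 'a. range f \<subseteq> carrier H \<and> range g \<subseteq> carrier H \<and>
        summable (\<lambda>k. (hnorm H (f k))\<^sup>2) \<and> summable (\<lambda>k. (hnorm H (g k))\<^sup>2) \<and>
        (\<forall>T\<in>M. (\<lambda>k. ip H (T (f k)) (g k)) sums \<phi> T))"

definition state :: "'a hilbert \<Rightarrow> ('a \<Rightarrow> 'a) set \<Rightarrow> (('a \<Rightarrow> 'a) \<Rightarrow> complex) \<Rightarrow> bool" where
  "state H M \<phi> \<longleftrightarrow>
     (\<forall>S\<in>M. \<forall>T\<in>M. \<phi> (S \<oplus>\<^bsub>op_algebra H\<^esub> T) = \<phi> S + \<phi> T) \<and>
     (\<forall>c. \<forall>T\<in>M. \<phi> (c \<odot>\<^bsub>op_algebra H\<^esub> T) = c * \<phi> T) \<and>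
     (\<forall>T\<in>M. positive_op H T \<longrightarrow> \<phi> T \<in> \<real>\<^sub>\<ge>\<^sub>0) \<and>
     \<phi> \<one>\<^bsub>op_algebra H\<^esub> = 1"

definition normal_state :: "'a hilbert \<Rightarrow> ('a \<Rightarrow> 'a) set \<Rightarrow> (('a \<Rightarrow> 'a) \<Rightarrow> complex) \<Rightarrow> bool" where
  "normal_state H M \<phi> \<longleftrightarrow> state H M \<phi> \<and> in_predual H M \<phi>"

definition faithful :: "'a hilbert \<Rightarrow> ('a \<Rightarrow> 'a) set \<Rightarrow> (('a \<Rightarrow> 'a) \<Rightarrow> complex) \<Rightarrow> bool" where
  "faithful H M \<phi> \<longleftrightarrow>
     (\<forall>T\<in>M. \<phi> (adj (op_algebra H) T \<otimes>\<^bsub>op_algebra H\<^esub> T) = 0 \<longrightarrow> T = \<zero>\<^bsub>op_algebra H\<^esub>)"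

text \<open>The support projection is the smallest projection \<open>p\<close> of the algebra with
  \<open>\<phi> (1 - p) = 0\<close>, i.e. \<open>\<phi> p = \<phi> 1\<close>; the order relation \<open>p \<le> q\<close>
  of projections is \<open>q p = p\<close>.\<close>

definition is_support_projection ::
  "'a hilbert \<Rightarrow> ('a \<Rightarrow> 'a) set \<Rightarrow> (('a \<Rightarrow> 'a) \<Rightarrow> complex) \<Rightarrow> ('a \<Rightarrow> 'a) \<Rightarrow> bool" where
  "is_support_projection H M \<phi> p \<longleftrightarrow>
     p \<in> projections H M \<and> \<phi> p = \<phi> \<one>\<^bsub>op_algebra H\<^esub> \<and>
     (\<forall>q\<in>projections H M. \<phi> q = \<phi> \<one>\<^bsub>op_algebra H\<^esub> \<longrightarrow> q \<otimes>\<^bsub>op_algebra H\<^esub> p = p)"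

definition support_projection ::
  "'a hilbert \<Rightarrow> ('a \<Rightarrow> 'a) set \<Rightarrow> (('a \<Rightarrow> 'a) \<Rightarrow> complex) \<Rightarrow> ('a \<Rightarrow> 'a)" where
  "support_projection H M \<phi> = (THE p. is_support_projection H M \<phi> p)"

definition reduced_algebra ::
  "'a hilbert \<Rightarrow> ('a \<Rightarrow> 'a) set \<Rightarrow> ('a \<Rightarrow> 'a) \<Rightarrow> ('a \<Rightarrow> 'a) star_algebra" where
  "reduced_algebra H M p = (op_algebra H)
     \<lparr>carrier := {p \<otimes>\<^bsub>op_algebra H\<^esub> x \<otimes>\<^bsub>op_algebra H\<^esub> p | x. x \<in> M}, one := p\<rparr>"

text \<open>
  The standard action of a von Neumann algebra \<open>M\<close> (given on a Hilbert space \<open>K\<close>) on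
  \<open>L\<^sup>2(M, \<phi>)\<close>: the Hilbert space \<open>H\<close>, the *-representation \<open>\<pi>\<close>
  and the cyclic vector \<open>\<xi>\<close> form the GNS triple of \<open>\<phi>\<close>. The map
  \<open>x \<mapsto> \<pi> x \<xi>\<close> embeds \<open>M\<close> densely in \<open>H\<close>, with
  \<open>\<langle>\<pi> x \<xi>, \<pi> y \<xi>\<rangle> = \<phi> (y\<^sup>* x)\<close>, and
  \<open>\<xi> = \<pi> 1 \<xi>\<close> is the canonical cyclic vector; this determines
  \<open>(H, \<pi>, \<xi>)\<close> up to unitary equivalence.
\<close>

locale GNS_triple = hilbert_space H
  for K :: "'k hilbert" and M :: "('k \<Rightarrow> 'k) set" and \<phi> :: "('k \<Rightarrow> 'k) \<Rightarrow> complex"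
    and H :: "'h hilbert" (structure) and \<pi> :: "('k \<Rightarrow> 'k) \<Rightarrow> ('h \<Rightarrow> 'h)" and \<xi> :: 'h +
  assumes rep: "\<pi> \<in> star_hom ((op_algebra K)\<lparr>carrier := M\<rparr>) (op_algebra H)"
    and vector: "\<xi> \<in> carrier H"
    and implements: "T \<in> M \<Longrightarrow> \<phi> T = ip H (\<pi> T \<xi>) \<xi>"
    and cyclic: "\<lbrakk>\<eta> \<in> carrier H; e > 0\<rbrakk> \<Longrightarrow> \<exists>T\<in>M. hnorm H (\<eta> \<ominus> \<pi> T \<xi>) < e"

section \<open>The Ocneanu ultraproduct\<close>

definition free_ultrafilter :: "nat filter \<Rightarrow> bool" where
  "free_ultrafilter \<omega> \<longleftrightarrow> \<omega> \<noteq> bot \<and>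
     (\<forall>P. eventually P \<omega> \<or> eventually (\<lambda>n. \<not> P n) \<omega>) \<and>
     (\<forall>m. eventually (\<lambda>n. n \<noteq> m) \<omega>)"

definition linf :: "(nat \<Rightarrow> 'k hilbert) \<Rightarrow> (nat \<Rightarrow> ('k \<Rightarrow> 'k) set) \<Rightarrow> (nat \<Rightarrow> 'k \<Rightarrow> 'k) set" where
  "linf K M = {x. (\<forall>n. x n \<in> M n) \<and> (\<exists>C. \<forall>n. opnorm (K n) (x n) \<le> C)}"

definition linf_algebra ::
  "(nat \<Rightarrow> 'k hilbert) \<Rightarrow> (nat \<Rightarrow> ('k \<Rightarrow> 'k) set) \<Rightarrow> (nat \<Rightarrow> 'k \<Rightarrow> 'k) star_algebra" where
  "linf_algebra K M =
     \<lparr>carrier = linf K M,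
      mult = (\<lambda>x y n. x n \<otimes>\<^bsub>op_algebra (K n)\<^esub> y n),
      one = (\<lambda>n. \<one>\<^bsub>op_algebra (K n)\<^esub>),
      zero = (\<lambda>n. \<zero>\<^bsub>op_algebra (K n)\<^esub>),
      add = (\<lambda>x y n. x n \<oplus>\<^bsub>op_algebra (K n)\<^esub> y n),
      smult = (\<lambda>c x n. c \<odot>\<^bsub>op_algebra (K n)\<^esub> x n),
      adj = (\<lambda>x n. adj (op_algebra (K n)) (x n))\<rparr>"

definition sharp_norm :: "'k hilbert \<Rightarrow> (('k \<Rightarrow> 'k) \<Rightarrow> complex) \<Rightarrow> ('k \<Rightarrow> 'k) \<Rightarrow> real" where
  "sharp_norm K \<phi> x = sqrt (Re (\<phi> (
     (adj (op_algebra K) x \<otimes>\<^bsub>op_algebra K\<^esub> x) \<oplus>\<^bsub>op_algebra K\<^esub>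
     (x \<otimes>\<^bsub>op_algebra K\<^esub> adj (op_algebra K) x))))"

definition ocneanu_ideal ::
  "nat filter \<Rightarrow> (nat \<Rightarrow> 'k hilbert) \<Rightarrow> (nat \<Rightarrow> ('k \<Rightarrow> 'k) set) \<Rightarrow>
    (nat \<Rightarrow> ('k \<Rightarrow> 'k) \<Rightarrow> complex) \<Rightarrow> (nat \<Rightarrow> 'k \<Rightarrow> 'k) set" where
  "ocneanu_ideal \<omega> K M \<phi> =
     {x \<in> linf K M. ((\<lambda>n. sharp_norm (K n) (\<phi> n) (x n)) \<longlongrightarrow> 0) \<omega>}"

definition ocneanu_multiplier ::
  "nat filter \<Rightarrow> (nat \<Rightarrow> 'k hilbert) \<Rightarrow> (nat \<Rightarrow> ('k \<Rightarrow> 'k) set) \<Rightarrow>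
    (nat \<Rightarrow> ('k \<Rightarrow> 'k) \<Rightarrow> complex) \<Rightarrow> (nat \<Rightarrow> 'k \<Rightarrow> 'k) set" where
  "ocneanu_multiplier \<omega> K M \<phi> =
     {x \<in> linf K M. \<forall>y\<in>ocneanu_ideal \<omega> K M \<phi>.
        x \<otimes>\<^bsub>linf_algebra K M\<^esub> y \<in> ocneanu_ideal \<omega> K M \<phi> \<and>
        y \<otimes>\<^bsub>linf_algebra K M\<^esub> x \<in> ocneanu_ideal \<omega> K M \<phi>}"

definition multiplier_algebra ::
  "nat filter \<Rightarrow> (nat \<Rightarrow> 'k hilbert) \<Rightarrow> (nat \<Rightarrow> ('k \<Rightarrow> 'k) set) \<Rightarrow>
    (nat \<Rightarrow> ('k \<Rightarrow> 'k) \<Rightarrow> complex) \<Rightarrow> (nat \<Rightarrow> 'k \<Rightarrow> 'k) star_algebra" where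
  "multiplier_algebra \<omega> K M \<phi> =
     (linf_algebra K M)\<lparr>carrier := ocneanu_multiplier \<omega> K M \<phi>\<rparr>"

text \<open>The ring structure is that of \<^const>\<open>FactRing\<close>, which does not carry over the
  scalar multiplication and the involution.\<close>

definition quotient_star_algebra :: "'a star_algebra \<Rightarrow> 'a set \<Rightarrow> 'a set star_algebra" where
  "quotient_star_algebra A I =
     \<lparr>carrier = carrier (A Quot I), mult = mult (A Quot I), one = one (A Quot I),
      zero = zero (A Quot I), add = add (A Quot I),
      smult = (\<lambda>c X. \<Union>x\<in>X. I +>\<^bsub>A\<^esub> (c \<odot>\<^bsub>A\<^esub> x)),
      adj = (\<lambda>X. \<Union>x\<in>X. I +>\<^bsub>A\<^esub> adj A x)\<rparr>"

definition ocneanu_ultraproduct ::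
  "nat filter \<Rightarrow> (nat \<Rightarrow> 'k hilbert) \<Rightarrow> (nat \<Rightarrow> ('k \<Rightarrow> 'k) set) \<Rightarrow>
    (nat \<Rightarrow> ('k \<Rightarrow> 'k) \<Rightarrow> complex) \<Rightarrow> (nat \<Rightarrow> 'k \<Rightarrow> 'k) set star_algebra" where
  "ocneanu_ultraproduct \<omega> K M \<phi> =
     quotient_star_algebra (multiplier_algebra \<omega> K M \<phi>) (ocneanu_ideal \<omega> K M \<phi>)"

definition ocneanu_class ::
  "nat filter \<Rightarrow> (nat \<Rightarrow> 'k hilbert) \<Rightarrow> (nat \<Rightarrow> ('k \<Rightarrow> 'k) set) \<Rightarrow>
    (nat \<Rightarrow> ('k \<Rightarrow> 'k) \<Rightarrow> complex) \<Rightarrow> (nat \<Rightarrow> 'k \<Rightarrow> 'k) \<Rightarrow> (nat \<Rightarrow> 'k \<Rightarrow> 'k) set" where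
  "ocneanu_class \<omega> K M \<phi> x =
     ocneanu_ideal \<omega> K M \<phi> +>\<^bsub>multiplier_algebra \<omega> K M \<phi>\<^esub> x"

section \<open>The Groh--Raynaud ultraproduct\<close>

definition bounded_seqs :: "(nat \<Rightarrow> 'h hilbert) \<Rightarrow> (nat \<Rightarrow> 'h) set" where
  "bounded_seqs H =
     {\<xi>. (\<forall>n. \<xi> n \<in> carrier (H n)) \<and> (\<exists>C. \<forall>n. hnorm (H n) (\<xi> n) \<le> C)}"

definition vec_class :: "nat filter \<Rightarrow> (nat \<Rightarrow> 'h hilbert) \<Rightarrow> (nat \<Rightarrow> 'h) \<Rightarrow> (nat \<Rightarrow> 'h) set" where
  "vec_class \<omega> H \<xi> =
     {\<eta> \<in> bounded_seqs H. ((\<lambda>n. hnorm (H n) (\<eta> n \<ominus>\<^bsub>H n\<^esub> \<xi> n)) \<longlongrightarrow> 0) \<omega>}"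

definition hilbert_ultraproduct ::
  "nat filter \<Rightarrow> (nat \<Rightarrow> 'h hilbert) \<Rightarrow> (nat \<Rightarrow> 'h) set hilbert" where
  "hilbert_ultraproduct \<omega> H =
     \<lparr>carrier = vec_class \<omega> H ` bounded_seqs H,
      mult = undefined, one = undefined,
      zero = vec_class \<omega> H (\<lambda>n. \<zero>\<^bsub>H n\<^esub>),
      add = (\<lambda>X Y. \<Union>\<xi>\<in>X. \<Union>\<eta>\<in>Y. vec_class \<omega> H (\<lambda>n. \<xi> n \<oplus>\<^bsub>H n\<^esub> \<eta> n)),
      smult = (\<lambda>c X. \<Union>\<xi>\<in>X. vec_class \<omega> H (\<lambda>n. c \<odot>\<^bsub>H n\<^esub> \<xi> n)),
      ip = (\<lambda>X Y. THE c. \<forall>\<xi>\<in>X. \<forall>\<eta>\<in>Y. ((\<lambda>n. ip (H n) (\<xi> n) (\<eta> n)) \<longlongrightarrow> c) \<omega>)\<rparr>"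

definition op_class ::
  "nat filter \<Rightarrow> (nat \<Rightarrow> 'h hilbert) \<Rightarrow> (nat \<Rightarrow> 'h \<Rightarrow> 'h) \<Rightarrow> ((nat \<Rightarrow> 'h) set \<Rightarrow> (nat \<Rightarrow> 'h) set)" where
  "op_class \<omega> H a =
     (\<lambda>X\<in>carrier (hilbert_ultraproduct \<omega> H). \<Union>\<xi>\<in>X. vec_class \<omega> H (\<lambda>n. a n (\<xi> n)))"

definition groh_raynaud_ultraproduct ::
  "nat filter \<Rightarrow> (nat \<Rightarrow> 'k hilbert) \<Rightarrow> (nat \<Rightarrow> ('k \<Rightarrow> 'k) set) \<Rightarrow> (nat \<Rightarrow> 'h hilbert) \<Rightarrow>
    (nat \<Rightarrow> ('k \<Rightarrow> 'k) \<Rightarrow> ('h \<Rightarrow> 'h)) \<Rightarrow> ((nat \<Rightarrow> 'h) set \<Rightarrow> (nat \<Rightarrow> 'h) set) set" where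
  "groh_raynaud_ultraproduct \<omega> K M H \<pi> =
     sot_closure (hilbert_ultraproduct \<omega> H)
       {op_class \<omega> H (\<lambda>n. \<pi> n (x n)) | x. x \<in> linf K M}"

end

theory Submission
  imports Defs
begin

text \<open>
  Let \<open>\<Xi>\<close> be the class of the cyclic vectors and \<open>p\<close> the projection onto the set of all vectors killed by
  every \<open>T \<in> N\<close> with \<open>T \<Xi> = 0\<close>. By the bicommutant theorem \<open>p \<in> N\<close>, and \<open>T \<Xi> = 0\<close> if and only if
  \<open>T p = 0\<close>. Since \<open>\<parallel>x\<^sub>n\<parallel>\<^sup>\<sharp>\<close> is the norm of \<open>(x\<^sub>n \<xi>\<^sub>n, x\<^sub>n\<^sup>* \<xi>\<^sub>n)\<close>, a bounded sequence lies in the ideal if and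
  only if its operator \<open>x\<close> on the ultraproduct satisfies \<open>x p = p x = 0\<close>.

  The rest is a Kaplansky density argument combined with countable saturation. A self-adjoint \<open>T \<in> N\<close> is
  approximated on finitely many vectors by operators of bounded sequences of self-adjoint elements \<open>c\<^sub>n\<close>;
  rational functions of \<open>c\<^sub>n\<close> with denominator \<open>1 + c\<^sub>n\<^sup>2\<close> make the bounds independent of the quality of the
  approximation, and saturation turns approximation into equality. For \<open>T = 1 - p\<close> this yields, for each
  \<open>\<eta>\<close> with \<open>p \<eta> = 0\<close>, an element \<open>y\<close> of the ideal with \<open>y \<eta> = \<eta>\<close>, so that multipliers commute with \<open>p\<close>.
  For general \<open>T\<close> it yields a bounded sequence agreeing with \<open>T\<close> and \<open>T\<^sup>*\<close> at \<open>\<Xi>\<close>, whence surjectivity.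
\<close>

section \<open>Hilbert spaces and their operators\<close>

text \<open>The obstacle is boundedness: strong approximation of \<open>T \<in> N\<close> yields
  operators whose norms may grow with the accuracy, while saturation produces an element of
  \<open>linf\<close> only if all approximants obey one fixed bound. Instead of a full functional
  calculus only the resolvent d of 1 + c^2 is built, and two functions of c are used. The function 2
  t^2 / (1 + t^2) fixes 0 and 1, so it does not move a projection, and a single application settles
  1 - p. The function 2 t / (1 + t^2) does move a general contraction T, but at the argument T / 2
  it moves it by T' / 4 with T' again a self-adjoint contraction, and iteration gives a geometric
  series. A second obstacle is that the adjoint is not strongly continuous: self-adjoint
  approximants come from an orthogonality argument over the reals and not from averaging.
  Self-adjointness in turn halves the work in the ideal, where conditions are imposed on an operator
  and on its adjoint at \<Xi>.\<close>

lemma complex_ring_simps [simp]: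
  "carrier complex_ring = UNIV" "mult complex_ring = (*)" "one complex_ring = 1"
  "zero complex_ring = 0" "add complex_ring = (+)"
  by (simp_all add: complex_ring_def)

lemma cring_complex_ring: "cring complex_ring"
proof (rule cringI)
  show "abelian_group complex_ring"
  proof (rule abelian_groupI)
    fix x assume "x \<in> carrier complex_ring"
    show "\<exists>y\<in>carrier complex_ring. y \<oplus>\<^bsub>complex_ring\<^esub> x = \<zero>\<^bsub>complex_ring\<^esub>"
      by (rule bexI[of _ "- x"]) auto
  qed auto
  show "comm_monoid complex_ring"
    by (rule comm_monoidI) auto
qed (auto simp: algebra_simps)

text \<open>\<open>\<ominus>\<close> is defined from the additive inverse, which has no formula in a
  concrete record. With subtraction written as adding the multiple by -1, finite powers and
  ultraproducts can be checked from their own operations alone; uniqueness of inverses converts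
  back.\<close>

lemma hilbert_spaceI:
  fixes H :: "'a hilbert" (structure)
  assumes zero_closed: "\<zero> \<in> carrier H"
    and add_closed: "\<And>x y. \<lbrakk>x \<in> carrier H; y \<in> carrier H\<rbrakk> \<Longrightarrow> x \<oplus> y \<in> carrier H"
    and scale_closed: "\<And>x c. x \<in> carrier H \<Longrightarrow> c \<odot> x \<in> carrier H"
    and add_assoc: "\<And>x y z. \<lbrakk>x \<in> carrier H; y \<in> carrier H; z \<in> carrier H\<rbrakk> \<Longrightarrow> (x \<oplus> y) \<oplus> z = x \<oplus> (y \<oplus> z)"
    and add_commute: "\<And>x y. \<lbrakk>x \<in> carrier H; y \<in> carrier H\<rbrakk> \<Longrightarrow> x \<oplus> y = y \<oplus> x"
    and zero_add: "\<And>x. x \<in> carrier H \<Longrightarrow> \<zero> \<oplus> x = x"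
    and neg_add: "\<And>x. x \<in> carrier H \<Longrightarrow> (-1) \<odot> x \<oplus> x = \<zero>"
    and add_scale: "\<And>a b x. x \<in> carrier H \<Longrightarrow> (a + b) \<odot> x = a \<odot> x \<oplus> b \<odot> x"
    and scale_add: "\<And>a x y. \<lbrakk>x \<in> carrier H; y \<in> carrier H\<rbrakk> \<Longrightarrow> a \<odot> (x \<oplus> y) = a \<odot> x \<oplus> a \<odot> y"
    and mult_scale: "\<And>a b x. x \<in> carrier H \<Longrightarrow> (a * b) \<odot> x = a \<odot> (b \<odot> x)"
    and one_scale: "\<And>x. x \<in> carrier H \<Longrightarrow> 1 \<odot> x = x"
    and ip_add: "\<And>x y z. \<lbrakk>x \<in> carrier H; y \<in> carrier H; z \<in> carrier H\<rbrakk>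
        \<Longrightarrow> ip H (x \<oplus> y) z = ip H x z + ip H y z"
    and ip_scale: "\<And>c x y. \<lbrakk>x \<in> carrier H; y \<in> carrier H\<rbrakk> \<Longrightarrow> ip H (c \<odot> x) y = c * ip H x y"
    and ip_comm: "\<And>x y. \<lbrakk>x \<in> carrier H; y \<in> carrier H\<rbrakk> \<Longrightarrow> ip H x y = cnj (ip H y x)"
    and ip_pos: "\<And>x. x \<in> carrier H \<Longrightarrow> ip H x x \<in> \<real>\<^sub>\<ge>\<^sub>0"
    and ip_def: "\<And>x. \<lbrakk>x \<in> carrier H; ip H x x = 0\<rbrakk> \<Longrightarrow> x = \<zero>"
    and compl: "\<And>u. \<lbrakk>\<And>n. u n \<in> carrier H;
        \<And>e. e > 0 \<Longrightarrow> \<exists>k. \<forall>m\<ge>k. \<forall>n\<ge>k. hnorm H (u m \<oplus> (-1) \<odot> u n) < e\<rbrakk>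
        \<Longrightarrow> \<exists>x\<in>carrier H. (\<lambda>n. hnorm H (u n \<oplus> (-1) \<odot> x)) \<longlonglongrightarrow> 0"
  shows "hilbert_space H"
proof -
  have ag: "abelian_group H"
  proof (rule abelian_groupI)
    show "\<exists>y\<in>carrier H. y \<oplus> x = \<zero>" if "x \<in> carrier H" for x
      using scale_closed[OF that, of "-1"] neg_add[OF that] by blast
  qed (erule zero_closed add_closed add_assoc add_commute zero_add | assumption | rule zero_closed add_closed add_assoc add_commute)+
  have "module complex_ring H"
  proof (rule moduleI[OF cring_complex_ring ag])
  qed (simp_all only: complex_ring_simps scale_closed add_scale scale_add mult_scale one_scale)
  moreover have diff: "x \<ominus> y = x \<oplus> (-1) \<odot> y" if "x \<in> carrier H" "y \<in> carrier H" for x y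
    using abelian_group.minus_equality[OF ag neg_add[OF that(2)] that(2) scale_closed[OF that(2)]]
    by (simp add: a_minus_def)
  ultimately have "module complex_ring H" by blast
  moreover have "hilbert_space_axioms H"
  proof (rule hilbert_space_axioms.intro)
    show "ip H x y = cnj (ip H y x)" if "x \<in> carrier H" "y \<in> carrier H" for x y
      using that by (rule ip_comm)
    show "\<exists>x\<in>carrier H. (\<lambda>n. hnorm H (u n \<ominus> x)) \<longlonglongrightarrow> 0"
      if "\<And>n. u n \<in> carrier H" "\<And>e. e > 0 \<Longrightarrow> \<exists>k. \<forall>m\<ge>k. \<forall>n\<ge>k. hnorm H (u m \<ominus> u n) < e" for u
    proof -
      have "\<exists>x\<in>carrier H. (\<lambda>n. hnorm H (u n \<oplus> (-1) \<odot> x)) \<longlonglongrightarrow> 0"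
        by (rule compl) (use that in \<open>simp_all flip: diff\<close>)
      then show ?thesis using diff that(1) by simp
    qed
  qed (simp_all only: ip_add ip_scale ip_pos ip_def)
  ultimately show ?thesis by (rule hilbert_space.intro)
qed

context hilbert_space
begin

lemma scale_closed [simp, intro]: "x \<in> carrier H \<Longrightarrow> c \<odot> x \<in> carrier H"
  using smult_closed by simp

lemma scale_one [simp]: "x \<in> carrier H \<Longrightarrow> 1 \<odot> x = x"
  using smult_one by simp

lemma scale_scale: "x \<in> carrier H \<Longrightarrow> a \<odot> (b \<odot> x) = (a * b) \<odot> x"
  using smult_assoc1[of a b x] by simp

lemma scale_zero [simp]: "c \<odot> \<zero> = \<zero>"
  using smult_r_null by simp

lemma zero_scale [simp]: "x \<in> carrier H \<Longrightarrow> 0 \<odot> x = \<zero>"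
  using smult_l_null by simp

lemma scale_minus: "x \<in> carrier H \<Longrightarrow> (-1) \<odot> x = \<ominus> x"
proof -
  assume x: "x \<in> carrier H"
  have "(-1) \<odot> x \<oplus> x = (-1 + 1) \<odot> x"
    using smult_l_distr[of "-1" 1 x] x by simp
  then have "(-1) \<odot> x \<oplus> x = \<zero>" using x by simp
  then show ?thesis using x by (simp add: M.minus_equality)
qed

lemma diff_eq: "\<lbrakk>x \<in> carrier H; y \<in> carrier H\<rbrakk> \<Longrightarrow> x \<ominus> y = x \<oplus> (-1) \<odot> y"
  by (simp add: scale_minus M.minus_eq)

lemma ip_add_right:
  "\<lbrakk>x \<in> carrier H; y \<in> carrier H; z \<in> carrier H\<rbrakk> \<Longrightarrow> ip H x (y \<oplus> z) = ip H x y + ip H x z"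
  using ip_commute[of x "y \<oplus> z"] ip_commute[of x y] ip_commute[of x z] by (simp add: ip_add_left)

lemma ip_scale_right:
  "\<lbrakk>x \<in> carrier H; y \<in> carrier H\<rbrakk> \<Longrightarrow> ip H x (c \<odot> y) = cnj c * ip H x y"
  using ip_commute[of x "c \<odot> y"] ip_commute[of x y] by (simp add: ip_scale_left)

lemma ip_diff_left:
  "\<lbrakk>x \<in> carrier H; y \<in> carrier H; z \<in> carrier H\<rbrakk> \<Longrightarrow> ip H (x \<ominus> y) z = ip H x z - ip H y z"
  by (simp add: diff_eq ip_add_left ip_scale_left)

lemma ip_diff_right:
  "\<lbrakk>x \<in> carrier H; y \<in> carrier H; z \<in> carrier H\<rbrakk> \<Longrightarrow> ip H z (x \<ominus> y) = ip H z x - ip H z y"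
  by (simp add: diff_eq ip_add_right ip_scale_right)

lemma ip_zero_left [simp]: "x \<in> carrier H \<Longrightarrow> ip H \<zero> x = 0"
  using ip_scale_left[of x x 0] by simp

lemma ip_zero_right [simp]: "x \<in> carrier H \<Longrightarrow> ip H x \<zero> = 0"
  using ip_scale_right[of x x 0] by simp

lemma ip_cnj: "\<lbrakk>x \<in> carrier H; y \<in> carrier H\<rbrakk> \<Longrightarrow> cnj (ip H x y) = ip H y x"
  using ip_commute by metis

lemma Re_ip_commute: "\<lbrakk>x \<in> carrier H; y \<in> carrier H\<rbrakk> \<Longrightarrow> Re (ip H x y) = Re (ip H y x)"
  using ip_commute[of x y] by simp

lemmas ip_simps = ip_add_left ip_add_right ip_scale_left ip_scale_right ip_diff_left ip_diff_right

lemma diff_eq_zero: "\<lbrakk>x \<in> carrier H; y \<in> carrier H\<rbrakk> \<Longrightarrow> x \<ominus> y = \<zero> \<longleftrightarrow> x = y"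
proof
  assume *: "x \<in> carrier H" "y \<in> carrier H" "x \<ominus> y = \<zero>"
  have "(x \<ominus> y) \<oplus> y = x" unfolding M.minus_eq using *(1,2) by (simp add: M.a_assoc M.l_neg)
  then show "x = y" using * by simp
qed (simp add: M.minus_eq M.r_neg)

text \<open>Pairing with a test vector turns an identity of vectors into one of complex numbers,
  where \<open>ip_simps\<close> and ordinary arithmetic suffice; this replaces rewriting in a module
  with explicit carrier.\<close>

lemma vec_eqI:
  assumes "x \<in> carrier H" "y \<in> carrier H" "\<And>z. z \<in> carrier H \<Longrightarrow> ip H x z = ip H y z"
  shows "x = y"
proof -
  have "ip H (x \<ominus> y) (x \<ominus> y) = 0"
    using assms(3)[of "x \<ominus> y"] assms(1,2) by (simp add: ip_diff_left)
  then have "x \<ominus> y = \<zero>" using assms ip_definite by blast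
  then show ?thesis using assms by (simp add: diff_eq_zero)
qed

lemma ip_self: "x \<in> carrier H \<Longrightarrow> ip H x x = of_real ((hnorm H x)\<^sup>2)"
  using ip_nonneg[of x] by (auto simp: hnorm_def complex_nonneg_Reals_iff complex_eq_iff)

lemma hnorm_nonneg [simp]: "x \<in> carrier H \<Longrightarrow> 0 \<le> hnorm H x"
  using ip_nonneg[of x] by (auto simp: hnorm_def complex_nonneg_Reals_iff)

lemma hnorm_sq: "x \<in> carrier H \<Longrightarrow> (hnorm H x)\<^sup>2 = Re (ip H x x)"
  by (simp add: ip_self)

lemma hnorm_eq_0 [simp]: "x \<in> carrier H \<Longrightarrow> hnorm H x = 0 \<longleftrightarrow> x = \<zero>"
  using ip_self[of x] ip_definite[of x] by (auto simp: hnorm_def)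

lemma hnorm_zero [simp]: "hnorm H \<zero> = 0"
  by simp

lemma hnorm_scale [simp]: "x \<in> carrier H \<Longrightarrow> hnorm H (c \<odot> x) = cmod c * hnorm H x"
proof -
  assume x: "x \<in> carrier H"
  have "(hnorm H (c \<odot> x))\<^sup>2 = Re ((c * cnj c) * ip H x x)"
    using x by (simp add: hnorm_sq ip_scale_left ip_scale_right mult.assoc mult.left_commute del: complex_mult_cnj)
  also have "\<dots> = (cmod c * hnorm H x)\<^sup>2"
    using x by (simp add: ip_self complex_norm_square[symmetric] power_mult_distrib del: of_real_power)
  finally show ?thesis using x by (simp add: power2_eq_iff_nonneg)
qed

lemma hnorm_add_sq:
  "\<lbrakk>x \<in> carrier H; y \<in> carrier H\<rbrakk> \<Longrightarrow>
    (hnorm H (x \<oplus> y))\<^sup>2 = (hnorm H x)\<^sup>2 + 2 * Re (ip H x y) + (hnorm H y)\<^sup>2"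
  using Re_ip_commute[of x y] by (simp add: hnorm_sq ip_simps)

lemma hnorm_diff_sq:
  "\<lbrakk>x \<in> carrier H; y \<in> carrier H\<rbrakk> \<Longrightarrow>
    (hnorm H (x \<ominus> y))\<^sup>2 = (hnorm H x)\<^sup>2 - 2 * Re (ip H x y) + (hnorm H y)\<^sup>2"
  using Re_ip_commute[of x y] by (simp add: hnorm_sq ip_simps)

lemma cauchy_schwarz:
  assumes x: "x \<in> carrier H" and y: "y \<in> carrier H"
  shows "cmod (ip H x y) \<le> hnorm H x * hnorm H y"
proof (cases "y = \<zero>")
  case True then show ?thesis using x by simp
next
  case False
  let ?n = "(hnorm H y)\<^sup>2"
  have n: "?n > 0" using False y by simp
  \<comment> \<open>\<open>c \<odot> y\<close> is the orthogonal projection of x to the line through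
    y, which makes the squared distance below as small as possible.\<close>
  define c where "c = ip H x y / of_real ?n"
  have "0 \<le> (hnorm H (x \<ominus> c \<odot> y))\<^sup>2" by simp
  also have "\<dots> = (hnorm H x)\<^sup>2 - 2 * Re (cnj c * ip H x y) + (cmod c)\<^sup>2 * ?n"
    using x y by (simp add: hnorm_diff_sq ip_simps power_mult_distrib)
  also have "cnj c * ip H x y = of_real ((cmod (ip H x y))\<^sup>2 / ?n)"
    by (simp add: c_def complex_norm_square mult.commute del: of_real_power)
  also have "(cmod c)\<^sup>2 * ?n = (cmod (ip H x y))\<^sup>2 / ?n"
    using n by (simp add: c_def norm_divide norm_power power_divide) (simp add: power2_eq_square power4_eq_xxxx)
  finally have "(cmod (ip H x y))\<^sup>2 \<le> (hnorm H x * hnorm H y)\<^sup>2"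
    using n by (simp add: field_simps power_mult_distrib)
  then show ?thesis using x y by (simp add: power2_le_iff_abs_le)
qed

lemma hnorm_triangle:
  assumes x: "x \<in> carrier H" and y: "y \<in> carrier H"
  shows "hnorm H (x \<oplus> y) \<le> hnorm H x + hnorm H y"
proof -
  have "Re (ip H x y) \<le> hnorm H x * hnorm H y"
    using cauchy_schwarz[OF x y] complex_Re_le_cmod order_trans by blast
  then have "(hnorm H (x \<oplus> y))\<^sup>2 \<le> (hnorm H x + hnorm H y)\<^sup>2"
    using x y by (simp add: hnorm_add_sq power2_sum)
  then show ?thesis using x y by (simp add: power2_le_iff_abs_le)
qed

lemma hnorm_minus_commute:
  "\<lbrakk>x \<in> carrier H; y \<in> carrier H\<rbrakk> \<Longrightarrow> hnorm H (x \<ominus> y) = hnorm H (y \<ominus> x)"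
proof -
  assume *: "x \<in> carrier H" "y \<in> carrier H"
  then have "(hnorm H (x \<ominus> y))\<^sup>2 = (hnorm H (y \<ominus> x))\<^sup>2"
    by (simp add: hnorm_diff_sq Re_ip_commute[of x y])
  then show ?thesis using * by (simp add: power2_eq_iff_nonneg)
qed

lemma hnorm_diff_triangle:
  assumes "x \<in> carrier H" "y \<in> carrier H" "z \<in> carrier H"
  shows "hnorm H (x \<ominus> z) \<le> hnorm H (x \<ominus> y) + hnorm H (y \<ominus> z)"
proof -
  have "x \<ominus> z = (x \<ominus> y) \<oplus> (y \<ominus> z)"
    by (rule vec_eqI) (use assms in \<open>simp_all add: ip_simps\<close>)
  then show ?thesis using hnorm_triangle[of "x \<ominus> y" "y \<ominus> z"] assms by simp
qed

lemma diff_zero [simp]: "x \<in> carrier H \<Longrightarrow> x \<ominus> \<zero> = x"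
  by (rule vec_eqI) (simp_all add: ip_simps)

lemma hnorm_le_diff:
  assumes "x \<in> carrier H" "y \<in> carrier H"
  shows "hnorm H x \<le> hnorm H (x \<ominus> y) + hnorm H y"
  using hnorm_diff_triangle[of x y \<zero>] assms by (simp del: M.minus_closed)

lemma hnorm_triangle_diff:
  assumes "x \<in> carrier H" "y \<in> carrier H"
  shows "hnorm H (x \<ominus> y) \<le> hnorm H x + hnorm H y"
  using hnorm_triangle[of x "(-1) \<odot> y"] assms by (simp add: diff_eq)

lemma diff_self [simp]: "x \<in> carrier H \<Longrightarrow> x \<ominus> x = \<zero>"
  by (simp add: M.minus_eq M.r_neg)

lemma hnorm_diff_eq_0: "\<lbrakk>x \<in> carrier H; y \<in> carrier H\<rbrakk> \<Longrightarrow> hnorm H (x \<ominus> y) = 0 \<longleftrightarrow> x = y"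
  by (simp add: diff_eq_zero)

lemma vec_eq_small:
  assumes "x \<in> carrier H" "y \<in> carrier H" "\<And>e. e > 0 \<Longrightarrow> hnorm H (x \<ominus> y) \<le> e"
  shows "x = y"
proof -
  have "hnorm H (x \<ominus> y) \<le> 0" by (rule field_le_epsilon) (use assms in simp)
  then have "hnorm H (x \<ominus> y) = 0" using hnorm_nonneg[of "x \<ominus> y"] assms by (intro antisym) auto
  then show ?thesis using hnorm_diff_eq_0 assms by blast
qed

lemma hnorm_sum_diff_le:
  assumes "a \<in> carrier H" "b \<in> carrier H" "x \<in> carrier H" "y \<in> carrier H"
  shows "hnorm H ((a \<oplus> b) \<ominus> (x \<oplus> y)) \<le> hnorm H (a \<ominus> x) + hnorm H (b \<ominus> y)"
proof -
  have "(a \<oplus> b) \<ominus> (x \<oplus> y) = (a \<ominus> x) \<oplus> (b \<ominus> y)"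
    by (rule vec_eqI) (use assms in \<open>simp_all add: ip_simps\<close>)
  then show ?thesis using hnorm_triangle[of "a \<ominus> x" "b \<ominus> y"] assms by simp
qed

lemma scale_diff:
  assumes "x \<in> carrier H" "y \<in> carrier H"
  shows "c \<odot> (x \<ominus> y) = c \<odot> x \<ominus> c \<odot> y"
  by (rule vec_eqI) (use assms in \<open>simp_all add: ip_simps algebra_simps\<close>)

lemma hnorm_scale_diff:
  assumes "x \<in> carrier H" "y \<in> carrier H"
  shows "hnorm H (c \<odot> x \<ominus> c \<odot> y) = cmod c * hnorm H (x \<ominus> y)"
  using assms by (simp flip: scale_diff)

text \<open>Only real scalars are demanded because V will also consist of values of self-adjoint
  operators. The limit l of a minimizing sequence need not belong to V, so it is described by
  approximation, and orthogonality concerns real parts.\<close>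

lemma real_subspace_projection:
  assumes V: "V \<subseteq> carrier H" "\<zero> \<in> V" "\<And>x y. \<lbrakk>x \<in> V; y \<in> V\<rbrakk> \<Longrightarrow> x \<oplus> y \<in> V"
    "\<And>r x. x \<in> V \<Longrightarrow> complex_of_real r \<odot> x \<in> V"
    and t: "t \<in> carrier H"
  shows "\<exists>l\<in>carrier H. (\<forall>e>0. \<exists>v\<in>V. hnorm H (l \<ominus> v) < e) \<and> (\<forall>v\<in>V. Re (ip H v (t \<ominus> l)) = 0)"
proof -
  define d where "d = (INF v\<in>V. (hnorm H (t \<ominus> v))\<^sup>2)"
  have bdd: "bdd_below ((\<lambda>v. (hnorm H (t \<ominus> v))\<^sup>2) ` V)" by (rule bdd_belowI[of _ 0]) auto
  have dle: "d \<le> (hnorm H (t \<ominus> v))\<^sup>2" if "v \<in> V" for v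
    unfolding d_def using bdd that by (rule cINF_lower)
  have "\<exists>v\<in>V. (hnorm H (t \<ominus> v))\<^sup>2 < d + inverse (real (Suc n))" for n
    using cINF_less_iff[of V "\<lambda>v. (hnorm H (t \<ominus> v))\<^sup>2" "d + inverse (real (Suc n))"] V(2) bdd
    by (auto simp: d_def)
  then obtain u where uV: "\<And>n. u n \<in> V" and u: "\<And>n. (hnorm H (t \<ominus> u n))\<^sup>2 < d + inverse (real (Suc n))"
    by metis
  have uc: "u n \<in> carrier H" for n using uV V(1) by auto
  \<comment> \<open>Parallelogram law: the midpoint of x and y lies in V, so its distance from t
    contributes the term 4 * d.\<close>
  have par: "(hnorm H (x \<ominus> y))\<^sup>2 \<le> 2 * (hnorm H (t \<ominus> x))\<^sup>2 + 2 * (hnorm H (t \<ominus> y))\<^sup>2 - 4 * d"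
    if "x \<in> V" "y \<in> V" for x y
  proof -
    have c: "x \<in> carrier H" "y \<in> carrier H" using that V(1) by auto
    have "complex_of_real (1/2) \<odot> (x \<oplus> y) \<in> V" using that V(3,4) by blast
    then have "d \<le> (hnorm H (t \<ominus> complex_of_real (1/2) \<odot> (x \<oplus> y)))\<^sup>2" by (rule dle)
    also have "\<dots> = (hnorm H t)\<^sup>2 - Re (ip H t x) - Re (ip H t y) +
        ((hnorm H x)\<^sup>2 + 2 * Re (ip H x y) + (hnorm H y)\<^sup>2) / 4"
      using c t by (simp add: hnorm_diff_sq ip_simps power_divide hnorm_add_sq field_simps)
    finally have "4 * d \<le> 4 * (hnorm H t)\<^sup>2 - 4 * Re (ip H t x) - 4 * Re (ip H t y) +
        ((hnorm H x)\<^sup>2 + 2 * Re (ip H x y) + (hnorm H y)\<^sup>2)" by argo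
    then show ?thesis using c t by (simp add: hnorm_diff_sq)
  qed
  have cauchy: "\<exists>k. \<forall>m\<ge>k. \<forall>n\<ge>k. hnorm H (u m \<ominus> u n) < e" if e: "e > 0" for e
  proof -
    have "e\<^sup>2 / 4 > 0" using e by simp
    then obtain k where k: "inverse (real (Suc k)) < e\<^sup>2 / 4" using reals_Archimedean by blast
    have "hnorm H (u m \<ominus> u n) < e" if "m \<ge> k" "n \<ge> k" for m n
    proof -
      have "inverse (real (Suc m)) \<le> inverse (real (Suc k))" "inverse (real (Suc n)) \<le> inverse (real (Suc k))"
        using that by (auto intro!: le_imp_inverse_le)
      then have "(hnorm H (u m \<ominus> u n))\<^sup>2 < e\<^sup>2"
        using par[OF uV uV, of m n] u[of m] u[of n] k by linarith
      then show ?thesis by (rule power2_less_imp_less) (use e in simp)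
    qed
    then show ?thesis by blast
  qed
  obtain l where l: "l \<in> carrier H" and lim: "(\<lambda>n. hnorm H (u n \<ominus> l)) \<longlonglongrightarrow> 0"
    using complete[OF uc cauchy] by blast
  have approx: "\<exists>v\<in>V. hnorm H (l \<ominus> v) < e" if e: "e > 0" for e
  proof -
    obtain n where "hnorm H (u n \<ominus> l) < e"
      using order_tendstoD(2)[OF lim e] by (auto simp: eventually_sequentially)
    then show ?thesis using uV hnorm_minus_commute[OF uc l] by metis
  qed
  have ld: "(hnorm H (t \<ominus> l))\<^sup>2 \<le> d"
  proof -
    have "(\<lambda>n. hnorm H (t \<ominus> u n)) \<longlonglongrightarrow> hnorm H (t \<ominus> l)"
    proof (rule LIM_zero_cancel, rule Lim_null_comparison[OF _ lim], rule always_eventually, rule allI)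
      fix n
      have "\<bar>hnorm H (t \<ominus> u n) - hnorm H (t \<ominus> l)\<bar> \<le> hnorm H (u n \<ominus> l)"
        using hnorm_diff_triangle[of t "u n" l] hnorm_diff_triangle[of t l "u n"]
          hnorm_minus_commute[of l "u n"] t l uc by force
      then show "norm (hnorm H (t \<ominus> u n) - hnorm H (t \<ominus> l)) \<le> hnorm H (u n \<ominus> l)" by simp
    qed
    then have "(\<lambda>n. (hnorm H (t \<ominus> u n))\<^sup>2) \<longlonglongrightarrow> (hnorm H (t \<ominus> l))\<^sup>2" by (intro tendsto_intros)
    moreover have "(\<lambda>n. d + inverse (real (Suc n))) \<longlonglongrightarrow> d"
      using tendsto_add[OF tendsto_const LIMSEQ_inverse_real_of_nat, of d] by simp
    ultimately show ?thesis
      by (rule LIMSEQ_le) (use u in \<open>auto intro: less_imp_le\<close>)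
  qed
  have orth: "Re (ip H v (t \<ominus> l)) = 0" if v: "v \<in> V" for v
  proof -
    have vc: "v \<in> carrier H" using v V(1) by auto
    \<comment> \<open>No vector l + s v is nearer to t than l. Since l may lie outside V, it is
      replaced by a nearby w in V at the cost of e.\<close>
    have ge: "hnorm H (t \<ominus> l) \<le> hnorm H ((t \<ominus> l) \<ominus> complex_of_real s \<odot> v)" for s
    proof (rule field_le_epsilon)
      fix e :: real assume "e > 0"
      then obtain w where w: "w \<in> V" "hnorm H (l \<ominus> w) < e" using approx by blast
      then have wc: "w \<in> carrier H" using V(1) by auto
      have "(hnorm H (t \<ominus> l))\<^sup>2 \<le> (hnorm H (t \<ominus> (w \<oplus> complex_of_real s \<odot> v)))\<^sup>2"
        using ld dle[OF V(3)[OF w(1) V(4)[OF v]], of s] by linarith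
      then have "hnorm H (t \<ominus> l) \<le> hnorm H (t \<ominus> (w \<oplus> complex_of_real s \<odot> v))"
        using t l wc vc by (simp add: power2_le_iff_abs_le)
      also have "t \<ominus> (w \<oplus> complex_of_real s \<odot> v) = ((t \<ominus> l) \<ominus> complex_of_real s \<odot> v) \<oplus> (l \<ominus> w)"
        by (rule vec_eqI) (use t l wc vc in \<open>simp_all add: ip_simps\<close>)
      also have "hnorm H \<dots> \<le> hnorm H ((t \<ominus> l) \<ominus> complex_of_real s \<odot> v) + hnorm H (l \<ominus> w)"
        by (rule hnorm_triangle) (use t l wc vc in simp_all)
      finally show "hnorm H (t \<ominus> l) \<le> hnorm H ((t \<ominus> l) \<ominus> complex_of_real s \<odot> v) + e"
        using w by simp
    qed
    define b where "b = Re (ip H v (t \<ominus> l))"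
    define a where "a = (hnorm H v)\<^sup>2 + 1"
    have quad: "2 * s * b \<le> s\<^sup>2 * (hnorm H v)\<^sup>2" for s
    proof -
      have "(hnorm H (t \<ominus> l))\<^sup>2 \<le> (hnorm H ((t \<ominus> l) \<ominus> complex_of_real s \<odot> v))\<^sup>2"
        using ge[of s] t l by (intro power_mono) auto
      then show ?thesis
        using t l vc Re_ip_commute[of v "t \<ominus> l"]
        by (simp add: hnorm_diff_sq[of "t \<ominus> l" "complex_of_real s \<odot> v"] ip_scale_right power_mult_distrib b_def)
    qed
    have a: "a > 0" by (simp add: a_def add_nonneg_pos)
    \<comment> \<open>At s = b/a the quadratic bound becomes 2 b^2 / a \<le> b^2 / a, which forces b
      = 0; the summand 1 in a covers v = \<zero>.\<close>
    have "2 * (b/a) * b \<le> (b/a)\<^sup>2 * (hnorm H v)\<^sup>2" by (rule quad)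
    also have "\<dots> \<le> (b/a)\<^sup>2 * a" by (rule mult_left_mono) (auto simp: a_def)
    finally have "b\<^sup>2 \<le> 0" using a by (simp add: field_simps power2_eq_square)
    then show ?thesis by (simp add: b_def)
  qed
  show ?thesis using l approx orth by blast
qed

lemma Re_ip_limit_zero:
  assumes "l \<in> carrier H" "z \<in> carrier H" "V \<subseteq> carrier H"
    and "\<And>e. e > 0 \<Longrightarrow> \<exists>v\<in>V. hnorm H (l \<ominus> v) < e" and "\<And>v. v \<in> V \<Longrightarrow> Re (ip H v z) = 0"
  shows "Re (ip H l z) = 0"
proof -
  have "\<bar>Re (ip H l z)\<bar> \<le> 0 + e" if "e > 0" for e
  proof -
    have "e / (hnorm H z + 1) > 0" using that assms(2) by (simp add: add_nonneg_pos)
    then obtain v where v: "v \<in> V" "hnorm H (l \<ominus> v) < e / (hnorm H z + 1)" using assms(4) by blast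
    have vc: "v \<in> carrier H" using v assms(3) by auto
    have "\<bar>Re (ip H l z)\<bar> = \<bar>Re (ip H (l \<ominus> v) z)\<bar>"
      using assms(1,2) vc assms(5)[OF v(1)] by (simp add: ip_simps)
    also have "\<dots> \<le> hnorm H (l \<ominus> v) * hnorm H z"
      using cauchy_schwarz[of "l \<ominus> v" z] assms(1,2) vc abs_Re_le_cmod order_trans by blast
    also have "\<dots> \<le> e / (hnorm H z + 1) * (hnorm H z + 1)"
      using v assms(1,2) vc by (intro mult_mono) (auto intro: order_trans[OF hnorm_nonneg less_imp_le])
    also have "\<dots> = e" using assms(2) hnorm_nonneg[of z] by (simp add: add_nonneg_eq_0_iff)
    finally show ?thesis by simp
  qed
  then show ?thesis using field_le_epsilon[of "\<bar>Re (ip H l z)\<bar>" 0] by simp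
qed

text \<open>The residual t - l of the projection l is orthogonal to V, hence by hypothesis to t and
  by approximation to l, so its norm vanishes. This takes the place of a separation theorem, both
  for self-adjoint operators and for the range of 1 + c^2.\<close>

lemma real_subspace_dense:
  assumes V: "V \<subseteq> carrier H" "\<zero> \<in> V" "\<And>x y. \<lbrakk>x \<in> V; y \<in> V\<rbrakk> \<Longrightarrow> x \<oplus> y \<in> V"
    "\<And>r x. x \<in> V \<Longrightarrow> complex_of_real r \<odot> x \<in> V"
    and t: "t \<in> carrier H"
    and orth: "\<And>z. \<lbrakk>z \<in> carrier H; \<And>v. v \<in> V \<Longrightarrow> Re (ip H v z) = 0\<rbrakk> \<Longrightarrow> Re (ip H t z) = 0"
    and e: "e > 0"
  shows "\<exists>v\<in>V. hnorm H (t \<ominus> v) < e"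
proof -
  obtain l where l: "l \<in> carrier H" and approx: "\<And>e. e > 0 \<Longrightarrow> \<exists>v\<in>V. hnorm H (l \<ominus> v) < e"
    and o: "\<And>v. v \<in> V \<Longrightarrow> Re (ip H v (t \<ominus> l)) = 0"
    using real_subspace_projection[OF V t] by blast
  have "Re (ip H t (t \<ominus> l)) = 0" using orth o t l by simp
  moreover have "Re (ip H l (t \<ominus> l)) = 0"
    by (rule Re_ip_limit_zero[OF _ _ V(1) approx o]) (use t l in auto)
  ultimately have "(hnorm H (t \<ominus> l))\<^sup>2 = 0"
    using t l hnorm_sq[of "t \<ominus> l"] ip_diff_left[of t l "t \<ominus> l"] by simp
  then have "t = l" using t l by (simp add: diff_eq_zero)
  then show ?thesis using approx e by blast
qed

end

section \<open>Bounded operators and their norms\<close>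

lemma op_algebra_simps [simp]:
  "carrier (op_algebra H) = bounded_ops H" "adj (op_algebra H) = adjoint H"
  by (simp_all add: op_algebra_def)

lemma op_algebra_apply [simp]:
  assumes "x \<in> carrier H"
  shows "(S \<otimes>\<^bsub>op_algebra H\<^esub> T) x = S (T x)"
    and "(S \<oplus>\<^bsub>op_algebra H\<^esub> T) x = S x \<oplus>\<^bsub>H\<^esub> T x"
    and "(c \<odot>\<^bsub>op_algebra H\<^esub> T) x = c \<odot>\<^bsub>H\<^esub> T x"
    and "\<one>\<^bsub>op_algebra H\<^esub> x = x"
    and "\<zero>\<^bsub>op_algebra H\<^esub> x = \<zero>\<^bsub>H\<^esub>"
  using assms by (simp_all add: op_algebra_def compose_def)

context hilbert_space
begin

lemma bounded_opsI:
  assumes "\<And>x. x \<in> carrier H \<Longrightarrow> T x \<in> carrier H" "\<And>x. x \<notin> carrier H \<Longrightarrow> T x = undefined"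
    and "\<And>x y. \<lbrakk>x \<in> carrier H; y \<in> carrier H\<rbrakk> \<Longrightarrow> T (x \<oplus> y) = T x \<oplus> T y"
    and "\<And>c x. x \<in> carrier H \<Longrightarrow> T (c \<odot> x) = c \<odot> T x"
    and "\<And>x. x \<in> carrier H \<Longrightarrow> hnorm H (T x) \<le> C * hnorm H x"
  shows "T \<in> bounded_ops H"
proof -
  have "T \<in> carrier H \<rightarrow>\<^sub>E carrier H" using assms(1,2) by (intro PiE_I)
  moreover have "\<exists>C. \<forall>x\<in>carrier H. hnorm H (T x) \<le> C * hnorm H x"
    using assms(5) by (intro exI[of _ C] ballI)
  ultimately show ?thesis
    unfolding bounded_ops_def by (intro CollectI conjI ballI allI assms(3,4))
qed

lemma bounded_opsD:
  assumes "T \<in> bounded_ops H"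
  shows op_closed [simp]: "x \<in> carrier H \<Longrightarrow> T x \<in> carrier H"
    and op_undefined: "x \<notin> carrier H \<Longrightarrow> T x = undefined"
    and op_add: "\<lbrakk>x \<in> carrier H; y \<in> carrier H\<rbrakk> \<Longrightarrow> T (x \<oplus> y) = T x \<oplus> T y"
    and op_scale: "x \<in> carrier H \<Longrightarrow> T (c \<odot> x) = c \<odot> T x"
    and op_bound_ex: "\<exists>C. \<forall>x\<in>carrier H. hnorm H (T x) \<le> C * hnorm H x"
proof -
  have T: "T \<in> carrier H \<rightarrow>\<^sub>E carrier H"
    and add: "\<forall>x\<in>carrier H. \<forall>y\<in>carrier H. T (x \<oplus> y) = T x \<oplus> T y"
    and scale: "\<forall>c. \<forall>x\<in>carrier H. T (c \<odot> x) = c \<odot> T x"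
    and bound: "\<exists>C. \<forall>x\<in>carrier H. hnorm H (T x) \<le> C * hnorm H x"
    using assms unfolding bounded_ops_def mem_Collect_eq by - (elim conjE, assumption)+
  show "x \<in> carrier H \<Longrightarrow> T x \<in> carrier H" using T by (rule PiE_mem)
  show "x \<notin> carrier H \<Longrightarrow> T x = undefined" using T by (rule PiE_arb)
  show "\<lbrakk>x \<in> carrier H; y \<in> carrier H\<rbrakk> \<Longrightarrow> T (x \<oplus> y) = T x \<oplus> T y"
    by (rule add[rule_format])
  show "x \<in> carrier H \<Longrightarrow> T (c \<odot> x) = c \<odot> T x"
    by (rule scale[rule_format])
  show "\<exists>C. \<forall>x\<in>carrier H. hnorm H (T x) \<le> C * hnorm H x" by (rule bound)
qed

lemma op_diff:
  "\<lbrakk>T \<in> bounded_ops H; x \<in> carrier H; y \<in> carrier H\<rbrakk> \<Longrightarrow> T (x \<ominus> y) = T x \<ominus> T y"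
  using op_add[of T x "(-1) \<odot> y"] op_scale[of T y "-1"] by (simp add: diff_eq)

lemma op_zero [simp]: "T \<in> bounded_ops H \<Longrightarrow> T \<zero> = \<zero>"
  using op_scale[of T \<zero> 0] by simp

lemma op_bound:
  assumes "T \<in> bounded_ops H"
  obtains C where "C > 0" "\<And>x. x \<in> carrier H \<Longrightarrow> hnorm H (T x) \<le> C * hnorm H x"
proof -
  obtain C where C: "\<And>x. x \<in> carrier H \<Longrightarrow> hnorm H (T x) \<le> C * hnorm H x"
    using op_bound_ex[OF assms] by blast
  show ?thesis
  proof (rule that[of "max C 1"])
    fix x assume x: "x \<in> carrier H"
    have "C * hnorm H x \<le> max C 1 * hnorm H x" using x by (intro mult_right_mono) auto
    then show "hnorm H (T x) \<le> max C 1 * hnorm H x" using C[OF x] by linarith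
  qed simp
qed

lemma op_eqI:
  assumes "S \<in> bounded_ops H" "T \<in> bounded_ops H" "\<And>x. x \<in> carrier H \<Longrightarrow> S x = T x"
  shows "S = T"
proof
  fix x show "S x = T x"
    using assms by (cases "x \<in> carrier H") (auto simp: op_undefined)
qed

lemma one_closed [simp]: "\<one>\<^bsub>op_algebra H\<^esub> \<in> bounded_ops H"
  by (rule bounded_opsI[of _ 1]) (auto simp: op_algebra_def)

lemma zero_op_closed [simp]: "\<zero>\<^bsub>op_algebra H\<^esub> \<in> bounded_ops H"
  by (rule bounded_opsI[of _ 0]) (auto simp: op_algebra_def)

lemma mult_op_closed [simp]:
  assumes S: "S \<in> bounded_ops H" and T: "T \<in> bounded_ops H"
  shows "S \<otimes>\<^bsub>op_algebra H\<^esub> T \<in> bounded_ops H"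
proof -
  obtain C where C: "C > 0" "\<And>x. x \<in> carrier H \<Longrightarrow> hnorm H (S x) \<le> C * hnorm H x"
    using op_bound[OF S] by blast
  obtain D where D: "D > 0" "\<And>x. x \<in> carrier H \<Longrightarrow> hnorm H (T x) \<le> D * hnorm H x"
    using op_bound[OF T] by blast
  show ?thesis
  proof (rule bounded_opsI[of _ "C * D"])
    fix x assume x: "x \<in> carrier H"
    have "hnorm H (S (T x)) \<le> C * hnorm H (T x)" using C T x by simp
    also have "\<dots> \<le> C * (D * hnorm H x)" using C(1) D(2)[OF x] by (intro mult_left_mono) auto
    finally show "hnorm H ((S \<otimes>\<^bsub>op_algebra H\<^esub> T) x) \<le> C * D * hnorm H x"
      using x by (simp add: mult.assoc)
  qed (use S T in \<open>auto simp: op_add op_scale op_algebra_def compose_def\<close>)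
qed

lemma add_op_closed [simp]:
  assumes S: "S \<in> bounded_ops H" and T: "T \<in> bounded_ops H"
  shows "S \<oplus>\<^bsub>op_algebra H\<^esub> T \<in> bounded_ops H"
proof -
  obtain C where C: "C > 0" "\<And>x. x \<in> carrier H \<Longrightarrow> hnorm H (S x) \<le> C * hnorm H x"
    using op_bound[OF S] by blast
  obtain D where D: "D > 0" "\<And>x. x \<in> carrier H \<Longrightarrow> hnorm H (T x) \<le> D * hnorm H x"
    using op_bound[OF T] by blast
  show ?thesis
  proof (rule bounded_opsI[of _ "C + D"])
    fix x assume x: "x \<in> carrier H"
    have "hnorm H (S x \<oplus> T x) \<le> C * hnorm H x + D * hnorm H x"
      using hnorm_triangle[of "S x" "T x"] C(2)[OF x] D(2)[OF x] S T x by force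
    then show "hnorm H ((S \<oplus>\<^bsub>op_algebra H\<^esub> T) x) \<le> (C + D) * hnorm H x"
      using x by (simp add: algebra_simps)
  next
    fix x y assume "x \<in> carrier H" "y \<in> carrier H"
    then show "(S \<oplus>\<^bsub>op_algebra H\<^esub> T) (x \<oplus> y) = (S \<oplus>\<^bsub>op_algebra H\<^esub> T) x \<oplus> (S \<oplus>\<^bsub>op_algebra H\<^esub> T) y"
      using S T by (intro vec_eqI) (simp_all add: op_add ip_simps)
  next
    fix c x assume "x \<in> carrier H"
    then show "(S \<oplus>\<^bsub>op_algebra H\<^esub> T) (c \<odot> x) = c \<odot> (S \<oplus>\<^bsub>op_algebra H\<^esub> T) x"
      using S T by (intro vec_eqI) (simp_all add: op_scale ip_simps algebra_simps)
  qed (use S T in \<open>auto simp: op_algebra_def\<close>)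
qed

lemma smult_op_closed [simp]:
  assumes T: "T \<in> bounded_ops H"
  shows "c \<odot>\<^bsub>op_algebra H\<^esub> T \<in> bounded_ops H"
proof -
  obtain C where C: "C > 0" "\<And>x. x \<in> carrier H \<Longrightarrow> hnorm H (T x) \<le> C * hnorm H x"
    using op_bound[OF T] by blast
  show ?thesis
  proof (rule bounded_opsI[of _ "cmod c * C"])
    fix x assume "x \<in> carrier H"
    then show "hnorm H ((c \<odot>\<^bsub>op_algebra H\<^esub> T) x) \<le> cmod c * C * hnorm H x"
      using T C(2)[of x] by (simp add: mult.assoc mult_left_mono)
  next
    fix x y assume "x \<in> carrier H" "y \<in> carrier H"
    then show "(c \<odot>\<^bsub>op_algebra H\<^esub> T) (x \<oplus> y) = (c \<odot>\<^bsub>op_algebra H\<^esub> T) x \<oplus> (c \<odot>\<^bsub>op_algebra H\<^esub> T) y"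
      using T by (intro vec_eqI) (simp_all add: op_add ip_simps algebra_simps)
  next
    fix d x assume "x \<in> carrier H"
    then show "(c \<odot>\<^bsub>op_algebra H\<^esub> T) (d \<odot> x) = d \<odot> (c \<odot>\<^bsub>op_algebra H\<^esub> T) x"
      using T by (intro vec_eqI) (simp_all add: op_scale ip_simps)
  qed (use T in \<open>auto simp: op_algebra_def\<close>)
qed

lemma hnorm_op_le:
  assumes T: "T \<in> bounded_ops H" and x: "x \<in> carrier H"
  shows "hnorm H (T x) \<le> opnorm H T * hnorm H x"
proof (cases "x = \<zero>")
  case True then show ?thesis using T by simp
next
  case False
  then have pos: "hnorm H x > 0" using x hnorm_nonneg[of x] hnorm_eq_0[of x] by linarith
  obtain C where C: "C > 0" "\<And>x. x \<in> carrier H \<Longrightarrow> hnorm H (T x) \<le> C * hnorm H x"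
    using op_bound[OF T] by blast
  let ?S = "{hnorm H (T x) | x. x \<in> carrier H \<and> hnorm H x \<le> 1}"
  \<comment> \<open>\<open>opnorm\<close> is a supremum of reals and carries information only
    because this set is bounded above.\<close>
  have bdd: "bdd_above ?S"
  proof (rule bdd_aboveI)
    fix r assume "r \<in> ?S"
    then obtain y where y: "r = hnorm H (T y)" "y \<in> carrier H" "hnorm H y \<le> 1" by blast
    then have "C * hnorm H y \<le> C * 1" using C(1) by (intro mult_left_mono) auto
    then show "r \<le> C" using C(2)[OF y(2)] y(1) by linarith
  qed
  define y where "y = complex_of_real (inverse (hnorm H x)) \<odot> x"
  have y: "y \<in> carrier H" "hnorm H y = 1"
    using x pos by (auto simp: y_def norm_inverse simp del: hnorm_eq_0)
  then have "hnorm H (T y) \<in> ?S" by force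
  then have "hnorm H (T y) \<le> opnorm H T" unfolding opnorm_def using bdd by (rule cSup_upper)
  moreover have "hnorm H (T y) = inverse (hnorm H x) * hnorm H (T x)"
    using T x pos by (simp add: y_def op_scale norm_inverse)
  ultimately show ?thesis using pos by (simp add: field_simps)
qed

lemma opnorm_le:
  assumes "C \<ge> 0" "\<And>x. x \<in> carrier H \<Longrightarrow> hnorm H (T x) \<le> C * hnorm H x"
  shows "opnorm H T \<le> C"
  unfolding opnorm_def
proof (rule cSup_least)
  show "{hnorm H (T x) | x. x \<in> carrier H \<and> hnorm H x \<le> 1} \<noteq> {}"
    using M.zero_closed hnorm_zero by force
  fix r assume "r \<in> {hnorm H (T x) | x. x \<in> carrier H \<and> hnorm H x \<le> 1}"
  then obtain y where y: "r = hnorm H (T y)" "y \<in> carrier H" "hnorm H y \<le> 1" by blast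
  then have "C * hnorm H y \<le> C * 1" using assms(1) by (intro mult_left_mono) auto
  then show "r \<le> C" using assms(2)[OF y(2)] y(1) by linarith
qed

subsection \<open>Orthogonal projections and adjoints\<close>

definition closed_subspace :: "'a set \<Rightarrow> bool" where
  "closed_subspace L \<longleftrightarrow> L \<subseteq> carrier H \<and> \<zero> \<in> L \<and> (\<forall>x\<in>L. \<forall>y\<in>L. x \<oplus> y \<in> L) \<and>
    (\<forall>c. \<forall>x\<in>L. c \<odot> x \<in> L) \<and>
    (\<forall>x\<in>carrier H. (\<forall>e>0. \<exists>v\<in>L. hnorm H (x \<ominus> v) < e) \<longrightarrow> x \<in> L)"

text \<open>Real orthogonality of the residual to both v and \<i> v is complex orthogonality to v,
  so the projection theorem over the reals suffices.\<close>

lemma closed_subspace_decomp: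
  assumes L: "closed_subspace L" and x: "x \<in> carrier H"
  shows "\<exists>l\<in>L. \<forall>v\<in>L. ip H v (x \<ominus> l) = 0"
proof -
  have sub: "L \<subseteq> carrier H" using L by (simp add: closed_subspace_def)
  obtain l where l: "l \<in> carrier H" "\<forall>e>0. \<exists>v\<in>L. hnorm H (l \<ominus> v) < e"
    and o: "\<forall>v\<in>L. Re (ip H v (x \<ominus> l)) = 0"
    using real_subspace_projection[of L x] L x by (auto simp: closed_subspace_def)
  have "ip H v (x \<ominus> l) = 0" if v: "v \<in> L" for v
  proof -
    have "\<i> \<odot> v \<in> L" using L v by (simp add: closed_subspace_def)
    then have "Re (ip H (\<i> \<odot> v) (x \<ominus> l)) = 0" using o by blast
    then have "Im (ip H v (x \<ominus> l)) = 0" using v sub l x by (auto simp: ip_scale_left subset_eq)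
    then show ?thesis using o v by (simp add: complex_eq_iff)
  qed
  moreover have "l \<in> L" using L l by (simp add: closed_subspace_def)
  ultimately show ?thesis by blast
qed

lemma orthogonal_projection:
  assumes L: "closed_subspace L"
  obtains P where "P \<in> bounded_ops H" "\<And>x. x \<in> carrier H \<Longrightarrow> P x \<in> L" "\<And>x. x \<in> L \<Longrightarrow> P x = x"
    "\<And>x y. \<lbrakk>x \<in> carrier H; y \<in> carrier H\<rbrakk> \<Longrightarrow> ip H (P x) y = ip H x (P y)"
proof -
  have sub: "v \<in> L \<Longrightarrow> v \<in> carrier H" for v using L by (auto simp: closed_subspace_def)
  obtain p where p: "\<And>x. x \<in> carrier H \<Longrightarrow> p x \<in> L"
    and o: "\<And>x v. \<lbrakk>x \<in> carrier H; v \<in> L\<rbrakk> \<Longrightarrow> ip H v (x \<ominus> p x) = 0"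
    using closed_subspace_decomp[OF L] by metis
  define P where "P = (\<lambda>x\<in>carrier H. p x)"
  have Ladd: "x \<oplus> y \<in> L" if "x \<in> L" "y \<in> L" for x y
    using L that unfolding closed_subspace_def by blast
  have Lscale: "c \<odot> x \<in> L" if "x \<in> L" for c x
    using L that unfolding closed_subspace_def by blast
  have P: "P x \<in> L" "P x \<in> carrier H" if "x \<in> carrier H" for x
    using that p sub by (auto simp: P_def)
  have o1: "ip H v (P x) = ip H v x" if "x \<in> carrier H" "v \<in> L" for x v
    using o[OF that] that sub p by (simp add: P_def ip_simps)
  have o2: "ip H (P x) v = ip H x v" if "x \<in> carrier H" "v \<in> L" for x v
    using o1[OF that] that sub P ip_commute by metis
  have selfadj: "ip H (P x) y = ip H x (P y)" if "x \<in> carrier H" "y \<in> carrier H" for x y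
    using o1[of y "P x"] o2[of x "P y"] P that by simp
  \<comment> \<open>P x is determined by its inner products with L; linearity and
    \<open>P x = x\<close> on L then reduce to comparing inner products.\<close>
  have uniq: "P x = l" if "x \<in> carrier H" "l \<in> L" "\<And>v. v \<in> L \<Longrightarrow> ip H l v = ip H x v" for x l
  proof (rule vec_eqI)
    fix z assume z: "z \<in> carrier H"
    have "ip H (P x) z = ip H x (P z)" using selfadj that z by simp
    also have "\<dots> = ip H l (P z)" using that z P by simp
    also have "\<dots> = ip H l z" using o1 that z by simp
    finally show "ip H (P x) z = ip H l z" .
  qed (use that P sub in auto)
  have "P \<in> bounded_ops H"
  proof (rule bounded_opsI[of _ 1])
    fix x y assume xy: "x \<in> carrier H" "y \<in> carrier H"
    show "P (x \<oplus> y) = P x \<oplus> P y"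
      by (rule uniq) (use xy P in \<open>simp_all add: Ladd ip_simps sub o2\<close>)
  next
    fix c x assume x: "x \<in> carrier H"
    show "P (c \<odot> x) = c \<odot> P x"
      by (rule uniq) (use x P in \<open>simp_all add: Lscale ip_simps sub o2\<close>)
  next
    fix x assume x: "x \<in> carrier H"
    have "(hnorm H (P x))\<^sup>2 = Re (ip H x (P x))" using x P o2 by (simp add: hnorm_sq)
    also have "\<dots> \<le> hnorm H x * hnorm H (P x)"
      by (rule order_trans[OF complex_Re_le_cmod cauchy_schwarz]) (use x P in auto)
    finally have "hnorm H (P x) * hnorm H (P x) \<le> hnorm H x * hnorm H (P x)"
      by (simp add: power2_eq_square)
    moreover have "0 \<le> hnorm H (P x)" "0 \<le> hnorm H x" using x P by simp_all
    ultimately show "hnorm H (P x) \<le> 1 * hnorm H x"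
      by (cases "hnorm H (P x) = 0") (auto simp only: mult_le_cancel_right mult_1)
  qed (use P in \<open>auto simp: P_def\<close>)
  moreover have "P x = x" if "x \<in> L" for x by (rule uniq) (use that sub in auto)
  ultimately show ?thesis using that P selfadj by blast
qed

text \<open>Invariance of L under R means R P = P R P, and invariance under R' means R' P = P R' P,
  whose adjoint is P R = P R P. The adjoint R' is a parameter so that it can be supplied explicitly,
  for instance coordinate by coordinate on a finite power.\<close>

lemma projection_commute:
  assumes "P \<in> bounded_ops H" "\<And>x. x \<in> carrier H \<Longrightarrow> P x \<in> L" "\<And>x. x \<in> L \<Longrightarrow> P x = x"
    and sa: "\<And>x y. \<lbrakk>x \<in> carrier H; y \<in> carrier H\<rbrakk> \<Longrightarrow> ip H (P x) y = ip H x (P y)"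
    and "R \<in> bounded_ops H" "R' \<in> bounded_ops H"
    and adj: "\<And>x y. \<lbrakk>x \<in> carrier H; y \<in> carrier H\<rbrakk> \<Longrightarrow> ip H (R x) y = ip H x (R' y)"
    and inv: "\<And>x. x \<in> L \<Longrightarrow> R x \<in> L" "\<And>x. x \<in> L \<Longrightarrow> R' x \<in> L" and x: "x \<in> carrier H"
  shows "P (R x) = R (P x)"
proof (rule vec_eqI)
  fix z assume z: "z \<in> carrier H"
  note c = assms(1,5,6) x z
  have "ip H (P (R x)) z = ip H x (R' (P z))" using c by (simp add: sa adj)
  also have "R' (P z) = P (R' (P z))" using c assms(2,3) inv by simp
  also have "ip H x (P (R' (P z))) = ip H (P (R (P x))) z" using c by (simp flip: sa adj)
  also have "P (R (P x)) = R (P x)" using c assms(2,3) inv by simp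
  finally show "ip H (P (R x)) z = ip H (R (P x)) z" .
qed (use assms in auto)

lemma riesz_representation:
  assumes add: "\<And>x y. \<lbrakk>x \<in> carrier H; y \<in> carrier H\<rbrakk> \<Longrightarrow> f (x \<oplus> y) = f x + f y"
    and scale: "\<And>c x. x \<in> carrier H \<Longrightarrow> f (c \<odot> x) = c * f x"
    and bound: "\<And>x. x \<in> carrier H \<Longrightarrow> cmod (f x) \<le> C * hnorm H x"
  shows "\<exists>y\<in>carrier H. \<forall>x\<in>carrier H. f x = ip H x y"
proof (cases "\<forall>x\<in>carrier H. f x = 0")
  case True then show ?thesis by (intro bexI[of _ \<zero>]) auto
next
  case False
  then obtain t where t: "t \<in> carrier H" "f t \<noteq> 0" by blast
  let ?L = "{x \<in> carrier H. f x = 0}"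
  have diff: "f (x \<ominus> y) = f x - f y" if "x \<in> carrier H" "y \<in> carrier H" for x y
    using that add scale by (simp add: diff_eq)
  have "closed_subspace ?L"
    unfolding closed_subspace_def
  proof (intro conjI ballI allI impI)
    show "\<zero> \<in> ?L" using scale[of \<zero> 0] by simp
    fix x assume x: "x \<in> carrier H" and *: "\<forall>e>0. \<exists>v\<in>?L. hnorm H (x \<ominus> v) < e"
    have "cmod (f x) \<le> 0 + e" if e: "e > 0" for e
    proof -
      \<comment> \<open>C may be zero or negative, so it is enlarged to a positive constant before
        dividing.\<close>
      have "e / (\<bar>C\<bar> + 1) > 0" using e by simp
      then obtain v where v: "v \<in> carrier H" "f v = 0" "hnorm H (x \<ominus> v) < e / (\<bar>C\<bar> + 1)" using * by blast
      have "cmod (f x) = cmod (f (x \<ominus> v))" using v x diff by simp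
      also have "\<dots> \<le> C * hnorm H (x \<ominus> v)" using v x bound by simp
      also have "\<dots> \<le> (\<bar>C\<bar> + 1) * (e / (\<bar>C\<bar> + 1))" using v x e by (intro mult_mono) auto
      finally show ?thesis by simp
    qed
    then have "cmod (f x) \<le> 0" by (rule field_le_epsilon)
    then show "x \<in> ?L" using x by simp
  qed (auto simp: add scale)
  then obtain l where l: "l \<in> ?L" and o: "\<forall>v\<in>?L. ip H v (t \<ominus> l) = 0"
    using closed_subspace_decomp t by meson
  define z where "z = t \<ominus> l"
  have z: "z \<in> carrier H" "f z = f t" using l t diff by (auto simp: z_def)
  have zn: "(hnorm H z)\<^sup>2 \<noteq> 0" using z t scale[of \<zero> 0] by auto
  \<comment> \<open>z is orthogonal to the kernel of f, and the scalar is forced by f z = ip H z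
    y.\<close>
  define y where "y = (cnj (f z) / complex_of_real ((hnorm H z)\<^sup>2)) \<odot> z"
  have "f x = ip H x y" if x: "x \<in> carrier H" for x
  proof -
    have "x \<ominus> (f x / f z) \<odot> z \<in> ?L" using x z t by (simp add: diff scale)
    then have "ip H (x \<ominus> (f x / f z) \<odot> z) z = 0" using o by (simp add: z_def)
    then have "ip H x z = f x / f z * complex_of_real ((hnorm H z)\<^sup>2)"
      using x z by (simp add: ip_simps ip_self)
    then show ?thesis using x z zn t by (simp add: y_def ip_scale_right)
  qed
  moreover have "y \<in> carrier H" using z by (simp add: y_def)
  ultimately show ?thesis by blast
qed

lemma adjoint_exists:
  assumes T: "T \<in> bounded_ops H"
  shows "\<exists>S\<in>bounded_ops H. \<forall>x\<in>carrier H. \<forall>y\<in>carrier H. ip H (T x) y = ip H x (S y)"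
proof -
  obtain C where C: "C > 0" "\<And>x. x \<in> carrier H \<Longrightarrow> hnorm H (T x) \<le> C * hnorm H x"
    using op_bound[OF T] by blast
  have "\<exists>z\<in>carrier H. \<forall>x\<in>carrier H. ip H (T x) y = ip H x z" if y: "y \<in> carrier H" for y
  proof (rule riesz_representation[where C = "C * hnorm H y"])
    fix x assume x: "x \<in> carrier H"
    have "cmod (ip H (T x) y) \<le> hnorm H (T x) * hnorm H y" using x y T cauchy_schwarz by simp
    also have "\<dots> \<le> (C * hnorm H x) * hnorm H y" using C(2)[OF x] y by (intro mult_right_mono) auto
    finally show "cmod (ip H (T x) y) \<le> C * hnorm H y * hnorm H x" by (simp add: mult_ac)
  qed (use T y in \<open>auto simp: op_add op_scale ip_simps\<close>)
  then obtain s where s: "\<And>y. y \<in> carrier H \<Longrightarrow> s y \<in> carrier H"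
    and ip: "\<And>x y. \<lbrakk>x \<in> carrier H; y \<in> carrier H\<rbrakk> \<Longrightarrow> ip H (T x) y = ip H x (s y)"
    by metis
  have ip': "ip H (s y) x = ip H y (T x)" if "x \<in> carrier H" "y \<in> carrier H" for x y
    using ip_commute[of "s y" x] ip_commute[of y "T x"] ip[OF that] that s T by simp
  define S where "S = (\<lambda>y\<in>carrier H. s y)"
  have "S \<in> bounded_ops H"
  proof (rule bounded_opsI[of _ C])
    fix x y assume "x \<in> carrier H" "y \<in> carrier H"
    then show "S (x \<oplus> y) = S x \<oplus> S y"
      using s T by (intro vec_eqI) (auto simp: S_def ip_simps ip')
  next
    fix c x assume "x \<in> carrier H"
    then show "S (c \<odot> x) = c \<odot> S x"
      using s T by (intro vec_eqI) (auto simp: S_def ip_simps ip')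
  next
    fix x assume x: "x \<in> carrier H"
    have "(hnorm H (s x))\<^sup>2 = Re (ip H (T (s x)) x)"
      by (simp only: hnorm_sq[OF s[OF x]] ip[OF s[OF x] x])
    also have "\<dots> \<le> hnorm H (T (s x)) * hnorm H x"
      by (rule order_trans[OF complex_Re_le_cmod cauchy_schwarz]) (use T s x in auto)
    also have "\<dots> \<le> (C * hnorm H (s x)) * hnorm H x"
      using C(2)[OF s[OF x]] x by (intro mult_right_mono) auto
    finally have "hnorm H (s x) * hnorm H (s x) \<le> (C * hnorm H x) * hnorm H (s x)"
      by (simp add: power2_eq_square mult_ac)
    moreover have "0 \<le> C * hnorm H x" using C(1) x by simp
    moreover have "0 \<le> hnorm H (s x)" using x s by simp
    ultimately have "hnorm H (s x) \<le> C * hnorm H x"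
      by (cases "hnorm H (s x) = 0") (auto simp only: mult_le_cancel_right)
    then show "hnorm H (S x) \<le> C * hnorm H x" using x by (simp add: S_def)
  qed (use s in \<open>auto simp: S_def\<close>)
  then show ?thesis using ip by (intro bexI[of _ S]) (auto simp: S_def)
qed

lemma adjoint_unique:
  assumes "S \<in> bounded_ops H" "S' \<in> bounded_ops H"
    and "\<And>x y. \<lbrakk>x \<in> carrier H; y \<in> carrier H\<rbrakk> \<Longrightarrow> ip H (T x) y = ip H x (S y)"
    and "\<And>x y. \<lbrakk>x \<in> carrier H; y \<in> carrier H\<rbrakk> \<Longrightarrow> ip H (T x) y = ip H x (S' y)"
  shows "S = S'"
proof (rule op_eqI)
  fix y assume y: "y \<in> carrier H"
  show "S y = S' y"
  proof (rule vec_eqI)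
    fix z assume z: "z \<in> carrier H"
    then have "ip H z (S y) = ip H z (S' y)" using assms(3,4)[OF _ y] by simp
    then show "ip H (S y) z = ip H (S' y) z"
      using ip_commute[of "S y" z] ip_commute[of "S' y" z] y z assms(1,2) by simp
  qed (use assms y in auto)
qed (use assms in auto)

lemma adjoint:
  assumes T: "T \<in> bounded_ops H"
  shows adjoint_closed [simp]: "adjoint H T \<in> bounded_ops H"
    and ip_adjoint_right: "\<lbrakk>x \<in> carrier H; y \<in> carrier H\<rbrakk> \<Longrightarrow> ip H x (adjoint H T y) = ip H (T x) y"
proof -
  obtain S where S: "S \<in> bounded_ops H" "\<forall>x\<in>carrier H. \<forall>y\<in>carrier H. ip H (T x) y = ip H x (S y)"
    using adjoint_exists[OF T] by blast
  have "\<exists>!S. S \<in> bounded_ops H \<and> (\<forall>x\<in>carrier H. \<forall>y\<in>carrier H. ip H (T x) y = ip H x (S y))"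
  proof (rule ex1I[of _ S])
    fix R assume R: "R \<in> bounded_ops H \<and> (\<forall>x\<in>carrier H. \<forall>y\<in>carrier H. ip H (T x) y = ip H x (R y))"
    show "R = S"
    proof (rule adjoint_unique)
      fix x y assume "x \<in> carrier H" "y \<in> carrier H"
      then show "ip H (T x) y = ip H x (R y)" "ip H (T x) y = ip H x (S y)" using R S(2) by blast+
    qed (use R S(1) in auto)
  qed (intro conjI S)
  then have *: "adjoint H T \<in> bounded_ops H \<and>
      (\<forall>x\<in>carrier H. \<forall>y\<in>carrier H. ip H (T x) y = ip H x (adjoint H T y))"
    unfolding adjoint_def by (rule theI')
  then show "adjoint H T \<in> bounded_ops H" by simp
  show "ip H x (adjoint H T y) = ip H (T x) y" if "x \<in> carrier H" "y \<in> carrier H"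
    using * that by force
qed

lemma ip_adjoint_left:
  assumes "T \<in> bounded_ops H" "x \<in> carrier H" "y \<in> carrier H"
  shows "ip H (adjoint H T x) y = ip H x (T y)"
  using ip_adjoint_right[OF assms(1,3,2)] ip_commute[of "adjoint H T x" y] ip_commute[of x "T y"] assms
  by simp

lemma adjoint_eqI:
  assumes "T \<in> bounded_ops H" "S \<in> bounded_ops H"
    and "\<And>x y. \<lbrakk>x \<in> carrier H; y \<in> carrier H\<rbrakk> \<Longrightarrow> ip H (T x) y = ip H x (S y)"
  shows "adjoint H T = S"
  by (rule adjoint_unique[of _ _ T]) (use assms ip_adjoint_right in auto)

lemma adjoint_adjoint [simp]: "T \<in> bounded_ops H \<Longrightarrow> adjoint H (adjoint H T) = T"
  by (rule adjoint_eqI) (auto simp: ip_adjoint_left)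

lemma adjoint_add:
  "\<lbrakk>S \<in> bounded_ops H; T \<in> bounded_ops H\<rbrakk> \<Longrightarrow>
    adjoint H (S \<oplus>\<^bsub>op_algebra H\<^esub> T) = adjoint H S \<oplus>\<^bsub>op_algebra H\<^esub> adjoint H T"
  by (rule adjoint_eqI) (auto simp: ip_simps ip_adjoint_right)

lemma adjoint_smult:
  "T \<in> bounded_ops H \<Longrightarrow> adjoint H (c \<odot>\<^bsub>op_algebra H\<^esub> T) = cnj c \<odot>\<^bsub>op_algebra H\<^esub> adjoint H T"
  by (rule adjoint_eqI) (auto simp: ip_simps ip_adjoint_right)

lemma adjoint_mult:
  "\<lbrakk>S \<in> bounded_ops H; T \<in> bounded_ops H\<rbrakk> \<Longrightarrow>
    adjoint H (S \<otimes>\<^bsub>op_algebra H\<^esub> T) = adjoint H T \<otimes>\<^bsub>op_algebra H\<^esub> adjoint H S"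
  by (rule adjoint_eqI) (auto simp: ip_adjoint_right)

lemma adjoint_one [simp]: "adjoint H \<one>\<^bsub>op_algebra H\<^esub> = \<one>\<^bsub>op_algebra H\<^esub>"
  by (rule adjoint_eqI) auto

text \<open>The squared norm of the adjoint at x is the pairing of \<open>T (adjoint H T x)\<close>
  with x; Cauchy-Schwarz and cancelling one factor finish. The bound is a parameter because a bound
  common to all entries of a sequence has to be preserved.\<close>

lemma hnorm_adjoint_le:
  assumes T: "T \<in> bounded_ops H" and x: "x \<in> carrier H"
    and C: "C \<ge> 0" "\<And>x. x \<in> carrier H \<Longrightarrow> hnorm H (T x) \<le> C * hnorm H x"
  shows "hnorm H (adjoint H T x) \<le> C * hnorm H x"
proof -
  let ?y = "adjoint H T x"
  have y: "?y \<in> carrier H" using T x by simp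
  have "(hnorm H ?y)\<^sup>2 = Re (ip H (T ?y) x)" by (simp only: hnorm_sq[OF y] ip_adjoint_right[OF T y x])
  also have "\<dots> \<le> hnorm H (T ?y) * hnorm H x"
    by (rule order_trans[OF complex_Re_le_cmod cauchy_schwarz]) (use T x y in auto)
  also have "\<dots> \<le> (C * hnorm H ?y) * hnorm H x" using C(2)[OF y] x by (intro mult_right_mono) auto
  finally have "hnorm H ?y * hnorm H ?y \<le> (C * hnorm H x) * hnorm H ?y"
    by (simp add: power2_eq_square mult_ac)
  moreover have "0 \<le> C * hnorm H x" using C(1) x by simp
  moreover have "0 \<le> hnorm H ?y" using y by simp
  ultimately show ?thesis
    by (cases "hnorm H ?y = 0") (auto simp only: mult_le_cancel_right)
qed

end

subsection \<open>Finite powers of a Hilbert space\<close>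

text \<open>Tuples are extensional functions, so that equality of tuples is equality of functions;
  the index set F will itself be a finite set of vectors of H.\<close>

definition hilbert_power :: "'a hilbert \<Rightarrow> 'i set \<Rightarrow> ('i \<Rightarrow> 'a) hilbert" where
  "hilbert_power H F =
     \<lparr>carrier = F \<rightarrow>\<^sub>E carrier H, mult = undefined, one = undefined,
      zero = (\<lambda>i\<in>F. \<zero>\<^bsub>H\<^esub>), add = (\<lambda>f g. \<lambda>i\<in>F. f i \<oplus>\<^bsub>H\<^esub> g i),
      smult = (\<lambda>c f. \<lambda>i\<in>F. c \<odot>\<^bsub>H\<^esub> f i), ip = (\<lambda>f g. \<Sum>i\<in>F. ip H (f i) (g i))\<rparr>"

lemma hilbert_power_simps [simp]:
  "carrier (hilbert_power H F) = F \<rightarrow>\<^sub>E carrier H"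
  "zero (hilbert_power H F) = (\<lambda>i\<in>F. \<zero>\<^bsub>H\<^esub>)"
  "add (hilbert_power H F) f g = (\<lambda>i\<in>F. f i \<oplus>\<^bsub>H\<^esub> g i)"
  "smult (hilbert_power H F) c f = (\<lambda>i\<in>F. c \<odot>\<^bsub>H\<^esub> f i)"
  "ip (hilbert_power H F) f g = (\<Sum>i\<in>F. ip H (f i) (g i))"
  by (simp_all add: hilbert_power_def)

context hilbert_space
begin

lemma hnorm_power_sq:
  assumes "finite F" "f \<in> F \<rightarrow>\<^sub>E carrier H"
  shows "(hnorm (hilbert_power H F) f)\<^sup>2 = (\<Sum>i\<in>F. (hnorm H (f i))\<^sup>2)"
proof -
  have "Re (\<Sum>i\<in>F. ip H (f i) (f i)) = (\<Sum>i\<in>F. (hnorm H (f i))\<^sup>2)"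
    unfolding Re_sum by (rule sum.cong) (use assms in \<open>auto simp: hnorm_sq PiE_iff\<close>)
  moreover have "0 \<le> (\<Sum>i\<in>F. (hnorm H (f i))\<^sup>2)" by (rule sum_nonneg) simp
  ultimately show ?thesis by (simp add: hnorm_def[of "hilbert_power H F"])
qed

lemma hnorm_power_component:
  assumes "finite F" "f \<in> F \<rightarrow>\<^sub>E carrier H" "i \<in> F"
  shows "hnorm H (f i) \<le> hnorm (hilbert_power H F) f"
proof (rule power2_le_imp_le)
  have "(hnorm H (f i))\<^sup>2 \<le> (\<Sum>i\<in>F. (hnorm H (f i))\<^sup>2)"
    by (rule member_le_sum) (use assms in auto)
  then show "(hnorm H (f i))\<^sup>2 \<le> (hnorm (hilbert_power H F) f)\<^sup>2" using assms by (simp add: hnorm_power_sq)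
  have "0 \<le> Re (\<Sum>i\<in>F. ip H (f i) (f i))"
    unfolding Re_sum by (rule sum_nonneg) (use assms in \<open>auto simp: PiE_iff ip_self\<close>)
  then show "0 \<le> hnorm (hilbert_power H F) f" by (simp add: hnorm_def[of "hilbert_power H F"])
qed

lemma hilbert_space_power:
  assumes fin: "finite F"
  shows "hilbert_space (hilbert_power H F)"
proof (rule hilbert_spaceI)
  let ?G = "hilbert_power H F"
  fix u :: "nat \<Rightarrow> 'b \<Rightarrow> 'a"
  assume u: "\<And>n. u n \<in> carrier ?G"
    and cauchy: "\<And>e. e > 0 \<Longrightarrow> \<exists>k. \<forall>m\<ge>k. \<forall>n\<ge>k. hnorm ?G (u m \<oplus>\<^bsub>?G\<^esub> (-1) \<odot>\<^bsub>?G\<^esub> u n) < e"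
  have uc: "u n i \<in> carrier H" if "i \<in> F" for n i using u that by auto
  have "\<exists>x\<in>carrier H. (\<lambda>n. hnorm H (u n i \<ominus> x)) \<longlonglongrightarrow> 0" if i: "i \<in> F" for i
  proof (rule complete)
    fix e :: real assume "e > 0"
    then obtain k where k: "\<And>m n. \<lbrakk>m \<ge> k; n \<ge> k\<rbrakk> \<Longrightarrow> hnorm ?G (u m \<oplus>\<^bsub>?G\<^esub> (-1) \<odot>\<^bsub>?G\<^esub> u n) < e"
      using cauchy by meson
    have "hnorm H (u m i \<ominus> u n i) < e" if "m \<ge> k" "n \<ge> k" for m n
      using k[OF that] hnorm_power_component[OF fin, of "u m \<oplus>\<^bsub>?G\<^esub> (-1) \<odot>\<^bsub>?G\<^esub> u n" i] i uc
      by (auto simp: diff_eq)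
    then show "\<exists>k. \<forall>m\<ge>k. \<forall>n\<ge>k. hnorm H (u m i \<ominus> u n i) < e" by blast
  qed (use uc i in auto)
  then obtain x where x: "\<And>i. i \<in> F \<Longrightarrow> x i \<in> carrier H"
    and lim: "\<And>i. i \<in> F \<Longrightarrow> (\<lambda>n. hnorm H (u n i \<ominus> x i)) \<longlonglongrightarrow> 0"
    by metis
  define y where "y = restrict x F"
  have y: "y \<in> carrier ?G" using x by (auto simp: y_def)
  have "(\<lambda>n. sqrt (\<Sum>i\<in>F. (hnorm H (u n i \<ominus> x i))\<^sup>2)) \<longlonglongrightarrow> sqrt (\<Sum>i\<in>F. 0\<^sup>2)"
    by (intro tendsto_real_sqrt tendsto_sum tendsto_power lim)
  moreover have "sqrt (\<Sum>i\<in>F. (hnorm H (u n i \<ominus> x i))\<^sup>2) = hnorm ?G (u n \<oplus>\<^bsub>?G\<^esub> (-1) \<odot>\<^bsub>?G\<^esub> y)" for n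
  proof -
    let ?d = "u n \<oplus>\<^bsub>?G\<^esub> (-1) \<odot>\<^bsub>?G\<^esub> y"
    have "Re (\<Sum>i\<in>F. ip H (?d i) (?d i)) = (\<Sum>i\<in>F. (hnorm H (u n i \<ominus> x i))\<^sup>2)"
      unfolding Re_sum by (rule sum.cong) (use uc x in \<open>auto simp: hnorm_sq diff_eq y_def\<close>)
    then show ?thesis by (simp add: hnorm_def[of ?G])
  qed
  ultimately show "\<exists>x\<in>carrier ?G. (\<lambda>n. hnorm ?G (u n \<oplus>\<^bsub>?G\<^esub> (-1) \<odot>\<^bsub>?G\<^esub> x)) \<longlonglongrightarrow> 0"
    using y by auto
next
  fix x assume x: "x \<in> carrier (hilbert_power H F)"
  then have xc: "i \<in> F \<Longrightarrow> x i \<in> carrier H" for i by auto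
  have s: "ip (hilbert_power H F) x x = of_real (\<Sum>i\<in>F. (hnorm H (x i))\<^sup>2)"
    using xc by (simp add: ip_self)
  show "ip (hilbert_power H F) x x \<in> \<real>\<^sub>\<ge>\<^sub>0"
    unfolding s by (simp add: complex_nonneg_Reals_iff sum_nonneg)
  assume "ip (hilbert_power H F) x x = 0"
  then have "(\<Sum>i\<in>F. (hnorm H (x i))\<^sup>2) = 0" unfolding s of_real_eq_0_iff .
  then have "\<forall>i\<in>F. (hnorm H (x i))\<^sup>2 = 0"
    using fin by (subst (asm) sum_nonneg_eq_0_iff) auto
  then have "\<forall>i\<in>F. x i = \<zero>" using xc by simp
  then show "x = \<zero>\<^bsub>hilbert_power H F\<^esub>" using x by (auto simp: fun_eq_iff PiE_iff extensional_def)
next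
  fix x y assume "x \<in> carrier (hilbert_power H F)" "y \<in> carrier (hilbert_power H F)"
  then show "x \<oplus>\<^bsub>hilbert_power H F\<^esub> y = y \<oplus>\<^bsub>hilbert_power H F\<^esub> x"
    by (auto simp: fun_eq_iff M.a_comm PiE_iff)
next
  fix x y assume "x \<in> carrier (hilbert_power H F)" "y \<in> carrier (hilbert_power H F)"
  then show "ip (hilbert_power H F) x y = cnj (ip (hilbert_power H F) y x)"
    by (auto simp: PiE_mem intro!: sum.cong ip_commute)
qed (auto simp: fun_eq_iff PiE_iff extensional_def ip_simps sum.distrib sum_distrib_left M.a_assoc
    scale_scale M.l_neg M.r_neg scale_minus smult_r_distr intro!: sum.cong smult_l_distr[simplified])

end

subsection \<open>The bicommutant theorem\<close>

definition commutant :: "'a hilbert \<Rightarrow> ('a \<Rightarrow> 'a) set \<Rightarrow> ('a \<Rightarrow> 'a) set" where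
  "commutant H A = {R \<in> bounded_ops H. \<forall>S\<in>A. \<forall>x\<in>carrier H. R (S x) = S (R x)}"

lemma commutantD: "\<lbrakk>R \<in> commutant H A; S \<in> A; x \<in> carrier H\<rbrakk> \<Longrightarrow> R (S x) = S (R x)"
  and commutant_bounded: "R \<in> commutant H A \<Longrightarrow> R \<in> bounded_ops H"
  by (simp_all add: commutant_def)

text \<open>The axioms of \<open>von_neumann_algebra\<close> except strong closedness: the operators
  of bounded sequences form such an algebra before the closure is taken.\<close>

locale operator_star_algebra = hilbert_space H
  for H :: "'a hilbert" (structure) and A :: "('a \<Rightarrow> 'a) set" +
  assumes subset: "A \<subseteq> bounded_ops H"
    and one_mem: "\<one>\<^bsub>op_algebra H\<^esub> \<in> A"
    and add_mem: "\<lbrakk>S \<in> A; T \<in> A\<rbrakk> \<Longrightarrow> S \<oplus>\<^bsub>op_algebra H\<^esub> T \<in> A"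
    and mult_mem: "\<lbrakk>S \<in> A; T \<in> A\<rbrakk> \<Longrightarrow> S \<otimes>\<^bsub>op_algebra H\<^esub> T \<in> A"
    and smult_mem: "T \<in> A \<Longrightarrow> c \<odot>\<^bsub>op_algebra H\<^esub> T \<in> A"
    and adj_mem: "T \<in> A \<Longrightarrow> adj (op_algebra H) T \<in> A"

sublocale von_neumann_algebra \<subseteq> operator_star_algebra H M
  by unfold_locales (fact subset one_mem add_mem mult_mem smult_mem adj_mem)+

context operator_star_algebra
begin

lemma mem_bounded [simp]: "S \<in> A \<Longrightarrow> S \<in> bounded_ops H"
  using subset by blast

lemma adjoint_mem [simp]: "S \<in> A \<Longrightarrow> adjoint H S \<in> A"
  using adj_mem by simp

lemma adjoint_commutant:
  assumes R: "R \<in> commutant H A"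
  shows "adjoint H R \<in> commutant H A"
  unfolding commutant_def
proof (intro CollectI conjI ballI)
  have Rb: "R \<in> bounded_ops H" using R by (rule commutant_bounded)
  then show "adjoint H R \<in> bounded_ops H" by simp
  fix S x assume S: "S \<in> A" and x: "x \<in> carrier H"
  have Sb: "S \<in> bounded_ops H" using S by simp
  show "adjoint H R (S x) = S (adjoint H R x)"
  proof (rule vec_eqI)
    fix z assume z: "z \<in> carrier H"
    have "ip H (adjoint H R (S x)) z = ip H x (adjoint H S (R z))"
      using Rb Sb x z by (simp add: ip_adjoint_left ip_adjoint_right)
    also have "\<dots> = ip H x (R (adjoint H S z))" using commutantD[OF R adjoint_mem[OF S] z] by simp
    also have "\<dots> = ip H (adjoint H R x) (adjoint H S z)"
      by (rule ip_adjoint_left[symmetric]) (use Rb Sb x z in auto)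
    also have "\<dots> = ip H (S (adjoint H R x)) z"
      by (rule ip_adjoint_right) (use Rb Sb x z in auto)
    finally show "ip H (adjoint H R (S x)) z = ip H (S (adjoint H R x)) z" .
  qed (use Rb Sb x in auto)
qed

text \<open>Commutation with R survives strong limits because one S approximates T at x and at R x
  simultaneously; the tolerance e / (C + 1) absorbs the bound C of R.\<close>

lemma sot_closure_le_bicommutant:
  assumes T: "T \<in> sot_closure H A"
  shows "T \<in> commutant H (commutant H A)"
  unfolding commutant_def[of H "commutant H A"]
proof (intro CollectI conjI ballI)
  show Tb: "T \<in> bounded_ops H" using T by (simp add: sot_closure_def)
  fix R x assume R: "R \<in> commutant H A" and x: "x \<in> carrier H"
  have Rb: "R \<in> bounded_ops H" using R by (rule commutant_bounded)
  obtain C where C: "C > 0" "\<And>x. x \<in> carrier H \<Longrightarrow> hnorm H (R x) \<le> C * hnorm H x"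
    using op_bound[OF Rb] by blast
  show "T (R x) = R (T x)"
  proof (rule vec_eq_small)
    fix e :: real assume e: "e > 0"
    have "finite {x, R x}" "{x, R x} \<subseteq> carrier H" "e / (C + 1) > 0" using C e x Rb by auto
    then obtain S where S: "S \<in> A" and app: "\<forall>y\<in>{x, R x}. hnorm H (T y \<ominus> S y) < e / (C + 1)"
      using T unfolding sot_closure_def by blast
    have Sb: "S \<in> bounded_ops H" using S by simp
    have "hnorm H (T (R x) \<ominus> R (T x)) \<le> hnorm H (T (R x) \<ominus> S (R x)) + hnorm H (S (R x) \<ominus> R (T x))"
      by (rule hnorm_diff_triangle) (use Tb Sb Rb x in auto)
    also have "S (R x) \<ominus> R (T x) = R (S x \<ominus> T x)"
      using commutantD[OF R S x] op_diff[OF Rb, of "S x" "T x"] Tb Sb x by simp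
    also have "hnorm H \<dots> \<le> C * hnorm H (S x \<ominus> T x)" by (rule C) (use Sb Tb x in auto)
    also have "hnorm H (S x \<ominus> T x) = hnorm H (T x \<ominus> S x)"
      by (rule hnorm_minus_commute) (use Sb Tb x in auto)
    also have "hnorm H (T (R x) \<ominus> S (R x)) + C * hnorm H (T x \<ominus> S x) \<le> e / (C + 1) + C * (e / (C + 1))"
      using app C(1) by (intro add_mono mult_left_mono) auto
    also have "\<dots> = (C + 1) * (e / (C + 1))" by (simp only: distrib_right mult_1 add.commute)
    also have "\<dots> = e" using C(1) by simp
    finally show "hnorm H (T (R x) \<ominus> R (T x)) \<le> e" by simp
  qed (use Tb Rb x in auto)
qed

text \<open>The entries of the projection onto the closure of \<open>{(S v)\<^sub>v | S \<in> A}\<close>, as an operator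
  matrix on the finite power of \<open>H\<close>, lie in the commutant of \<open>A\<close>, hence they commute with \<open>T\<close>.\<close>

lemma bicommutant_le_sot_closure:
  assumes T: "T \<in> commutant H (commutant H A)"
  shows "T \<in> sot_closure H A"
  unfolding sot_closure_def
proof (intro CollectI conjI allI impI)
  show Tb: "T \<in> bounded_ops H" using T by (rule commutant_bounded)
  fix F and e :: real assume "finite F \<and> F \<subseteq> carrier H \<and> e > 0"
  then have fin: "finite F" and F: "F \<subseteq> carrier H" and e: "e > 0" by auto
  let ?G = "hilbert_power H F"
  interpret G: hilbert_space ?G by (rule hilbert_space_power[OF fin])
  have Fc: "i \<in> F \<Longrightarrow> i \<in> carrier H" for i using F by auto
  \<comment> \<open>The amplification of S, acting by S on each coordinate: approximating T on all
    of F becomes approximating \<open>diag T\<close> at a single vector.\<close>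
  define diag where "diag S = (\<lambda>f\<in>carrier ?G. \<lambda>i\<in>F. S (f i))" for S :: "'a \<Rightarrow> 'a"
  have diag_mem: "diag S \<in> bounded_ops ?G" if S: "S \<in> bounded_ops H" for S
  proof -
    obtain C where C: "C > 0" "\<And>x. x \<in> carrier H \<Longrightarrow> hnorm H (S x) \<le> C * hnorm H x"
      using op_bound[OF S] by blast
    show ?thesis
    proof (rule G.bounded_opsI[of _ C])
      fix f assume f: "f \<in> carrier ?G"
      then have fc: "i \<in> F \<Longrightarrow> f i \<in> carrier H" for i by auto
      have dc: "(\<lambda>i\<in>F. S (f i)) \<in> F \<rightarrow>\<^sub>E carrier H" using fc S by auto
      show "diag S f \<in> carrier ?G" using f dc by (simp add: diag_def)
      have "(hnorm ?G (diag S f))\<^sup>2 = (\<Sum>i\<in>F. (hnorm H (S (f i)))\<^sup>2)"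
        using f hnorm_power_sq[OF fin dc] by (simp add: diag_def)
      also have "\<dots> \<le> (\<Sum>i\<in>F. (C * hnorm H (f i))\<^sup>2)"
        by (intro sum_mono power_mono C) (use fc S in auto)
      also have "\<dots> = (C * hnorm ?G f)\<^sup>2"
        using f by (simp add: power_mult_distrib hnorm_power_sq[OF fin] sum_distrib_left)
      finally show "hnorm ?G (diag S f) \<le> C * hnorm ?G f"
        by (rule power2_le_imp_le) (use C(1) f in auto)
    next
      fix f g assume "f \<in> carrier ?G" "g \<in> carrier ?G"
      then show "diag S (f \<oplus>\<^bsub>?G\<^esub> g) = diag S f \<oplus>\<^bsub>?G\<^esub> diag S g"
        by (auto simp: diag_def fun_eq_iff PiE_iff intro!: op_add[OF S])
    next
      fix c f assume "f \<in> carrier ?G"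
      then show "diag S (c \<odot>\<^bsub>?G\<^esub> f) = c \<odot>\<^bsub>?G\<^esub> diag S f"
        by (auto simp: diag_def fun_eq_iff PiE_iff intro!: op_scale[OF S])
    qed (simp add: diag_def)
  qed
  define V where "V = (\<lambda>S. \<lambda>i\<in>F. S i) ` A"
  define L where "L = {l \<in> carrier ?G. \<forall>e>0. \<exists>v\<in>V. hnorm ?G (l \<ominus>\<^bsub>?G\<^esub> v) < e}"
  have Vc: "v \<in> carrier ?G" if "v \<in> V" for v using that Fc by (auto simp: V_def)
  have VL: "v \<in> L" if "v \<in> V" for v
    using that Vc by (auto simp: L_def intro!: bexI[of _ v] simp del: hilbert_power_simps)
  have L: "G.closed_subspace L"
    unfolding G.closed_subspace_def
  proof (intro conjI ballI allI impI)
    show "L \<subseteq> carrier ?G" by (auto simp: L_def)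
    have "\<zero>\<^bsub>?G\<^esub> \<in> V"
      unfolding V_def
    proof (rule image_eqI)
      show "0 \<odot>\<^bsub>op_algebra H\<^esub> \<one>\<^bsub>op_algebra H\<^esub> \<in> A" by (intro smult_mem one_mem)
      show "\<zero>\<^bsub>?G\<^esub> = (\<lambda>i\<in>F. (0 \<odot>\<^bsub>op_algebra H\<^esub> \<one>\<^bsub>op_algebra H\<^esub>) i)"
        using Fc by (auto simp: fun_eq_iff)
    qed
    then show "\<zero>\<^bsub>?G\<^esub> \<in> L" by (rule VL)
  next
    fix f g assume f: "f \<in> L" and g: "g \<in> L"
    then have c: "f \<in> carrier ?G" "g \<in> carrier ?G" by (auto simp: L_def)
    have "\<exists>v\<in>V. hnorm ?G ((f \<oplus>\<^bsub>?G\<^esub> g) \<ominus>\<^bsub>?G\<^esub> v) < d" if "d > 0" for d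
    proof -
      have "d / 2 > 0" using that by simp
      then obtain S R where S: "S \<in> A" "hnorm ?G (f \<ominus>\<^bsub>?G\<^esub> (\<lambda>i\<in>F. S i)) < d / 2"
        and R: "R \<in> A" "hnorm ?G (g \<ominus>\<^bsub>?G\<^esub> (\<lambda>i\<in>F. R i)) < d / 2"
        using f g unfolding L_def V_def by blast
      have SR: "(\<lambda>i\<in>F. S i) \<in> carrier ?G" "(\<lambda>i\<in>F. R i) \<in> carrier ?G"
        using S R Fc by auto
      have "hnorm ?G ((f \<oplus>\<^bsub>?G\<^esub> g) \<ominus>\<^bsub>?G\<^esub> ((\<lambda>i\<in>F. S i) \<oplus>\<^bsub>?G\<^esub> (\<lambda>i\<in>F. R i))) < d"
        using G.hnorm_sum_diff_le[OF c SR] S R by linarith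
      moreover have "(\<lambda>i\<in>F. S i) \<oplus>\<^bsub>?G\<^esub> (\<lambda>i\<in>F. R i) \<in> V"
        unfolding V_def
        by (rule image_eqI[OF _ add_mem[OF S(1) R(1)]]) (use Fc in \<open>auto simp: fun_eq_iff\<close>)
      ultimately show ?thesis by blast
    qed
    then show "f \<oplus>\<^bsub>?G\<^esub> g \<in> L" using G.M.a_closed[OF c] by (simp add: L_def del: hilbert_power_simps)
  next
    fix c f assume f: "f \<in> L"
    then have fc: "f \<in> carrier ?G" by (auto simp: L_def)
    have "\<exists>v\<in>V. hnorm ?G ((c \<odot>\<^bsub>?G\<^esub> f) \<ominus>\<^bsub>?G\<^esub> v) < d" if "d > 0" for d
    proof -
      have "d / (cmod c + 1) > 0" using that by (simp add: add_nonneg_pos)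
      then obtain S where S: "S \<in> A" "hnorm ?G (f \<ominus>\<^bsub>?G\<^esub> (\<lambda>i\<in>F. S i)) < d / (cmod c + 1)"
        using f unfolding L_def V_def by blast
      have Sc: "(\<lambda>i\<in>F. S i) \<in> carrier ?G" using S Fc by auto
      have "hnorm ?G ((c \<odot>\<^bsub>?G\<^esub> f) \<ominus>\<^bsub>?G\<^esub> (c \<odot>\<^bsub>?G\<^esub> (\<lambda>i\<in>F. S i))) = cmod c * hnorm ?G (f \<ominus>\<^bsub>?G\<^esub> (\<lambda>i\<in>F. S i))"
        by (rule G.hnorm_scale_diff[OF fc Sc])
      also have "\<dots> \<le> cmod c * (d / (cmod c + 1))" using S by (intro mult_left_mono) auto
      also have "\<dots> < (cmod c + 1) * (d / (cmod c + 1))"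
        using that by (intro mult_strict_right_mono) (auto simp: add_nonneg_pos)
      also have "\<dots> = d" by (simp add: add_nonneg_eq_0_iff)
      finally have "hnorm ?G ((c \<odot>\<^bsub>?G\<^esub> f) \<ominus>\<^bsub>?G\<^esub> (c \<odot>\<^bsub>?G\<^esub> (\<lambda>i\<in>F. S i))) < d" .
      moreover have "c \<odot>\<^bsub>?G\<^esub> (\<lambda>i\<in>F. S i) \<in> V"
        unfolding V_def
        by (rule image_eqI[OF _ smult_mem[OF S(1)]]) (use Fc in \<open>auto simp: fun_eq_iff\<close>)
      ultimately show ?thesis by blast
    qed
    then show "c \<odot>\<^bsub>?G\<^esub> f \<in> L" using G.scale_closed[OF fc] by (simp add: L_def del: hilbert_power_simps)
  next
    fix f assume f: "f \<in> carrier ?G" and app: "\<forall>d>0. \<exists>l\<in>L. hnorm ?G (f \<ominus>\<^bsub>?G\<^esub> l) < d"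
    have "\<exists>v\<in>V. hnorm ?G (f \<ominus>\<^bsub>?G\<^esub> v) < d" if "d > 0" for d
    proof -
      have d2: "d / 2 > 0" using that by simp
      then obtain l where l: "l \<in> L" "hnorm ?G (f \<ominus>\<^bsub>?G\<^esub> l) < d / 2" using app by blast
      then obtain v where v: "v \<in> V" "hnorm ?G (l \<ominus>\<^bsub>?G\<^esub> v) < d / 2" using d2 unfolding L_def by blast
      have "l \<in> carrier ?G" using l by (auto simp: L_def)
      then show ?thesis
        using G.hnorm_diff_triangle[OF f _ Vc[OF v(1)], of l] l v by (intro bexI[of _ v]) auto
    qed
    then show "f \<in> L" using f by (simp add: L_def del: hilbert_power_simps)
  qed
  obtain P where Pb: "P \<in> bounded_ops ?G" and PL: "\<And>x. x \<in> carrier ?G \<Longrightarrow> P x \<in> L"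
    and Pfix: "\<And>x. x \<in> L \<Longrightarrow> P x = x"
    and Psa: "\<And>x y. \<lbrakk>x \<in> carrier ?G; y \<in> carrier ?G\<rbrakk> \<Longrightarrow> ip ?G (P x) y = ip ?G x (P y)"
    using G.orthogonal_projection[OF L] by blast
  \<comment> \<open>Invariance of L under amplified elements of A. Used for S and for its adjoint,
    it makes P commute with \<open>diag S\<close>.\<close>
  have diag_L: "diag S f \<in> L" if S: "S \<in> A" and f: "f \<in> L" for S f
  proof -
    have Sb: "S \<in> bounded_ops H" using S by simp
    have fc: "f \<in> carrier ?G" using f by (auto simp: L_def)
    note db = diag_mem[OF Sb]
    obtain C where C: "C > 0" "\<And>x. x \<in> carrier ?G \<Longrightarrow> hnorm ?G (diag S x) \<le> C * hnorm ?G x"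
      using G.op_bound[OF db] by blast
    have "\<exists>v\<in>V. hnorm ?G (diag S f \<ominus>\<^bsub>?G\<^esub> v) < d" if "d > 0" for d
    proof -
      have "d / C > 0" using that C(1) by simp
      then obtain R where R: "R \<in> A" "hnorm ?G (f \<ominus>\<^bsub>?G\<^esub> (\<lambda>i\<in>F. R i)) < d / C"
        using f unfolding L_def V_def by blast
      have Rc: "(\<lambda>i\<in>F. R i) \<in> carrier ?G" using R Fc by auto
      have "hnorm ?G (diag S f \<ominus>\<^bsub>?G\<^esub> diag S (\<lambda>i\<in>F. R i)) = hnorm ?G (diag S (f \<ominus>\<^bsub>?G\<^esub> (\<lambda>i\<in>F. R i)))"
        by (simp only: G.op_diff[OF db fc Rc])
      also have "\<dots> \<le> C * hnorm ?G (f \<ominus>\<^bsub>?G\<^esub> (\<lambda>i\<in>F. R i))"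
        by (rule C(2)[OF G.M.minus_closed[OF fc Rc]])
      also have "\<dots> < d" using R(2) C(1) by (simp add: field_simps)
      finally have "hnorm ?G (diag S f \<ominus>\<^bsub>?G\<^esub> diag S (\<lambda>i\<in>F. R i)) < d" .
      moreover have "diag S (\<lambda>i\<in>F. R i) \<in> V"
        unfolding V_def
        by (rule image_eqI[OF _ mult_mem[OF S R(1)]]) (use Fc Rc in \<open>auto simp: fun_eq_iff diag_def\<close>)
      ultimately show ?thesis by blast
    qed
    then show ?thesis using G.op_closed[OF db fc] by (simp add: L_def del: hilbert_power_simps)
  qed
  have P_diag: "P (diag S f) = diag S (P f)" if S: "S \<in> A" and f: "f \<in> carrier ?G" for S f
  proof (rule G.projection_commute[OF Pb PL Pfix Psa, where R' = "diag (adjoint H S)"])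
    have Sb: "S \<in> bounded_ops H" using S by simp
    show "diag S \<in> bounded_ops ?G" "diag (adjoint H S) \<in> bounded_ops ?G" using Sb diag_mem by auto
    show "ip ?G (diag S x) y = ip ?G x (diag (adjoint H S) y)"
      if "x \<in> carrier ?G" "y \<in> carrier ?G" for x y
      using that Sb by (auto simp: diag_def PiE_iff ip_adjoint_right intro!: sum.cong)
  qed (use diag_L S f adjoint_mem in auto)
  \<comment> \<open>\<open>emb j\<close> places a vector in coordinate j, so that
    \<open>Q i j\<close> below is the matrix entry of P at position i, j.\<close>
  define emb where "emb j w = (\<lambda>k\<in>F. if k = j then w else \<zero>)" for j w
  have emb: "emb j w \<in> carrier ?G" if "w \<in> carrier H" for j w using that by (auto simp: emb_def)
  have emb_norm: "hnorm ?G (emb j w) \<le> hnorm H w" if w: "w \<in> carrier H" for j w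
  proof (rule power2_le_imp_le)
    have "(hnorm ?G (emb j w))\<^sup>2 = (\<Sum>k\<in>F. if k = j then (hnorm H w)\<^sup>2 else 0)"
      using emb[OF w, of j] by (subst hnorm_power_sq[OF fin]) (auto simp: emb_def intro!: sum.cong)
    then show "(hnorm ?G (emb j w))\<^sup>2 \<le> (hnorm H w)\<^sup>2" using fin by (simp add: sum.delta)
  qed (use w in simp)
  define Q where "Q i j = (\<lambda>w\<in>carrier H. P (emb j w) i)" for i j
  have Pc: "P f i \<in> carrier H" if "f \<in> carrier ?G" "i \<in> F" for f i
    using G.op_closed[OF Pb that(1)] that(2) by auto
  have Q: "Q i j \<in> commutant H A" if i: "i \<in> F" for i j
    unfolding commutant_def
  proof (intro CollectI conjI ballI)
    obtain C where C: "C > 0" "\<And>x. x \<in> carrier ?G \<Longrightarrow> hnorm ?G (P x) \<le> C * hnorm ?G x"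
      using G.op_bound[OF Pb] by blast
    show "Q i j \<in> bounded_ops H"
    proof (rule bounded_opsI[of _ C])
      fix w assume w: "w \<in> carrier H"
      show "Q i j w \<in> carrier H" using w i Pc emb by (simp add: Q_def)
      have "hnorm H (P (emb j w) i) \<le> hnorm ?G (P (emb j w))"
        by (rule hnorm_power_component[OF fin _ i]) (use G.op_closed[OF Pb emb[OF w]] in simp)
      also have "\<dots> \<le> C * hnorm ?G (emb j w)" by (rule C(2)[OF emb[OF w]])
      also have "\<dots> \<le> C * hnorm H w" using C(1) emb_norm[OF w] by (intro mult_left_mono) auto
      finally show "hnorm H (Q i j w) \<le> C * hnorm H w" using w by (simp add: Q_def)
    next
      fix v w assume vw: "v \<in> carrier H" "w \<in> carrier H"
      have "emb j (v \<oplus> w) = emb j v \<oplus>\<^bsub>?G\<^esub> emb j w" using vw by (auto simp: emb_def fun_eq_iff)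
      then have "P (emb j (v \<oplus> w)) = P (emb j v) \<oplus>\<^bsub>?G\<^esub> P (emb j w)"
        using G.op_add[OF Pb emb emb] vw by metis
      then show "Q i j (v \<oplus> w) = Q i j v \<oplus> Q i j w" using vw i by (simp add: Q_def)
    next
      fix c w assume w: "w \<in> carrier H"
      have "emb j (c \<odot> w) = c \<odot>\<^bsub>?G\<^esub> emb j w" using w by (auto simp: emb_def fun_eq_iff)
      then have "P (emb j (c \<odot> w)) = c \<odot>\<^bsub>?G\<^esub> P (emb j w)"
        using G.op_scale[OF Pb emb[OF w]] by metis
      then show "Q i j (c \<odot> w) = c \<odot> Q i j w" using w i by (simp add: Q_def)
    qed (simp add: Q_def)
    fix S w assume S: "S \<in> A" and w: "w \<in> carrier H"
    have Sb: "S \<in> bounded_ops H" using S by simp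
    have "emb j (S w) = diag S (emb j w)"
      using emb[OF w, of j] Sb by (auto simp: emb_def diag_def fun_eq_iff)
    then have "P (emb j (S w)) = diag S (P (emb j w))" using P_diag[OF S emb[OF w]] by simp
    then show "Q i j (S w) = S (Q i j w)"
      using w i Sb G.op_closed[OF Pb emb[OF w]] by (simp add: Q_def diag_def)
  qed
  note dT = diag_mem[OF Tb]
  have PT_emb: "P (diag T (emb j w)) = diag T (P (emb j w))" if w: "w \<in> carrier H" for j w
  proof
    fix i
    have *: "diag T (emb j w) = emb j (T w)"
      using emb[OF w, of j] Tb by (auto simp: emb_def diag_def fun_eq_iff)
    show "P (diag T (emb j w)) i = diag T (P (emb j w)) i"
    proof (cases "i \<in> F")
      case True
      have "T (Q i j w) = Q i j (T w)" using commutantD[OF T Q[OF True] w] .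
      then show ?thesis
        unfolding * using True w Tb G.op_closed[OF Pb emb[OF w]] by (simp add: Q_def diag_def)
    next
      case False
      then show ?thesis
        using G.op_closed[OF Pb emb[of "T w" j]] w Tb
          G.op_closed[OF dT G.op_closed[OF Pb emb[OF w, of j]]]
        by (auto simp: * PiE_iff extensional_def)
    qed
  qed
  \<comment> \<open>Commutation is known on vectors with one nonzero coordinate; adding the
    coordinates one at a time extends it to all tuples.\<close>
  have PT: "P (diag T u) = diag T (P u)" if u: "u \<in> carrier ?G" for u
  proof -
    have "P (diag T (\<lambda>k\<in>F. if k \<in> J then u k else \<zero>)) = diag T (P (\<lambda>k\<in>F. if k \<in> J then u k else \<zero>))"
      if "finite J" "J \<subseteq> F" for J
      using that
    proof (induction J)
      case empty
      have "(\<lambda>k\<in>F. if k \<in> {} then u k else \<zero>) = \<zero>\<^bsub>?G\<^esub>" by (auto simp: fun_eq_iff)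
      then show ?case using G.op_zero[OF Pb] G.op_zero[OF dT] by (simp del: hilbert_power_simps)
    next
      case (insert j J)
      let ?v = "\<lambda>k\<in>F. if k \<in> J then u k else \<zero>"
      have uj: "u j \<in> carrier H" using insert.prems u by auto
      have v: "?v \<in> carrier ?G" using u by auto
      have "(\<lambda>k\<in>F. if k \<in> insert j J then u k else \<zero>) = ?v \<oplus>\<^bsub>?G\<^esub> emb j (u j)"
        using insert.hyps insert.prems u by (auto simp: emb_def fun_eq_iff PiE_iff)
      moreover have "P (diag T (?v \<oplus>\<^bsub>?G\<^esub> emb j (u j))) = diag T (P (?v \<oplus>\<^bsub>?G\<^esub> emb j (u j)))"
        using insert.IH insert.prems PT_emb[OF uj, of j]
        by (simp only: G.op_add[OF dT v emb[OF uj]] G.op_add[OF Pb v emb[OF uj]]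
            G.op_add[OF Pb G.op_closed[OF dT v] G.op_closed[OF dT emb[OF uj]]]
            G.op_add[OF dT G.op_closed[OF Pb v] G.op_closed[OF Pb emb[OF uj]]] insert_subset simp_thms)
      ultimately show ?case by (simp only:)
    qed
    from this[OF fin subset_refl] have "P (diag T (\<lambda>k\<in>F. u k)) = diag T (P (\<lambda>k\<in>F. u k))"
      by (simp cong: restrict_cong)
    moreover have "(\<lambda>k\<in>F. u k) = u" using u by (auto simp: fun_eq_iff PiE_iff extensional_def)
    ultimately show ?thesis by simp
  qed
  \<comment> \<open>The tuple listing F itself. It lies in V as the value of the identity, so
    \<open>diag T\<close> keeps it in L, and membership in L is the wanted approximation.\<close>
  define x0 where "x0 = (\<lambda>i\<in>F. i)"
  have x0c: "x0 \<in> carrier ?G" using Fc by (auto simp: x0_def)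
  have "x0 \<in> V"
    unfolding V_def by (rule image_eqI[OF _ one_mem]) (use Fc in \<open>auto simp: x0_def fun_eq_iff\<close>)
  then have "diag T x0 = P (diag T x0)" using PT[OF x0c] Pfix VL by simp
  then have "diag T x0 \<in> L" using PL[OF G.op_closed[OF dT x0c]] by simp
  then obtain S where S: "S \<in> A" "hnorm ?G (diag T x0 \<ominus>\<^bsub>?G\<^esub> (\<lambda>i\<in>F. S i)) < e"
    using e unfolding L_def V_def by blast
  have "hnorm H (T i \<ominus> S i) < e" if i: "i \<in> F" for i
  proof -
    have Sc: "(\<lambda>i\<in>F. S i) \<in> carrier ?G" using S Fc by auto
    have eq: "(diag T x0 \<ominus>\<^bsub>?G\<^esub> (\<lambda>i\<in>F. S i)) i = T i \<ominus> S i"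
      using i x0c S Tb Fc G.diff_eq[OF G.op_closed[OF dT x0c] Sc]
      by (simp add: diag_def diff_eq x0_def)
    have "hnorm H ((diag T x0 \<ominus>\<^bsub>?G\<^esub> (\<lambda>i\<in>F. S i)) i) \<le> hnorm ?G (diag T x0 \<ominus>\<^bsub>?G\<^esub> (\<lambda>i\<in>F. S i))"
      by (rule hnorm_power_component[OF fin _ i])
        (use G.M.minus_closed[OF G.op_closed[OF dT x0c] Sc] in simp)
    then show ?thesis using S(2) by (simp add: eq)
  qed
  then show "\<exists>S\<in>A. \<forall>x\<in>F. hnorm H (T x \<ominus> S x) < e" using S(1) by blast
qed

lemma sot_closure_eq_bicommutant: "sot_closure H A = commutant H (commutant H A)"
  using sot_closure_le_bicommutant bicommutant_le_sot_closure by blast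

end

section \<open>Strong closures of star algebras\<close>

context operator_star_algebra
begin

lemma commutant_algebra:
  "von_neumann_algebra H (commutant H A)"
proof unfold_locales
  show "commutant H A \<subseteq> bounded_ops H" using commutant_bounded by blast
  show "\<one>\<^bsub>op_algebra H\<^esub> \<in> commutant H A" by (simp add: commutant_def)
  show "adj (op_algebra H) T \<in> commutant H A" if "T \<in> commutant H A" for T
    using adjoint_commutant[OF that] by simp
  show "S \<oplus>\<^bsub>op_algebra H\<^esub> T \<in> commutant H A" if "S \<in> commutant H A" "T \<in> commutant H A" for S T
    using that commutant_bounded[OF that(1)] commutant_bounded[OF that(2)]
    by (auto simp: commutant_def op_add[OF mem_bounded])
  show "S \<otimes>\<^bsub>op_algebra H\<^esub> T \<in> commutant H A" if "S \<in> commutant H A" "T \<in> commutant H A" for S T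
    using that commutant_bounded[OF that(1)] commutant_bounded[OF that(2)]
    by (auto simp: commutant_def)
  show "c \<odot>\<^bsub>op_algebra H\<^esub> T \<in> commutant H A" if "T \<in> commutant H A" for c T
    using that commutant_bounded[OF that]
    by (auto simp: commutant_def op_scale[OF mem_bounded])
  show "sot_closure H (commutant H A) \<subseteq> commutant H A"
  proof
    fix R assume R: "R \<in> sot_closure H (commutant H A)"
    then have Rb: "R \<in> bounded_ops H" by (simp add: sot_closure_def)
    show "R \<in> commutant H A"
      unfolding commutant_def
    proof (intro CollectI conjI ballI)
      fix S x assume S: "S \<in> A" and x: "x \<in> carrier H"
      have Sb: "S \<in> bounded_ops H" using S by simp
      obtain C where C: "C > 0" "\<And>x. x \<in> carrier H \<Longrightarrow> hnorm H (S x) \<le> C * hnorm H x"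
        using op_bound[OF Sb] by blast
      show "R (S x) = S (R x)"
      proof (rule vec_eq_small)
        fix e :: real assume e: "e > 0"
        have "finite {x, S x}" "{x, S x} \<subseteq> carrier H" "e / (C + 1) > 0" using C e x Sb by auto
        then obtain Q where Q: "Q \<in> commutant H A" and app: "\<forall>y\<in>{x, S x}. hnorm H (R y \<ominus> Q y) < e / (C + 1)"
          using R unfolding sot_closure_def by blast
        have Qb: "Q \<in> bounded_ops H" using Q by (rule commutant_bounded)
        have "hnorm H (R (S x) \<ominus> S (R x)) \<le> hnorm H (R (S x) \<ominus> Q (S x)) + hnorm H (Q (S x) \<ominus> S (R x))"
          by (rule hnorm_diff_triangle) (use Rb Sb Qb x in auto)
        also have "Q (S x) \<ominus> S (R x) = S (Q x \<ominus> R x)"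
          using commutantD[OF Q S x] op_diff[OF Sb, of "Q x" "R x"] Qb Rb x by simp
        also have "hnorm H \<dots> \<le> C * hnorm H (Q x \<ominus> R x)" by (rule C) (use Qb Rb x in auto)
        also have "hnorm H (Q x \<ominus> R x) = hnorm H (R x \<ominus> Q x)"
          by (rule hnorm_minus_commute) (use Qb Rb x in auto)
        also have "hnorm H (R (S x) \<ominus> Q (S x)) + C * hnorm H (R x \<ominus> Q x) \<le> e / (C + 1) + C * (e / (C + 1))"
          using app C(1) by (intro add_mono mult_left_mono) auto
        also have "\<dots> = (C + 1) * (e / (C + 1))" by (simp only: distrib_right mult_1 add.commute)
        also have "\<dots> = e" using C(1) by simp
        finally show "hnorm H (R (S x) \<ominus> S (R x)) \<le> e" by simp
      qed (use Rb Sb x in auto)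
    qed (rule Rb)
  qed
qed

text \<open>Multiplication is not jointly strongly continuous and the adjoint is not strongly
  continuous, so the operations cannot be passed to the limit directly. Written as the commutant of
  a commutant, the closure is an instance of \<open>commutant_algebra\<close>.\<close>

lemma von_neumann_sot_closure: "von_neumann_algebra H (sot_closure H A)"
proof -
  interpret C: von_neumann_algebra H "commutant H A" by (rule commutant_algebra)
  show ?thesis unfolding sot_closure_eq_bicommutant by (rule C.commutant_algebra)
qed

lemma subset_sot_closure: "A \<subseteq> sot_closure H A"
proof
  fix S assume "S \<in> A"
  then show "S \<in> sot_closure H A"
    unfolding sot_closure_eq_bicommutant commutant_def by auto
qed

text \<open>An approximant of T cannot be replaced by its self-adjoint part, as its adjoint may be
  far from T on F. Instead, the tuples of values of self-adjoint S form a real subspace of a finite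
  power, and it is enough that any tuple z real-orthogonal to all of them is real-orthogonal to the
  tuple of T.\<close>

lemma selfadjoint_dense:
  assumes T: "T \<in> sot_closure H A" "adjoint H T = T"
    and fin: "finite F" and F: "F \<subseteq> carrier H" and e: "e > 0"
  shows "\<exists>S\<in>A. adjoint H S = S \<and> (\<forall>x\<in>F. hnorm H (T x \<ominus> S x) < e)"
proof -
  let ?G = "hilbert_power H F"
  interpret G: hilbert_space ?G by (rule hilbert_space_power[OF fin])
  have Tb: "T \<in> bounded_ops H" using T by (simp add: sot_closure_def)
  have Fc: "i \<in> F \<Longrightarrow> i \<in> carrier H" for i using F by auto
  define B where "B = {S \<in> A. adjoint H S = S}"
  have Bb: "S \<in> B \<Longrightarrow> S \<in> bounded_ops H" for S by (simp add: B_def)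
  have Sc: "(\<lambda>i\<in>F. S i) \<in> carrier ?G" if "S \<in> bounded_ops H" for S using that Fc by auto
  have "\<exists>v\<in>(\<lambda>S. \<lambda>i\<in>F. S i) ` B. hnorm ?G ((\<lambda>i\<in>F. T i) \<ominus>\<^bsub>?G\<^esub> v) < e"
  proof (rule G.real_subspace_dense)
    show "(\<lambda>S. \<lambda>i\<in>F. S i) ` B \<subseteq> carrier ?G" using Sc Bb by blast
    show "\<zero>\<^bsub>?G\<^esub> \<in> (\<lambda>S. \<lambda>i\<in>F. S i) ` B"
    proof (rule image_eqI)
      show "0 \<odot>\<^bsub>op_algebra H\<^esub> \<one>\<^bsub>op_algebra H\<^esub> \<in> B"
        by (simp add: B_def one_mem smult_mem adjoint_smult)
      show "\<zero>\<^bsub>?G\<^esub> = (\<lambda>i\<in>F. (0 \<odot>\<^bsub>op_algebra H\<^esub> \<one>\<^bsub>op_algebra H\<^esub>) i)"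
        using Fc by (auto simp: fun_eq_iff)
    qed
  next
    fix f g assume "f \<in> (\<lambda>S. \<lambda>i\<in>F. S i) ` B" "g \<in> (\<lambda>S. \<lambda>i\<in>F. S i) ` B"
    then obtain S R where S: "S \<in> B" "f = (\<lambda>i\<in>F. S i)" and R: "R \<in> B" "g = (\<lambda>i\<in>F. R i)" by blast
    have "S \<oplus>\<^bsub>op_algebra H\<^esub> R \<in> B" using S R by (simp add: B_def add_mem adjoint_add)
    then show "f \<oplus>\<^bsub>?G\<^esub> g \<in> (\<lambda>S. \<lambda>i\<in>F. S i) ` B"
      by (rule image_eqI[rotated]) (use Fc S R in \<open>auto simp: fun_eq_iff\<close>)
  next
    fix r f assume "f \<in> (\<lambda>S. \<lambda>i\<in>F. S i) ` B"
    then obtain S where S: "S \<in> B" "f = (\<lambda>i\<in>F. S i)" by blast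
    have "complex_of_real r \<odot>\<^bsub>op_algebra H\<^esub> S \<in> B"
      using S by (simp add: B_def smult_mem adjoint_smult)
    then show "complex_of_real r \<odot>\<^bsub>?G\<^esub> f \<in> (\<lambda>S. \<lambda>i\<in>F. S i) ` B"
      by (rule image_eqI[rotated]) (use Fc S in \<open>auto simp: fun_eq_iff\<close>)
  next
    show "(\<lambda>i\<in>F. T i) \<in> carrier ?G" by (rule Sc[OF Tb])
    fix z assume z: "z \<in> carrier ?G"
      and orth: "\<And>v. v \<in> (\<lambda>S. \<lambda>i\<in>F. S i) ` B \<Longrightarrow> Re (ip ?G v z) = 0"
    have zc: "i \<in> F \<Longrightarrow> z i \<in> carrier H" for i using z by auto
    \<comment> \<open>Orthogonality is used for the sum of an arbitrary S and its adjoint. Moving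
      the adjoint across the inner product leaves only values of S, so the identity passes to the
      strong limit T.\<close>
    have S0: "(\<Sum>i\<in>F. Re (ip H (S i) (z i)) + Re (ip H (S (z i)) i)) = 0" if S: "S \<in> A" for S
    proof -
      have Sb: "S \<in> bounded_ops H" using S by simp
      have "S \<oplus>\<^bsub>op_algebra H\<^esub> adjoint H S \<in> B"
        using S Sb by (simp add: B_def add_mem adjoint_add) (rule op_eqI, auto simp: M.a_comm)
      then have "Re (ip ?G (\<lambda>i\<in>F. (S \<oplus>\<^bsub>op_algebra H\<^esub> adjoint H S) i) z) = 0" using orth by blast
      then have "(\<Sum>i\<in>F. Re (ip H ((S \<oplus>\<^bsub>op_algebra H\<^esub> adjoint H S) i) (z i))) = 0" by simp
      moreover have "Re (ip H ((S \<oplus>\<^bsub>op_algebra H\<^esub> adjoint H S) i) (z i)) =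
          Re (ip H (S i) (z i)) + Re (ip H (S (z i)) i)" if i: "i \<in> F" for i
        using Fc[OF i] zc[OF i] Sb Re_ip_commute[of i "S (z i)"]
        by (simp add: ip_add_left ip_adjoint_left)
      ultimately show ?thesis by simp
    qed
    have "\<bar>\<Sum>i\<in>F. Re (ip H (T i) (z i)) + Re (ip H (T (z i)) i)\<bar> \<le> 0 + d" if d: "d > 0" for d
    proof -
      \<comment> \<open>The total weight of the vectors entering the estimate; the extra 1 keeps K
        positive even when the sum vanishes.\<close>
      define K where "K = (\<Sum>i\<in>F. hnorm H (z i) + hnorm H i) + 1"
      have K: "K > 0" unfolding K_def by (intro add_nonneg_pos sum_nonneg add_nonneg_nonneg) (use zc Fc in auto)
      have "finite (F \<union> z ` F)" "F \<union> z ` F \<subseteq> carrier H" "d / K > 0" using fin F zc K d by auto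
      then obtain S where S: "S \<in> A" and app: "\<forall>y\<in>F \<union> z ` F. hnorm H (T y \<ominus> S y) < d / K"
        using T(1) unfolding sot_closure_def by blast
      have Sb: "S \<in> bounded_ops H" using S by simp
      have bd: "\<bar>Re (ip H (T y) w) - Re (ip H (S y) w)\<bar> \<le> d / K * hnorm H w"
        if "y \<in> F \<union> z ` F" "w \<in> carrier H" for y w
      proof -
        have y: "y \<in> carrier H" using that(1) F zc by auto
        have "\<bar>Re (ip H (T y) w) - Re (ip H (S y) w)\<bar> = \<bar>Re (ip H (T y \<ominus> S y) w)\<bar>"
          using Tb Sb y that by (simp add: ip_diff_left)
        also have "\<dots> \<le> hnorm H (T y \<ominus> S y) * hnorm H w"
          by (rule order_trans[OF abs_Re_le_cmod cauchy_schwarz]) (use Tb Sb y that in auto)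
        also have "\<dots> \<le> d / K * hnorm H w" using app that by (intro mult_right_mono) (auto intro: less_imp_le)
        finally show ?thesis .
      qed
      have "\<bar>\<Sum>i\<in>F. Re (ip H (T i) (z i)) + Re (ip H (T (z i)) i)\<bar> =
          \<bar>\<Sum>i\<in>F. (Re (ip H (T i) (z i)) - Re (ip H (S i) (z i))) + (Re (ip H (T (z i)) i) - Re (ip H (S (z i)) i))\<bar>"
        using S0[OF S] by (simp add: sum.distrib sum_subtractf)
      also have "\<dots> \<le> (\<Sum>i\<in>F. d / K * hnorm H (z i) + d / K * hnorm H i)"
      proof (rule order_trans[OF sum_abs], rule sum_mono)
        fix i assume i: "i \<in> F"
        show "\<bar>(Re (ip H (T i) (z i)) - Re (ip H (S i) (z i))) + (Re (ip H (T (z i)) i) - Re (ip H (S (z i)) i))\<bar>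
          \<le> d / K * hnorm H (z i) + d / K * hnorm H i"
          using bd[of i "z i"] bd[of "z i" i] i zc Fc by fastforce
      qed
      also have "\<dots> = d / K * (K - 1)" by (simp add: K_def sum_distrib_left distrib_left)
      also have "\<dots> \<le> d / K * K" using K d by (intro mult_left_mono) auto
      also have "\<dots> = d" using K by simp
      finally show ?thesis by simp
    qed
    then have "\<bar>\<Sum>i\<in>F. Re (ip H (T i) (z i)) + Re (ip H (T (z i)) i)\<bar> \<le> 0" by (rule field_le_epsilon)
    then have "(\<Sum>i\<in>F. Re (ip H (T i) (z i)) + Re (ip H (T (z i)) i)) = 0" by simp
    \<comment> \<open>Self-adjointness of T folds the two summands into one, which recovers the
      pairing of T with z.\<close>
    moreover have "Re (ip H (T (z i)) i) = Re (ip H (T i) (z i))" if i: "i \<in> F" for i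
      using ip_adjoint_right[OF Tb zc[OF i] Fc[OF i]] T(2) Re_ip_commute[of "z i" "T i"] Tb zc[OF i] Fc[OF i]
      by simp
    ultimately have "(\<Sum>i\<in>F. 2 * Re (ip H (T i) (z i))) = 0" by simp
    then have "(\<Sum>i\<in>F. Re (ip H (T i) (z i))) = 0" by (simp flip: sum_distrib_left)
    then show "Re (ip ?G (\<lambda>i\<in>F. T i) z) = 0" by simp
  qed (rule e)
  then obtain S where S: "S \<in> B" and lt: "hnorm ?G ((\<lambda>i\<in>F. T i) \<ominus>\<^bsub>?G\<^esub> (\<lambda>i\<in>F. S i)) < e" by blast
  have Sb: "S \<in> bounded_ops H" using S Bb by blast
  have "hnorm H (T i \<ominus> S i) < e" if i: "i \<in> F" for i
  proof -
    have eq: "((\<lambda>i\<in>F. T i) \<ominus>\<^bsub>?G\<^esub> (\<lambda>i\<in>F. S i)) i = T i \<ominus> S i"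
      using i Sb Tb Fc G.diff_eq[OF Sc[OF Tb] Sc[OF Sb]] by (simp add: diff_eq)
    have "hnorm H (((\<lambda>i\<in>F. T i) \<ominus>\<^bsub>?G\<^esub> (\<lambda>i\<in>F. S i)) i) \<le> hnorm ?G ((\<lambda>i\<in>F. T i) \<ominus>\<^bsub>?G\<^esub> (\<lambda>i\<in>F. S i))"
      by (rule hnorm_power_component[OF fin _ i]) (use G.M.minus_closed[OF Sc[OF Tb] Sc[OF Sb]] in simp)
    then show ?thesis using lt by (simp add: eq)
  qed
  then show ?thesis using S by (auto simp: B_def)
qed

end

subsection \<open>The resolvent of a self-adjoint operator\<close>

context hilbert_space
begin

text \<open>b = 1 + c^2 satisfies \<parallel>b x\<parallel> \<ge> \<parallel>x\<parallel>, so it is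
  injective with closed range; the range is dense since a vector z orthogonal to b z has
  \<parallel>z\<parallel>^2 + \<parallel>c z\<parallel>^2 = 0. No spectral theory enters.\<close>

lemma resolvent_exists:
  assumes c: "c \<in> bounded_ops H" "adjoint H c = c"
  shows "\<exists>d\<in>bounded_ops H. \<forall>x\<in>carrier H. d (x \<oplus> c (c x)) = x \<and> d x \<oplus> c (c (d x)) = x"
proof -
  have sa: "ip H (c x) y = ip H x (c y)" if "x \<in> carrier H" "y \<in> carrier H" for x y
    using ip_adjoint_right[OF c(1) that] c(2) by simp
  define b where "b = (\<one>\<^bsub>op_algebra H\<^esub> \<oplus>\<^bsub>op_algebra H\<^esub> c \<otimes>\<^bsub>op_algebra H\<^esub> c)"
  have bb: "b \<in> bounded_ops H" using c by (simp add: b_def)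
  have bx: "b x = x \<oplus> c (c x)" if "x \<in> carrier H" for x using that c by (simp add: b_def)
  have bnorm: "hnorm H x \<le> hnorm H (b x)" if x: "x \<in> carrier H" for x
  proof (rule power2_le_imp_le)
    have "(hnorm H (b x))\<^sup>2 = (hnorm H x)\<^sup>2 + 2 * (hnorm H (c x))\<^sup>2 + (hnorm H (c (c x)))\<^sup>2"
      unfolding bx[OF x] using x c sa[of x "c x"] by (subst hnorm_add_sq) (simp_all add: hnorm_sq[of "c x"])
    then show "(hnorm H x)\<^sup>2 \<le> (hnorm H (b x))\<^sup>2" by simp
  qed (use x bb in simp)
  have "\<exists>x\<in>carrier H. b x = y" if y: "y \<in> carrier H" for y
  proof -
    have "\<exists>v\<in>b ` carrier H. hnorm H (y \<ominus> v) < e" if "e > 0" for e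
    proof (rule real_subspace_dense)
      show "b ` carrier H \<subseteq> carrier H" using bb by auto
      show "\<zero> \<in> b ` carrier H" using bb by (intro image_eqI[of _ _ \<zero>]) auto
      show "v \<oplus> w \<in> b ` carrier H" if "v \<in> b ` carrier H" "w \<in> b ` carrier H" for v w
      proof -
        obtain v' w' where "v' \<in> carrier H" "v = b v'" "w' \<in> carrier H" "w = b w'" using \<open>v \<in> _\<close> \<open>w \<in> _\<close> by blast
        then show ?thesis using op_add[OF bb, of v' w'] by (intro image_eqI[of _ _ "v' \<oplus> w'"]) auto
      qed
      show "complex_of_real r \<odot> v \<in> b ` carrier H" if "v \<in> b ` carrier H" for r v
      proof -
        obtain v' where "v' \<in> carrier H" "v = b v'" using \<open>v \<in> _\<close> by blast
        then show ?thesis using op_scale[OF bb, of v'] by (intro image_eqI[of _ _ "complex_of_real r \<odot> v'"]) auto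
      qed
      fix z assume z: "z \<in> carrier H" and o: "\<And>v. v \<in> b ` carrier H \<Longrightarrow> Re (ip H v z) = 0"
      have "Re (ip H (b z) z) = 0" using o z by blast
      then have "(hnorm H z)\<^sup>2 + (hnorm H (c z))\<^sup>2 = 0"
        using z c sa[of "c z" z] by (simp add: bx ip_add_left hnorm_sq)
      then have "z = \<zero>" using z c by (simp add: sum_power2_eq_zero_iff)
      then show "Re (ip H y z) = 0" using y by simp
    qed (use y that in auto)
    then have "\<exists>x\<in>carrier H. hnorm H (y \<ominus> b x) < inverse (real (Suc n))" for n by simp
    then obtain u where u: "\<And>n. u n \<in> carrier H"
      and ub: "\<And>n. hnorm H (y \<ominus> b (u n)) < inverse (real (Suc n))"
      by metis
    \<comment> \<open>Approximate preimages of y form a Cauchy sequence because b does not shrink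
      norms.\<close>
    have "\<exists>x\<in>carrier H. (\<lambda>n. hnorm H (u n \<ominus> x)) \<longlonglongrightarrow> 0"
    proof (rule complete[OF u])
      show "\<exists>k. \<forall>m\<ge>k. \<forall>n\<ge>k. hnorm H (u m \<ominus> u n) < e" if e: "e > 0" for e
      proof -
        have "e / 2 > 0" using e by simp
        then obtain k where k: "inverse (real (Suc k)) < e / 2" using reals_Archimedean by blast
        have "hnorm H (u m \<ominus> u n) < e" if "m \<ge> k" "n \<ge> k" for m n
        proof -
          have "inverse (real (Suc m)) \<le> inverse (real (Suc k))" "inverse (real (Suc n)) \<le> inverse (real (Suc k))"
            using that by (auto intro!: le_imp_inverse_le)
          then have lt: "hnorm H (y \<ominus> b (u m)) < e / 2" "hnorm H (y \<ominus> b (u n)) < e / 2"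
            using ub[of m] ub[of n] k by linarith+
          have "hnorm H (u m \<ominus> u n) \<le> hnorm H (b (u m) \<ominus> b (u n))"
            using bnorm[OF M.minus_closed[OF u u], of m n] op_diff[OF bb u u, of m n] by simp
          also have "\<dots> \<le> hnorm H (b (u m) \<ominus> y) + hnorm H (y \<ominus> b (u n))"
            by (rule hnorm_diff_triangle) (use bb u y in auto)
          also have "hnorm H (b (u m) \<ominus> y) = hnorm H (y \<ominus> b (u m))"
            by (rule hnorm_minus_commute) (use bb u y in auto)
          finally show ?thesis using lt by simp
        qed
        then show ?thesis by blast
      qed
    qed
    then obtain x where x: "x \<in> carrier H" and lim: "(\<lambda>n. hnorm H (u n \<ominus> x)) \<longlonglongrightarrow> 0" by blast
    obtain C where C: "C > 0" "\<And>x. x \<in> carrier H \<Longrightarrow> hnorm H (b x) \<le> C * hnorm H x"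
      using op_bound[OF bb] by blast
    have lim': "(\<lambda>n. inverse (real (Suc n)) + C * hnorm H (u n \<ominus> x)) \<longlonglongrightarrow> 0 + C * 0"
      by (intro tendsto_intros lim LIMSEQ_inverse_real_of_nat)
    have "hnorm H (y \<ominus> b x) \<le> inverse (real (Suc n)) + C * hnorm H (u n \<ominus> x)" for n
    proof -
      have "hnorm H (y \<ominus> b x) \<le> hnorm H (y \<ominus> b (u n)) + hnorm H (b (u n) \<ominus> b x)"
        by (rule hnorm_diff_triangle) (use bb u x y in auto)
      also have "b (u n) \<ominus> b x = b (u n \<ominus> x)" using op_diff[OF bb u x] by simp
      also have "hnorm H \<dots> \<le> C * hnorm H (u n \<ominus> x)" by (rule C(2)[OF M.minus_closed[OF u x]])
      finally show ?thesis using ub[of n] by linarith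
    qed
    then have "hnorm H (y \<ominus> b x) \<le> 0 + C * 0" by (intro LIMSEQ_le_const[OF lim'] exI allI impI)
    then have "hnorm H (y \<ominus> b x) = 0" using bb x y by (intro antisym hnorm_nonneg) simp_all
    then have "y = b x" using hnorm_diff_eq_0[OF y] bb x by simp
    then show ?thesis using x by blast
  qed
  then obtain g where g: "\<And>y. y \<in> carrier H \<Longrightarrow> g y \<in> carrier H" and bg: "\<And>y. y \<in> carrier H \<Longrightarrow> b (g y) = y"
    by metis
  have inj: "x = y" if "x \<in> carrier H" "y \<in> carrier H" "b x = b y" for x y
  proof -
    have "hnorm H (x \<ominus> y) \<le> hnorm H (b x \<ominus> b y)"
      using bnorm[of "x \<ominus> y"] op_diff[OF bb, of x y] that by simp
    also have "\<dots> = 0" using that bb by simp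
    finally have "hnorm H (x \<ominus> y) = 0" using that by (intro antisym) auto
    then show ?thesis using hnorm_diff_eq_0 that by blast
  qed
  define d where "d = restrict g (carrier H)"
  have dx: "d x \<in> carrier H" "b (d x) = x" if "x \<in> carrier H" for x
    using that g bg by (auto simp: d_def)
  have db: "d \<in> bounded_ops H"
  proof (rule bounded_opsI[of _ 1])
    show "d (x \<oplus> y) = d x \<oplus> d y" if "x \<in> carrier H" "y \<in> carrier H" for x y
      by (rule inj) (use that dx op_add[OF bb] in auto)
    show "d (k \<odot> x) = k \<odot> d x" if "x \<in> carrier H" for k x
      by (rule inj) (use that dx op_scale[OF bb] in auto)
    show "hnorm H (d x) \<le> 1 * hnorm H x" if "x \<in> carrier H" for x
      using bnorm[of "d x"] dx that by simp
  qed (use dx in \<open>auto simp: d_def\<close>)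
  have "d (x \<oplus> c (c x)) = x" if "x \<in> carrier H" for x
    unfolding bx[OF that, symmetric] by (rule inj) (use that dx bb in auto)
  moreover have "d x \<oplus> c (c (d x)) = x" if "x \<in> carrier H" for x
    using dx(2)[OF that] unfolding bx[OF dx(1)[OF that]] .
  ultimately show ?thesis using db by blast
qed

end

context von_neumann_algebra
begin

text \<open>d commutes with whatever commutes with c, so it lies in the bicommutant, which is M. The
  bounds are those of 1 / (1 + t^2) and t / (1 + t^2); both are independent of c and come from
  expanding the squared norm of x = d x + c (c (d x)).\<close>

lemma resolvent_mem:
  assumes c: "c \<in> M" "adjoint H c = c"
  obtains d where "d \<in> M" "adjoint H d = d" "\<And>x. x \<in> carrier H \<Longrightarrow> d x \<oplus> c (c (d x)) = x"
    "\<And>x. x \<in> carrier H \<Longrightarrow> d (c x) = c (d x)"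
    "\<And>x. x \<in> carrier H \<Longrightarrow> hnorm H (d x) \<le> hnorm H x"
    "\<And>x. x \<in> carrier H \<Longrightarrow> 2 * hnorm H (c (d x)) \<le> hnorm H x"
proof -
  have cb: "c \<in> bounded_ops H" using c by simp
  obtain d where db: "d \<in> bounded_ops H" and left: "\<And>x. x \<in> carrier H \<Longrightarrow> d (x \<oplus> c (c x)) = x"
    and right: "\<And>x. x \<in> carrier H \<Longrightarrow> d x \<oplus> c (c (d x)) = x"
    using resolvent_exists[OF cb c(2)] by blast
  have comm: "d (R x) = R (d x)"
    if R: "R \<in> bounded_ops H" "\<And>x. x \<in> carrier H \<Longrightarrow> R (c x) = c (R x)" and x: "x \<in> carrier H" for R x
  proof -
    have "R x = R (d x \<oplus> c (c (d x)))" using right x by simp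
    also have "\<dots> = R (d x) \<oplus> c (c (R (d x)))" using R x db cb by (simp add: op_add[OF R(1)])
    finally have "d (R x) = d (R (d x) \<oplus> c (c (R (d x))))" by simp
    also have "\<dots> = R (d x)" by (rule left) (use R x db in auto)
    finally show ?thesis .
  qed
  have sa: "ip H (c x) y = ip H x (c y)" if "x \<in> carrier H" "y \<in> carrier H" for x y
    using ip_adjoint_right[OF cb that] c(2) by simp
  have norm: "(hnorm H x)\<^sup>2 = (hnorm H (d x))\<^sup>2 + 2 * (hnorm H (c (d x)))\<^sup>2 + (hnorm H (c (c (d x))))\<^sup>2"
    if x: "x \<in> carrier H" for x
  proof -
    have "(hnorm H x)\<^sup>2 = (hnorm H (d x \<oplus> c (c (d x))))\<^sup>2" by (simp only: right[OF x])
    also have "\<dots> = (hnorm H (d x))\<^sup>2 + 2 * Re (ip H (d x) (c (c (d x)))) + (hnorm H (c (c (d x))))\<^sup>2"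
      by (rule hnorm_add_sq) (use x cb db in auto)
    also have "ip H (d x) (c (c (d x))) = ip H (c (d x)) (c (d x))"
      by (rule sa[symmetric]) (use x cb db in auto)
    finally show ?thesis using x cb db by (simp add: hnorm_sq[of "c (d x)"])
  qed
  show ?thesis
  proof (rule that)
    have "d \<in> commutant H (commutant H M)"
      unfolding commutant_def[of H "commutant H M"]
    proof (intro CollectI conjI ballI)
      fix R x assume R: "R \<in> commutant H M" and x: "x \<in> carrier H"
      show "d (R x) = R (d x)"
        by (rule comm) (use commutant_bounded[OF R] commutantD[OF R c(1)] x in auto)
    qed (rule db)
    then show "d \<in> M" using sot_closed sot_closure_eq_bicommutant by blast
    show "adjoint H d = d"
    proof (rule adjoint_eqI[OF db db])
      fix x y assume x: "x \<in> carrier H" and y: "y \<in> carrier H"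
      have "ip H (d x) y = ip H (d x) (d y \<oplus> c (c (d y)))" using right y by simp
      also have "\<dots> = ip H (d x \<oplus> c (c (d x))) (d y)"
        using x y cb db by (simp add: ip_simps sa)
      also have "\<dots> = ip H x (d y)" using right x by simp
      finally show "ip H (d x) y = ip H x (d y)" .
    qed
    show "d (c x) = c (d x)" if "x \<in> carrier H" for x by (rule comm) (use cb that in auto)
    show "hnorm H (d x) \<le> hnorm H x" if x: "x \<in> carrier H" for x
      by (rule power2_le_imp_le) (use norm[OF x] x in auto)
    show "2 * hnorm H (c (d x)) \<le> hnorm H x" if x: "x \<in> carrier H" for x
    proof (rule power2_le_imp_le)
      have "(hnorm H (c (d x)))\<^sup>2 = Re (ip H (d x) (c (c (d x))))"
        using x cb db by (simp add: hnorm_sq sa)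
      also have "\<dots> \<le> hnorm H (d x) * hnorm H (c (c (d x)))"
        by (rule order_trans[OF complex_Re_le_cmod cauchy_schwarz]) (use x cb db in auto)
      \<comment> \<open>Arithmetic-geometric mean: twice the squared norm of c (d x) is at most the
        sum of the two outer terms, so the expansion in \<open>norm\<close> dominates four times
        it.\<close>
      finally have "2 * (hnorm H (c (d x)))\<^sup>2 \<le> (hnorm H (d x))\<^sup>2 + (hnorm H (c (c (d x))))\<^sup>2"
        using sum_squares_bound[of "hnorm H (d x)" "hnorm H (c (c (d x)))"] by linarith
      then show "(2 * hnorm H (c (d x)))\<^sup>2 \<le> (hnorm H x)\<^sup>2" using norm[OF x] by (simp add: power_mult_distrib)
    qed (use x in auto)
  qed (rule right)
qed

end

section \<open>Ultraproducts\<close>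

locale free_ultrafilter_on_nat =
  fixes \<omega> :: "nat filter"
  assumes free: "free_ultrafilter \<omega>"
begin

lemma nontrivial [simp]: "\<omega> \<noteq> bot"
  using free by (simp add: free_ultrafilter_def)

lemma ultra: "eventually P \<omega> \<or> eventually (\<lambda>n. \<not> P n) \<omega>"
  using free by (simp add: free_ultrafilter_def)

text \<open>Freeness excludes each single index, hence each finite set of them. This is how a
  quality that improves with n becomes arbitrarily good along \<omega>.\<close>

lemma eventually_ge: "eventually (\<lambda>n. n \<ge> m) \<omega>"
proof -
  have "eventually (\<lambda>n. \<forall>k\<in>{..<m}. n \<noteq> k) \<omega>"
    by (rule eventually_ball_finite) (use free in \<open>auto simp: free_ultrafilter_def\<close>)
  then show ?thesis by eventually_elim (auto simp: not_less[symmetric])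
qed

text \<open>Compactness gives a cluster point, and for an ultrafilter every cluster point is a
  limit: a neighbourhood that is not eventually entered would be eventually avoided.\<close>

lemma tendsto_compact:
  fixes f :: "nat \<Rightarrow> 'x::topological_space"
  assumes "compact U" "\<And>n. f n \<in> U"
  shows "\<exists>c\<in>U. (f \<longlongrightarrow> c) \<omega>"
proof -
  have "filtermap f \<omega> \<noteq> bot" by (simp add: filtermap_bot_iff)
  moreover have "eventually (\<lambda>x. x \<in> U) (filtermap f \<omega>)" by (simp add: eventually_filtermap assms)
  ultimately obtain c where c: "c \<in> U" "inf (nhds c) (filtermap f \<omega>) \<noteq> bot"
    using assms(1) unfolding compact_filter by blast
  have "(f \<longlongrightarrow> c) \<omega>"
  proof (rule topological_tendstoI)
    fix S assume S: "open S" "c \<in> S"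
    show "eventually (\<lambda>n. f n \<in> S) \<omega>"
    proof (rule ccontr)
      assume "\<not> eventually (\<lambda>n. f n \<in> S) \<omega>"
      then have "eventually (\<lambda>x. x \<notin> S) (filtermap f \<omega>)"
        using ultra[of "\<lambda>n. f n \<in> S"] by (simp add: eventually_filtermap)
      moreover have "eventually (\<lambda>x. x \<in> S) (nhds c)" using S by (rule eventually_nhds_in_open)
      ultimately have "eventually (\<lambda>x. False) (inf (nhds c) (filtermap f \<omega>))"
        unfolding eventually_inf by (intro exI[of _ "\<lambda>x. x \<in> S"] exI[of _ "\<lambda>x. x \<notin> S"]) auto
      then show False using c(2) by (simp add: trivial_limit_def)
    qed
  qed
  then show ?thesis using c(1) by blast
qed

lemma convergent_bounded_complex:
  fixes f :: "nat \<Rightarrow> complex"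
  assumes "\<And>n. cmod (f n) \<le> C"
  shows "\<exists>c. (f \<longlongrightarrow> c) \<omega>"
  using tendsto_compact[of "cball 0 C" f] assms by auto

lemma ulim_unique: "\<lbrakk>(f \<longlongrightarrow> a) \<omega>; (f \<longlongrightarrow> b) \<omega>\<rbrakk> \<Longrightarrow> a = (b::'b::t2_space)"
  by (rule tendsto_unique[OF nontrivial])

lemma tendsto_zero_mono:
  fixes f g :: "nat \<Rightarrow> real"
  assumes "(g \<longlongrightarrow> 0) \<omega>" "\<And>n. 0 \<le> f n" "\<And>n. f n \<le> g n"
  shows "(f \<longlongrightarrow> 0) \<omega>"
  using assms(1) by (rule Lim_null_comparison[rotated]) (use assms in auto)

text \<open>Countable saturation: choosing \<open>x\<^sub>n\<close> almost optimally for each \<open>n\<close> beats every fixed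
  approximation quality along \<open>\<omega>\<close>.\<close>

lemma saturation:
  fixes g :: "nat \<Rightarrow> 'x \<Rightarrow> real"
  assumes ne: "\<And>n. X n \<noteq> {}" and nn: "\<And>n x. x \<in> X n \<Longrightarrow> 0 \<le> g n x"
    and app: "\<And>e. e > 0 \<Longrightarrow> eventually (\<lambda>n. \<exists>x\<in>X n. g n x < e) \<omega>"
  shows "\<exists>x. (\<forall>n. x n \<in> X n) \<and> ((\<lambda>n. g n (x n)) \<longlongrightarrow> 0) \<omega>"
proof -
  have bdd: "bdd_below (g n ` X n)" for n using nn by (intro bdd_belowI[of _ 0]) auto
  have "\<exists>x\<in>X n. g n x < (INF x\<in>X n. g n x) + inverse (real (Suc n))" for n
    using cINF_less_iff[OF ne bdd, of n "(INF x\<in>X n. g n x) + inverse (real (Suc n))"] by simp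
  then obtain x where x: "\<And>n. x n \<in> X n"
    and lt: "\<And>n. g n (x n) < (INF x\<in>X n. g n x) + inverse (real (Suc n))"
    by metis
  have "((\<lambda>n. g n (x n)) \<longlongrightarrow> 0) \<omega>"
  proof (rule order_tendstoI)
    show "eventually (\<lambda>n. a < g n (x n)) \<omega>" if "a < 0" for a
      using nn x that by (intro always_eventually allI) (meson less_le_trans)
    fix e :: real assume e: "0 < e"
    obtain k where k: "inverse (real (Suc k)) < e / 2" using e reals_Archimedean[of "e / 2"] by auto
    have "eventually (\<lambda>n. \<exists>x\<in>X n. g n x < e / 2) \<omega>" using e by (intro app) simp
    then show "eventually (\<lambda>n. g n (x n) < e) \<omega>"
      using eventually_ge[of k]
    proof eventually_elim
      case (elim n)
      then obtain y where y: "y \<in> X n" "g n y < e / 2" by blast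
      have "(INF x\<in>X n. g n x) \<le> g n y" using bdd y(1) by (rule cINF_lower)
      moreover have "inverse (real (Suc n)) \<le> inverse (real (Suc k))" using elim by (intro le_imp_inverse_le) auto
      ultimately show ?case using lt[of n] y(2) k by linarith
    qed
  qed
  then show ?thesis using x by blast
qed

end

section \<open>The ultraproduct of Hilbert spaces\<close>

locale hilbert_sequence = free_ultrafilter_on_nat \<omega> for \<omega> :: "nat filter" +
  fixes H :: "nat \<Rightarrow> 'h hilbert"
  assumes hilbert: "\<And>n. hilbert_space (H n)"
begin

abbreviation \<H> :: "(nat \<Rightarrow> 'h) set hilbert" where "\<H> \<equiv> hilbert_ultraproduct \<omega> H"

abbreviation cls :: "(nat \<Rightarrow> 'h) \<Rightarrow> (nat \<Rightarrow> 'h) set" where "cls \<equiv> vec_class \<omega> H"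

sublocale F: hilbert_space "H n" for n by (rule hilbert)

lemma bounded_seqsD: "u \<in> bounded_seqs H \<Longrightarrow> u n \<in> carrier (H n)"
  by (simp add: bounded_seqs_def)

lemma bounded_seqs_bound:
  assumes "u \<in> bounded_seqs H"
  obtains C where "C > 0" "\<And>n. hnorm (H n) (u n) \<le> C"
proof -
  obtain C where C: "\<And>n. hnorm (H n) (u n) \<le> C" using assms by (auto simp: bounded_seqs_def)
  show ?thesis by (rule that[of "max C 1"]) (use C in \<open>auto simp: max.coboundedI1\<close>)
qed

lemma bounded_seqsI:
  "\<lbrakk>\<And>n. u n \<in> carrier (H n); \<And>n. hnorm (H n) (u n) \<le> C\<rbrakk> \<Longrightarrow> u \<in> bounded_seqs H"
  by (auto simp: bounded_seqs_def)

lemma zero_bounded_seq [simp]: "(\<lambda>n. \<zero>\<^bsub>H n\<^esub>) \<in> bounded_seqs H"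
  by (rule bounded_seqsI[of _ 0]) auto

lemma add_bounded_seq [simp]:
  assumes u: "u \<in> bounded_seqs H" and v: "v \<in> bounded_seqs H"
  shows "(\<lambda>n. u n \<oplus>\<^bsub>H n\<^esub> v n) \<in> bounded_seqs H"
proof -
  obtain C where C: "\<And>n. hnorm (H n) (u n) \<le> C" using bounded_seqs_bound[OF u] by blast
  obtain D where D: "\<And>n. hnorm (H n) (v n) \<le> D" using bounded_seqs_bound[OF v] by blast
  show ?thesis
  proof (rule bounded_seqsI[of _ "C + D"])
    show "hnorm (H n) (u n \<oplus>\<^bsub>H n\<^esub> v n) \<le> C + D" for n
      using F.hnorm_triangle[OF bounded_seqsD[OF u] bounded_seqsD[OF v], of n] C[of n] D[of n] by linarith
  qed (use u v in \<open>auto simp: bounded_seqsD\<close>)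
qed

lemma scale_bounded_seq [simp]:
  assumes u: "u \<in> bounded_seqs H"
  shows "(\<lambda>n. c \<odot>\<^bsub>H n\<^esub> u n) \<in> bounded_seqs H"
proof -
  obtain C where C: "\<And>n. hnorm (H n) (u n) \<le> C" using bounded_seqs_bound[OF u] by blast
  show ?thesis
    by (rule bounded_seqsI[of _ "cmod c * C"]) (use u C in \<open>auto simp: bounded_seqsD intro: mult_left_mono\<close>)
qed

lemma cls_mem: "v \<in> cls u \<longleftrightarrow> v \<in> bounded_seqs H \<and> ((\<lambda>n. hnorm (H n) (v n \<ominus>\<^bsub>H n\<^esub> u n)) \<longlongrightarrow> 0) \<omega>"
  by (simp add: vec_class_def)

lemma cls_self [simp]: "u \<in> bounded_seqs H \<Longrightarrow> u \<in> cls u"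
  by (simp add: cls_mem bounded_seqsD)

lemma cls_eqI:
  assumes u: "u \<in> bounded_seqs H" and v: "v \<in> bounded_seqs H"
    and lim: "((\<lambda>n. hnorm (H n) (u n \<ominus>\<^bsub>H n\<^esub> v n)) \<longlongrightarrow> 0) \<omega>"
  shows "cls u = cls v"
proof -
  have *: "w \<in> cls b"
    if "w \<in> cls a" "a \<in> bounded_seqs H" "b \<in> bounded_seqs H"
      and l: "((\<lambda>n. hnorm (H n) (a n \<ominus>\<^bsub>H n\<^esub> b n)) \<longlongrightarrow> 0) \<omega>" for w a b
  proof -
    have w: "w \<in> bounded_seqs H" "((\<lambda>n. hnorm (H n) (w n \<ominus>\<^bsub>H n\<^esub> a n)) \<longlongrightarrow> 0) \<omega>"
      using that(1) by (auto simp: cls_mem)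
    have "((\<lambda>n. hnorm (H n) (w n \<ominus>\<^bsub>H n\<^esub> b n)) \<longlongrightarrow> 0) \<omega>"
    proof (rule tendsto_zero_mono)
      show "((\<lambda>n. hnorm (H n) (w n \<ominus>\<^bsub>H n\<^esub> a n) + hnorm (H n) (a n \<ominus>\<^bsub>H n\<^esub> b n)) \<longlongrightarrow> 0) \<omega>"
        using tendsto_add[OF w(2) l] by simp
      show "hnorm (H n) (w n \<ominus>\<^bsub>H n\<^esub> b n) \<le> hnorm (H n) (w n \<ominus>\<^bsub>H n\<^esub> a n) + hnorm (H n) (a n \<ominus>\<^bsub>H n\<^esub> b n)" for n
        by (rule F.hnorm_diff_triangle) (use that w in \<open>auto intro: bounded_seqsD\<close>)
      show "0 \<le> hnorm (H n) (w n \<ominus>\<^bsub>H n\<^esub> b n)" for n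
        using bounded_seqsD that w(1) by simp
    qed
    then show ?thesis using w by (simp add: cls_mem)
  qed
  have "((\<lambda>n. hnorm (H n) (v n \<ominus>\<^bsub>H n\<^esub> u n)) \<longlongrightarrow> 0) \<omega>"
    using lim F.hnorm_minus_commute[OF bounded_seqsD[OF u] bounded_seqsD[OF v]] by simp
  then show ?thesis using *[OF _ u v lim] *[OF _ v u] by blast
qed

lemma carrier_ultra: "carrier \<H> = cls ` bounded_seqs H"
  by (simp add: hilbert_ultraproduct_def)

lemma cls_closed [simp]: "u \<in> bounded_seqs H \<Longrightarrow> cls u \<in> carrier \<H>"
  by (simp add: carrier_ultra)

lemma carrier_ultraE:
  assumes "X \<in> carrier \<H>"
  obtains u where "u \<in> bounded_seqs H" "X = cls u"
  using assms by (auto simp: carrier_ultra)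

text \<open>Operations on classes are defined as unions over representatives; this collapses the
  union once the result is independent of the choice.\<close>

lemma UN_cls:
  assumes u: "u \<in> bounded_seqs H" and "\<And>v. v \<in> cls u \<Longrightarrow> f v = Y"
  shows "(\<Union>v\<in>cls u. f v) = Y"
  using cls_self[OF u] assms(2) by blast

lemma zero_ultra: "\<zero>\<^bsub>\<H>\<^esub> = cls (\<lambda>n. \<zero>\<^bsub>H n\<^esub>)"
  by (simp add: hilbert_ultraproduct_def)

lemma add_ultra:
  assumes u: "u \<in> bounded_seqs H" and v: "v \<in> bounded_seqs H"
  shows "cls u \<oplus>\<^bsub>\<H>\<^esub> cls v = cls (\<lambda>n. u n \<oplus>\<^bsub>H n\<^esub> v n)"
proof -
  have "cls (\<lambda>n. a n \<oplus>\<^bsub>H n\<^esub> b n) = cls (\<lambda>n. u n \<oplus>\<^bsub>H n\<^esub> v n)" if "a \<in> cls u" "b \<in> cls v" for a b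
  proof (rule cls_eqI)
    have ab: "a \<in> bounded_seqs H" "b \<in> bounded_seqs H" using that by (auto simp: cls_mem)
    show "(\<lambda>n. a n \<oplus>\<^bsub>H n\<^esub> b n) \<in> bounded_seqs H" "(\<lambda>n. u n \<oplus>\<^bsub>H n\<^esub> v n) \<in> bounded_seqs H"
      using ab u v by simp_all
    note c = ab[THEN bounded_seqsD] u[THEN bounded_seqsD] v[THEN bounded_seqsD]
    show "((\<lambda>n. hnorm (H n) ((a n \<oplus>\<^bsub>H n\<^esub> b n) \<ominus>\<^bsub>H n\<^esub> (u n \<oplus>\<^bsub>H n\<^esub> v n))) \<longlongrightarrow> 0) \<omega>"
    proof (rule tendsto_zero_mono)
      show "((\<lambda>n. hnorm (H n) (a n \<ominus>\<^bsub>H n\<^esub> u n) + hnorm (H n) (b n \<ominus>\<^bsub>H n\<^esub> v n)) \<longlongrightarrow> 0) \<omega>"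
        using that by (intro tendsto_add_zero) (auto simp: cls_mem)
      show "hnorm (H n) ((a n \<oplus>\<^bsub>H n\<^esub> b n) \<ominus>\<^bsub>H n\<^esub> (u n \<oplus>\<^bsub>H n\<^esub> v n))
          \<le> hnorm (H n) (a n \<ominus>\<^bsub>H n\<^esub> u n) + hnorm (H n) (b n \<ominus>\<^bsub>H n\<^esub> v n)" for n
        by (rule F.hnorm_sum_diff_le) (rule c)+
      show "0 \<le> hnorm (H n) ((a n \<oplus>\<^bsub>H n\<^esub> b n) \<ominus>\<^bsub>H n\<^esub> (u n \<oplus>\<^bsub>H n\<^esub> v n))" for n using c by simp
    qed
  qed
  then have "(\<Union>a\<in>cls u. \<Union>b\<in>cls v. cls (\<lambda>n. a n \<oplus>\<^bsub>H n\<^esub> b n)) = cls (\<lambda>n. u n \<oplus>\<^bsub>H n\<^esub> v n)"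
    by (intro UN_cls u v) auto
  then show ?thesis by (simp add: hilbert_ultraproduct_def)
qed

lemma smult_ultra:
  assumes u: "u \<in> bounded_seqs H"
  shows "c \<odot>\<^bsub>\<H>\<^esub> cls u = cls (\<lambda>n. c \<odot>\<^bsub>H n\<^esub> u n)"
proof -
  have "cls (\<lambda>n. c \<odot>\<^bsub>H n\<^esub> a n) = cls (\<lambda>n. c \<odot>\<^bsub>H n\<^esub> u n)" if "a \<in> cls u" for a
  proof (rule cls_eqI)
    have a: "a \<in> bounded_seqs H" using that by (auto simp: cls_mem)
    show "(\<lambda>n. c \<odot>\<^bsub>H n\<^esub> a n) \<in> bounded_seqs H" "(\<lambda>n. c \<odot>\<^bsub>H n\<^esub> u n) \<in> bounded_seqs H"
      using a u by simp_all
    have "((\<lambda>n. cmod c * hnorm (H n) (a n \<ominus>\<^bsub>H n\<^esub> u n)) \<longlongrightarrow> cmod c * 0) \<omega>"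
      using that by (intro tendsto_intros) (simp add: cls_mem)
    then show "((\<lambda>n. hnorm (H n) (c \<odot>\<^bsub>H n\<^esub> a n \<ominus>\<^bsub>H n\<^esub> c \<odot>\<^bsub>H n\<^esub> u n)) \<longlongrightarrow> 0) \<omega>"
      using F.hnorm_scale_diff[OF bounded_seqsD[OF a] bounded_seqsD[OF u]] by simp
  qed
  then have "(\<Union>a\<in>cls u. cls (\<lambda>n. c \<odot>\<^bsub>H n\<^esub> a n)) = cls (\<lambda>n. c \<odot>\<^bsub>H n\<^esub> u n)"
    by (intro UN_cls u)
  then show ?thesis by (simp add: hilbert_ultraproduct_def)
qed

text \<open>The limit exists by compactness since the inner products are bounded, it is unique since
  \<omega> is proper, and other representatives change the inner products by a null sequence.
  Together these facts evaluate the definite description in the inner product of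
  \<open>\<H>\<close>.\<close>

lemma ip_ultra_tendsto:
  assumes u: "u \<in> bounded_seqs H" and v: "v \<in> bounded_seqs H"
  shows "((\<lambda>n. ip (H n) (u n) (v n)) \<longlongrightarrow> ip \<H> (cls u) (cls v)) \<omega>"
proof -
  obtain C where C: "C > 0" "\<And>n. hnorm (H n) (u n) \<le> C" using bounded_seqs_bound[OF u] by blast
  obtain D where D: "D > 0" "\<And>n. hnorm (H n) (v n) \<le> D" using bounded_seqs_bound[OF v] by blast
  note c = u[THEN bounded_seqsD] v[THEN bounded_seqsD]
  have "cmod (ip (H n) (u n) (v n)) \<le> C * D" for n
  proof -
    have "hnorm (H n) (u n) * hnorm (H n) (v n) \<le> C * D"
      using C(2)[of n] D(2)[of n] C(1) c by (intro mult_mono) auto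
    then show ?thesis using F.cauchy_schwarz[OF c, of n] by linarith
  qed
  then obtain L where L: "((\<lambda>n. ip (H n) (u n) (v n)) \<longlongrightarrow> L) \<omega>"
    using convergent_bounded_complex[of "\<lambda>n. ip (H n) (u n) (v n)" "C * D"] by blast
  have all: "((\<lambda>n. ip (H n) (a n) (b n)) \<longlongrightarrow> L) \<omega>" if "a \<in> cls u" "b \<in> cls v" for a b
  proof -
    have ab: "a \<in> bounded_seqs H" "b \<in> bounded_seqs H" using that by (auto simp: cls_mem)
    note d = ab[THEN bounded_seqsD]
    obtain E where E: "E > 0" "\<And>n. hnorm (H n) (b n) \<le> E" using bounded_seqs_bound[OF ab(2)] by blast
    have "((\<lambda>n. ip (H n) (a n) (b n) - ip (H n) (u n) (v n)) \<longlongrightarrow> 0) \<omega>"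
    proof (rule Lim_null_comparison)
      have "((\<lambda>n. hnorm (H n) (a n \<ominus>\<^bsub>H n\<^esub> u n) * E + C * hnorm (H n) (b n \<ominus>\<^bsub>H n\<^esub> v n)) \<longlongrightarrow> 0 * E + C * 0) \<omega>"
        using that by (intro tendsto_intros) (auto simp: cls_mem)
      then show "((\<lambda>n. hnorm (H n) (a n \<ominus>\<^bsub>H n\<^esub> u n) * E + C * hnorm (H n) (b n \<ominus>\<^bsub>H n\<^esub> v n)) \<longlongrightarrow> 0) \<omega>" by simp
      show "eventually (\<lambda>n. cmod (ip (H n) (a n) (b n) - ip (H n) (u n) (v n))
          \<le> hnorm (H n) (a n \<ominus>\<^bsub>H n\<^esub> u n) * E + C * hnorm (H n) (b n \<ominus>\<^bsub>H n\<^esub> v n)) \<omega>"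
      proof (intro always_eventually allI)
        fix n
        have "ip (H n) (a n) (b n) - ip (H n) (u n) (v n) =
            ip (H n) (a n \<ominus>\<^bsub>H n\<^esub> u n) (b n) + ip (H n) (u n) (b n \<ominus>\<^bsub>H n\<^esub> v n)"
          using c d by (simp add: F.ip_diff_left F.ip_diff_right)
        also have "cmod \<dots> \<le> cmod (ip (H n) (a n \<ominus>\<^bsub>H n\<^esub> u n) (b n)) + cmod (ip (H n) (u n) (b n \<ominus>\<^bsub>H n\<^esub> v n))"
          by (rule norm_triangle_ineq)
        also have "\<dots> \<le> hnorm (H n) (a n \<ominus>\<^bsub>H n\<^esub> u n) * hnorm (H n) (b n) +
            hnorm (H n) (u n) * hnorm (H n) (b n \<ominus>\<^bsub>H n\<^esub> v n)"
          using c d by (intro add_mono F.cauchy_schwarz) auto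
        also have "\<dots> \<le> hnorm (H n) (a n \<ominus>\<^bsub>H n\<^esub> u n) * E + C * hnorm (H n) (b n \<ominus>\<^bsub>H n\<^esub> v n)"
          using C(2)[of n] E(2)[of n] c d by (intro add_mono mult_left_mono mult_right_mono) auto
        finally show "cmod (ip (H n) (a n) (b n) - ip (H n) (u n) (v n))
          \<le> hnorm (H n) (a n \<ominus>\<^bsub>H n\<^esub> u n) * E + C * hnorm (H n) (b n \<ominus>\<^bsub>H n\<^esub> v n)" .
      qed
    qed
    from tendsto_add[OF this L] show ?thesis by simp
  qed
  have "ip \<H> (cls u) (cls v) = (THE c. \<forall>a\<in>cls u. \<forall>b\<in>cls v. ((\<lambda>n. ip (H n) (a n) (b n)) \<longlongrightarrow> c) \<omega>)"
    by (simp add: hilbert_ultraproduct_def)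
  also have "\<dots> = L"
  proof (rule the_equality)
    fix c assume "\<forall>a\<in>cls u. \<forall>b\<in>cls v. ((\<lambda>n. ip (H n) (a n) (b n)) \<longlongrightarrow> c) \<omega>"
    then have "((\<lambda>n. ip (H n) (u n) (v n)) \<longlongrightarrow> c) \<omega>" using cls_self[OF u] cls_self[OF v] by blast
    then show "c = L" using L by (rule ulim_unique)
  qed (use all in blast)
  finally show ?thesis using L by simp
qed

lemma ip_ultra_eqI:
  assumes "u \<in> bounded_seqs H" "v \<in> bounded_seqs H" "((\<lambda>n. ip (H n) (u n) (v n)) \<longlongrightarrow> c) \<omega>"
  shows "ip \<H> (cls u) (cls v) = c"
  using ip_ultra_tendsto[OF assms(1,2)] assms(3) by (rule ulim_unique)

lemma hnorm_ultra_tendsto: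
  assumes u: "u \<in> bounded_seqs H"
  shows "((\<lambda>n. hnorm (H n) (u n)) \<longlongrightarrow> hnorm \<H> (cls u)) \<omega>"
  unfolding hnorm_def by (intro tendsto_intros ip_ultra_tendsto u)

lemma diff_bounded_seq [simp]:
  assumes u: "u \<in> bounded_seqs H" and v: "v \<in> bounded_seqs H"
  shows "(\<lambda>n. u n \<ominus>\<^bsub>H n\<^esub> v n) \<in> bounded_seqs H"
  using add_bounded_seq[OF u scale_bounded_seq[OF v, of "-1"]] u v
  by (simp add: F.diff_eq bounded_seqsD)

lemma hnorm_ultra_diff:
  assumes u: "u \<in> bounded_seqs H" and v: "v \<in> bounded_seqs H"
  shows "((\<lambda>n. hnorm (H n) (u n \<ominus>\<^bsub>H n\<^esub> v n)) \<longlongrightarrow> hnorm \<H> (cls u \<oplus>\<^bsub>\<H>\<^esub> (-1) \<odot>\<^bsub>\<H>\<^esub> cls v)) \<omega>"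
proof -
  have "cls u \<oplus>\<^bsub>\<H>\<^esub> (-1) \<odot>\<^bsub>\<H>\<^esub> cls v = cls (\<lambda>n. u n \<ominus>\<^bsub>H n\<^esub> v n)"
    using u v by (simp add: smult_ultra add_ultra F.diff_eq bounded_seqsD)
  then show ?thesis using hnorm_ultra_tendsto[OF diff_bounded_seq[OF u v]] by simp
qed

text \<open>Diagonal argument: \<open>w\<^sub>n\<close> is the entry \<open>n\<close> of the latest representative that is, at \<open>n\<close>,
  bounded by \<open>C\<close> and within the Cauchy tolerance of all earlier ones.\<close>

lemma ultra_complete:
  assumes uc: "\<And>n. U n \<in> carrier \<H>"
    and cauchy: "\<And>e. e > 0 \<Longrightarrow> \<exists>k. \<forall>m\<ge>k. \<forall>n\<ge>k. hnorm \<H> (U m \<oplus>\<^bsub>\<H>\<^esub> (-1) \<odot>\<^bsub>\<H>\<^esub> U n) < e"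
  shows "\<exists>x\<in>carrier \<H>. (\<lambda>n. hnorm \<H> (U n \<oplus>\<^bsub>\<H>\<^esub> (-1) \<odot>\<^bsub>\<H>\<^esub> x)) \<longlonglongrightarrow> 0"
proof -
  obtain u where u: "\<And>i. u i \<in> bounded_seqs H" and U: "\<And>i. U i = cls (u i)"
  proof -
    have "\<forall>i. \<exists>u. u \<in> bounded_seqs H \<and> U i = cls u" using uc by (auto simp: carrier_ultra)
    then obtain u where "\<forall>i. u i \<in> bounded_seqs H \<and> U i = cls (u i)" by (rule choice[THEN exE])
    then show ?thesis using that by blast
  qed
  note ucc = u[THEN bounded_seqsD]
  obtain N where N: "\<And>j m n. \<lbrakk>m \<ge> N j; n \<ge> N j\<rbrakk> \<Longrightarrow> hnorm \<H> (U m \<oplus>\<^bsub>\<H>\<^esub> (-1) \<odot>\<^bsub>\<H>\<^esub> U n) < inverse (real (Suc j))"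
  proof -
    have "\<forall>j. \<exists>k. \<forall>m\<ge>k. \<forall>n\<ge>k. hnorm \<H> (U m \<oplus>\<^bsub>\<H>\<^esub> (-1) \<odot>\<^bsub>\<H>\<^esub> U n) < inverse (real (Suc j))"
      using cauchy by simp
    then obtain N where "\<forall>j. \<forall>m\<ge>N j. \<forall>n\<ge>N j. hnorm \<H> (U m \<oplus>\<^bsub>\<H>\<^esub> (-1) \<odot>\<^bsub>\<H>\<^esub> U n) < inverse (real (Suc j))"
      by (rule choice[THEN exE])
    then show ?thesis using that by blast
  qed
  \<comment> \<open>Since \<open>s k\<close> is at least \<open>N j\<close> for every j \<le> k, the
    subsequence v meets the j-th Cauchy tolerance from its j-th member on.\<close>
  define s where "s j = Max (N ` {..j}) + j" for j
  have sN: "N j \<le> s k" if "j \<le> k" for j k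
  proof -
    have "N j \<le> Max (N ` {..k})" using that by (intro Max_ge) auto
    then show ?thesis by (simp add: s_def)
  qed
  define v where "v j = u (s j)" for j
  have v: "v j \<in> bounded_seqs H" for j by (simp add: v_def u)
  note vc = v[THEN bounded_seqsD]
  have vv: "eventually (\<lambda>n. hnorm (H n) (v k n \<ominus>\<^bsub>H n\<^esub> v j n) < inverse (real (Suc j))) \<omega>" if "j \<le> k" for j k
    using N[OF sN[OF that] sN[OF order_refl]] hnorm_ultra_diff[OF v v, of k j]
    by (intro order_tendstoD(2)) (auto simp: U v_def)
  obtain C where C: "C > 0" "\<And>n. hnorm (H n) (v 0 n) \<le> C" using bounded_seqs_bound[OF v] by blast
  define good where "good n k \<longleftrightarrow> (\<forall>j\<le>k. hnorm (H n) (v k n \<ominus>\<^bsub>H n\<^esub> v j n) \<le> inverse (real (Suc j)))" for n k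
  have good0: "good n 0" for n using vc by (simp add: good_def)
  have ev_good: "eventually (\<lambda>n. good n k) \<omega>" for k
  proof -
    have "eventually (\<lambda>n. \<forall>j\<in>{..k}. hnorm (H n) (v k n \<ominus>\<^bsub>H n\<^esub> v j n) < inverse (real (Suc j))) \<omega>"
      by (rule eventually_ball_finite) (use vv in auto)
    then show ?thesis by eventually_elim (auto simp: good_def intro: less_imp_le)
  qed
  \<comment> \<open>The cut-off k \<le> n makes the set finite and k = 0 always belongs to it, so
    the maximum exists; along \<omega> it is eventually at least any given k.\<close>
  define \<kappa> where "\<kappa> n = Max {k. k \<le> n \<and> good n k}" for n
  have fin: "finite {k. k \<le> n \<and> good n k}" for n by (rule finite_subset[of _ "{..n}"]) auto
  have \<kappa>: "good n (\<kappa> n)" for n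
    using Max_in[OF fin, of n] good0[of n] by (auto simp: \<kappa>_def)
  have \<kappa>_ge: "eventually (\<lambda>n. k \<le> \<kappa> n) \<omega>" for k
    using ev_good[of k] eventually_ge[of k] by eventually_elim (auto simp: \<kappa>_def intro!: Max_ge fin)
  define w where "w n = v (\<kappa> n) n" for n
  have wc: "w n \<in> carrier (H n)" for n by (simp add: w_def vc)
  have close: "j \<le> \<kappa> n \<Longrightarrow> hnorm (H n) (w n \<ominus>\<^bsub>H n\<^esub> v j n) \<le> inverse (real (Suc j))" for j n
    using \<kappa>[of n] by (simp add: good_def w_def)
  have w: "w \<in> bounded_seqs H"
  proof (rule bounded_seqsI[of _ "1 + C"])
    show "hnorm (H n) (w n) \<le> 1 + C" for n
      using F.hnorm_le_diff[OF wc vc, of n 0] close[of 0 n] C(2)[of n] by simp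
  qed (rule wc)
  have vw: "hnorm \<H> (cls w \<oplus>\<^bsub>\<H>\<^esub> (-1) \<odot>\<^bsub>\<H>\<^esub> cls (v j)) \<le> inverse (real (Suc j))" for j
    by (rule tendsto_upperbound[OF hnorm_ultra_diff[OF w v] eventually_mono[OF \<kappa>_ge close] nontrivial])
  have "(\<lambda>n. hnorm \<H> (U n \<oplus>\<^bsub>\<H>\<^esub> (-1) \<odot>\<^bsub>\<H>\<^esub> cls w)) \<longlonglongrightarrow> 0"
  proof (rule LIMSEQ_I)
    fix e :: real assume e: "0 < e"
    then obtain j where j: "inverse (real (Suc j)) < e / 2" using reals_Archimedean[of "e / 2"] by auto
    have "norm (hnorm \<H> (U n \<oplus>\<^bsub>\<H>\<^esub> (-1) \<odot>\<^bsub>\<H>\<^esub> cls w) - 0) < e" if n: "n \<ge> s j" for n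
    proof -
      \<comment> \<open>\<open>\<H>\<close> is not yet known to be a Hilbert space, so the triangle
        inequality and the sign of the norm are carried over from the coordinates.\<close>
      have "hnorm \<H> (U n \<oplus>\<^bsub>\<H>\<^esub> (-1) \<odot>\<^bsub>\<H>\<^esub> cls w) \<le>
          hnorm \<H> (U n \<oplus>\<^bsub>\<H>\<^esub> (-1) \<odot>\<^bsub>\<H>\<^esub> U (s j)) + hnorm \<H> (cls w \<oplus>\<^bsub>\<H>\<^esub> (-1) \<odot>\<^bsub>\<H>\<^esub> cls (v j))"
      proof (rule tendsto_le[OF nontrivial])
        show "((\<lambda>i. hnorm (H i) (u n i \<ominus>\<^bsub>H i\<^esub> w i)) \<longlongrightarrow> hnorm \<H> (U n \<oplus>\<^bsub>\<H>\<^esub> (-1) \<odot>\<^bsub>\<H>\<^esub> cls w)) \<omega>"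
          unfolding U by (rule hnorm_ultra_diff[OF u w])
        show "((\<lambda>i. hnorm (H i) (u n i \<ominus>\<^bsub>H i\<^esub> u (s j) i) + hnorm (H i) (w i \<ominus>\<^bsub>H i\<^esub> v j i)) \<longlongrightarrow>
            hnorm \<H> (U n \<oplus>\<^bsub>\<H>\<^esub> (-1) \<odot>\<^bsub>\<H>\<^esub> U (s j)) + hnorm \<H> (cls w \<oplus>\<^bsub>\<H>\<^esub> (-1) \<odot>\<^bsub>\<H>\<^esub> cls (v j))) \<omega>"
          unfolding U by (intro tendsto_add hnorm_ultra_diff u w v)
        show "eventually (\<lambda>i. hnorm (H i) (u n i \<ominus>\<^bsub>H i\<^esub> w i) \<le>
            hnorm (H i) (u n i \<ominus>\<^bsub>H i\<^esub> u (s j) i) + hnorm (H i) (w i \<ominus>\<^bsub>H i\<^esub> v j i)) \<omega>"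
        proof (intro always_eventually allI)
          fix i
          show "hnorm (H i) (u n i \<ominus>\<^bsub>H i\<^esub> w i) \<le>
            hnorm (H i) (u n i \<ominus>\<^bsub>H i\<^esub> u (s j) i) + hnorm (H i) (w i \<ominus>\<^bsub>H i\<^esub> v j i)"
            using F.hnorm_diff_triangle[OF ucc ucc wc, of i n "s j"] F.hnorm_minus_commute[OF wc vc, of i j]
            by (simp add: v_def)
        qed
      qed
      moreover have "hnorm \<H> (U n \<oplus>\<^bsub>\<H>\<^esub> (-1) \<odot>\<^bsub>\<H>\<^esub> U (s j)) < inverse (real (Suc j))"
        by (rule N) (use n sN[OF order_refl, of j] in linarith)+
      moreover have "0 \<le> hnorm \<H> (U n \<oplus>\<^bsub>\<H>\<^esub> (-1) \<odot>\<^bsub>\<H>\<^esub> cls w)"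
      proof (rule tendsto_lowerbound[OF _ _ nontrivial])
        show "((\<lambda>i. hnorm (H i) (u n i \<ominus>\<^bsub>H i\<^esub> w i)) \<longlongrightarrow> hnorm \<H> (U n \<oplus>\<^bsub>\<H>\<^esub> (-1) \<odot>\<^bsub>\<H>\<^esub> cls w)) \<omega>"
          unfolding U by (rule hnorm_ultra_diff[OF u w])
        show "eventually (\<lambda>i. 0 \<le> hnorm (H i) (u n i \<ominus>\<^bsub>H i\<^esub> w i)) \<omega>"
          using ucc wc by (intro always_eventually allI) simp
      qed
      ultimately show ?thesis using vw[of j] j by simp
    qed
    then show "\<exists>no. \<forall>n\<ge>no. norm (hnorm \<H> (U n \<oplus>\<^bsub>\<H>\<^esub> (-1) \<odot>\<^bsub>\<H>\<^esub> cls w) - 0) < e" by blast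
  qed
  then show ?thesis using cls_closed[OF w] by blast
qed

lemma hilbert_space_ultra: "hilbert_space \<H>"
proof (rule hilbert_spaceI)
  fix X Y Z c
  assume "X \<in> carrier \<H>" "Y \<in> carrier \<H>" "Z \<in> carrier \<H>"
  then obtain u v w where u: "u \<in> bounded_seqs H" "X = cls u" and v: "v \<in> bounded_seqs H" "Y = cls v"
    and w: "w \<in> bounded_seqs H" "Z = cls w" by (elim carrier_ultraE)
  note c = u(1)[THEN bounded_seqsD] v(1)[THEN bounded_seqsD] w(1)[THEN bounded_seqsD]
  show "(X \<oplus>\<^bsub>\<H>\<^esub> Y) \<oplus>\<^bsub>\<H>\<^esub> Z = X \<oplus>\<^bsub>\<H>\<^esub> (Y \<oplus>\<^bsub>\<H>\<^esub> Z)"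
    using u v w c by (simp add: add_ultra F.M.a_assoc)
  show "ip \<H> (X \<oplus>\<^bsub>\<H>\<^esub> Y) Z = ip \<H> X Z + ip \<H> Y Z"
    using tendsto_add[OF ip_ultra_tendsto[OF u(1) w(1)] ip_ultra_tendsto[OF v(1) w(1)]] c
    unfolding u v w by (subst add_ultra[OF u(1) v(1)], intro ip_ultra_eqI add_bounded_seq u v w)
      (simp add: F.ip_add_left)
next
  fix X Y c
  assume "X \<in> carrier \<H>" "Y \<in> carrier \<H>"
  then obtain u v where u: "u \<in> bounded_seqs H" "X = cls u" and v: "v \<in> bounded_seqs H" "Y = cls v"
    by (elim carrier_ultraE)
  note c = u(1)[THEN bounded_seqsD] v(1)[THEN bounded_seqsD]
  show "X \<oplus>\<^bsub>\<H>\<^esub> Y \<in> carrier \<H>" using u v by (simp add: add_ultra)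
  show "X \<oplus>\<^bsub>\<H>\<^esub> Y = Y \<oplus>\<^bsub>\<H>\<^esub> X" using u v c by (simp add: add_ultra F.M.a_comm)
  show "c \<odot>\<^bsub>\<H>\<^esub> (X \<oplus>\<^bsub>\<H>\<^esub> Y) = c \<odot>\<^bsub>\<H>\<^esub> X \<oplus>\<^bsub>\<H>\<^esub> c \<odot>\<^bsub>\<H>\<^esub> Y"
    using u v c by (simp add: add_ultra smult_ultra F.smult_r_distr)
  show "ip \<H> (c \<odot>\<^bsub>\<H>\<^esub> X) Y = c * ip \<H> X Y"
    using tendsto_mult_left[OF ip_ultra_tendsto[OF u(1) v(1)], of c] c
    unfolding u v by (subst smult_ultra[OF u(1)], intro ip_ultra_eqI scale_bounded_seq u v)
      (simp add: F.ip_scale_left)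
  show "ip \<H> X Y = cnj (ip \<H> Y X)"
    using tendsto_cnj[OF ip_ultra_tendsto[OF v(1) u(1)]] c
    unfolding u v by (intro ip_ultra_eqI u v) (simp add: F.ip_cnj)
next
  fix X a b
  assume "X \<in> carrier \<H>"
  then obtain u where u: "u \<in> bounded_seqs H" "X = cls u" by (elim carrier_ultraE)
  note c = u(1)[THEN bounded_seqsD]
  show "a \<odot>\<^bsub>\<H>\<^esub> X \<in> carrier \<H>" using u by (simp add: smult_ultra)
  show "\<zero>\<^bsub>\<H>\<^esub> \<oplus>\<^bsub>\<H>\<^esub> X = X" using u c by (simp add: zero_ultra add_ultra)
  show "(-1) \<odot>\<^bsub>\<H>\<^esub> X \<oplus>\<^bsub>\<H>\<^esub> X = \<zero>\<^bsub>\<H>\<^esub>"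
  proof -
    have "(-1) \<odot>\<^bsub>H n\<^esub> u n \<oplus>\<^bsub>H n\<^esub> u n = \<zero>\<^bsub>H n\<^esub>" for n using c by (simp add: F.scale_minus F.M.l_neg)
    then show ?thesis using u by (simp add: zero_ultra smult_ultra add_ultra)
  qed
  show "(a + b) \<odot>\<^bsub>\<H>\<^esub> X = a \<odot>\<^bsub>\<H>\<^esub> X \<oplus>\<^bsub>\<H>\<^esub> b \<odot>\<^bsub>\<H>\<^esub> X"
    using u c F.smult_l_distr by (simp add: smult_ultra add_ultra)
  show "(a * b) \<odot>\<^bsub>\<H>\<^esub> X = a \<odot>\<^bsub>\<H>\<^esub> (b \<odot>\<^bsub>\<H>\<^esub> X)" using u c by (simp add: smult_ultra F.scale_scale)
  show "1 \<odot>\<^bsub>\<H>\<^esub> X = X" using u c by (simp add: smult_ultra)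
  have lim: "((\<lambda>n. complex_of_real ((hnorm (H n) (u n))\<^sup>2)) \<longlongrightarrow> ip \<H> X X) \<omega>"
    using ip_ultra_tendsto[OF u(1) u(1)] c unfolding u by (simp add: F.ip_self)
  have "closed (\<real>\<^sub>\<ge>\<^sub>0 :: complex set)" by (rule closed_nonneg_Reals_complex)
  then show "ip \<H> X X \<in> \<real>\<^sub>\<ge>\<^sub>0"
    by (rule Lim_in_closed_set[OF _ _ nontrivial lim]) (simp add: complex_nonneg_Reals_iff)
  assume "ip \<H> X X = 0"
  then have "((\<lambda>n. sqrt (Re (complex_of_real ((hnorm (H n) (u n))\<^sup>2)))) \<longlongrightarrow> sqrt (Re 0)) \<omega>"
    using lim by (intro tendsto_real_sqrt tendsto_Re) simp
  then have "((\<lambda>n. hnorm (H n) (u n \<ominus>\<^bsub>H n\<^esub> \<zero>\<^bsub>H n\<^esub>)) \<longlongrightarrow> 0) \<omega>" using c by simp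
  then show "X = \<zero>\<^bsub>\<H>\<^esub>" unfolding u zero_ultra by (intro cls_eqI u zero_bounded_seq)
qed (simp_all add: zero_ultra ultra_complete)

end

section \<open>Operators on the ultraproduct\<close>

context hilbert_sequence
begin

sublocale W: hilbert_space \<H> by (rule hilbert_space_ultra)

definition bounded_op_seqs :: "(nat \<Rightarrow> 'h \<Rightarrow> 'h) set" where
  "bounded_op_seqs = {a. (\<forall>n. a n \<in> bounded_ops (H n)) \<and>
     (\<exists>C. \<forall>n. \<forall>x\<in>carrier (H n). hnorm (H n) (a n x) \<le> C * hnorm (H n) x)}"

lemma bounded_op_seqs_mem: "a \<in> bounded_op_seqs \<Longrightarrow> a n \<in> bounded_ops (H n)"
  by (simp add: bounded_op_seqs_def)

lemma bounded_op_seqs_bound: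
  assumes "a \<in> bounded_op_seqs"
  obtains C where "C > 0" "\<And>n x. x \<in> carrier (H n) \<Longrightarrow> hnorm (H n) (a n x) \<le> C * hnorm (H n) x"
proof -
  obtain C where C: "\<forall>n. \<forall>x\<in>carrier (H n). hnorm (H n) (a n x) \<le> C * hnorm (H n) x"
    using assms unfolding bounded_op_seqs_def mem_Collect_eq by (elim conjE exE)
  show ?thesis
  proof (rule that[of "max C 1"])
    fix n x assume x: "x \<in> carrier (H n)"
    have "C * hnorm (H n) x \<le> max C 1 * hnorm (H n) x" using x by (intro mult_right_mono) auto
    then show "hnorm (H n) (a n x) \<le> max C 1 * hnorm (H n) x" using C x order_trans by blast
  qed simp
qed

lemma apply_bounded_seq:
  assumes a: "a \<in> bounded_op_seqs" and u: "u \<in> bounded_seqs H"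
  shows "(\<lambda>n. a n (u n)) \<in> bounded_seqs H"
proof -
  obtain C where C: "C > 0" "\<And>n x. x \<in> carrier (H n) \<Longrightarrow> hnorm (H n) (a n x) \<le> C * hnorm (H n) x"
    using bounded_op_seqs_bound[OF a] by blast
  obtain D where D: "D > 0" "\<And>n. hnorm (H n) (u n) \<le> D" using bounded_seqs_bound[OF u] by blast
  show ?thesis
  proof (rule bounded_seqsI[of _ "C * D"])
    show "a n (u n) \<in> carrier (H n)" for n
      using bounded_op_seqs_mem[OF a] bounded_seqsD[OF u] by simp
    show "hnorm (H n) (a n (u n)) \<le> C * D" for n
      using C(2)[OF bounded_seqsD[OF u], of n] mult_left_mono[OF D(2)[of n], of C] C(1) by linarith
  qed
qed

text \<open>The common bound C sends null sequences to null sequences, so the class of the image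
  does not depend on the representative.\<close>

lemma op_class_apply:
  assumes a: "a \<in> bounded_op_seqs" and u: "u \<in> bounded_seqs H"
  shows "op_class \<omega> H a (cls u) = cls (\<lambda>n. a n (u n))"
proof -
  obtain C where C: "C > 0" "\<And>n x. x \<in> carrier (H n) \<Longrightarrow> hnorm (H n) (a n x) \<le> C * hnorm (H n) x"
    using bounded_op_seqs_bound[OF a] by blast
  have "cls (\<lambda>n. a n (v n)) = cls (\<lambda>n. a n (u n))" if "v \<in> cls u" for v
  proof (rule cls_eqI)
    have v: "v \<in> bounded_seqs H" using that by (simp add: cls_mem)
    show "(\<lambda>n. a n (v n)) \<in> bounded_seqs H" "(\<lambda>n. a n (u n)) \<in> bounded_seqs H"
      using a u v by (auto intro: apply_bounded_seq)
    note c = v[THEN bounded_seqsD] u[THEN bounded_seqsD]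
    show "((\<lambda>n. hnorm (H n) (a n (v n) \<ominus>\<^bsub>H n\<^esub> a n (u n))) \<longlongrightarrow> 0) \<omega>"
    proof (rule tendsto_zero_mono)
      show "((\<lambda>n. C * hnorm (H n) (v n \<ominus>\<^bsub>H n\<^esub> u n)) \<longlongrightarrow> 0) \<omega>"
        using that by (intro tendsto_mult_right_zero) (simp add: cls_mem)
      fix n
      have ab: "a n \<in> bounded_ops (H n)" by (rule bounded_op_seqs_mem[OF a])
      show "0 \<le> hnorm (H n) (a n (v n) \<ominus>\<^bsub>H n\<^esub> a n (u n))" using ab c by simp
      show "hnorm (H n) (a n (v n) \<ominus>\<^bsub>H n\<^esub> a n (u n)) \<le> C * hnorm (H n) (v n \<ominus>\<^bsub>H n\<^esub> u n)"
        using C(2)[OF F.M.minus_closed[OF c], of n] F.op_diff[OF ab c] by simp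
    qed
  qed
  then have "(\<Union>v\<in>cls u. cls (\<lambda>n. a n (v n))) = cls (\<lambda>n. a n (u n))" by (intro UN_cls u)
  then show ?thesis using u by (simp add: op_class_def)
qed

lemma hnorm_op_class_le:
  assumes a: "a \<in> bounded_op_seqs" and V: "V \<in> carrier \<H>"
    and C: "\<And>n x. x \<in> carrier (H n) \<Longrightarrow> hnorm (H n) (a n x) \<le> C * hnorm (H n) x"
  shows "hnorm \<H> (op_class \<omega> H a V) \<le> C * hnorm \<H> V"
proof -
  obtain u where u: "u \<in> bounded_seqs H" "V = cls u" using V by (rule carrier_ultraE)
  show ?thesis
    unfolding u(2) op_class_apply[OF a u(1)]
  proof (rule tendsto_le[OF nontrivial])
    show "((\<lambda>n. hnorm (H n) (a n (u n))) \<longlongrightarrow> hnorm \<H> (cls (\<lambda>n. a n (u n)))) \<omega>"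
      by (rule hnorm_ultra_tendsto[OF apply_bounded_seq[OF a u(1)]])
    show "((\<lambda>n. C * hnorm (H n) (u n)) \<longlongrightarrow> C * hnorm \<H> (cls u)) \<omega>"
      by (intro tendsto_intros hnorm_ultra_tendsto u(1))
    show "eventually (\<lambda>n. hnorm (H n) (a n (u n)) \<le> C * hnorm (H n) (u n)) \<omega>"
      using C[OF bounded_seqsD[OF u(1)]] by (intro always_eventually allI)
  qed
qed

lemma op_class_bounded:
  assumes a: "a \<in> bounded_op_seqs"
  shows "op_class \<omega> H a \<in> bounded_ops \<H>"
proof -
  obtain C where C: "C > 0" "\<And>n x. x \<in> carrier (H n) \<Longrightarrow> hnorm (H n) (a n x) \<le> C * hnorm (H n) x"
    using bounded_op_seqs_bound[OF a] by blast
  note ab = bounded_op_seqs_mem[OF a]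
  show ?thesis
  proof (rule W.bounded_opsI[of _ C])
    fix V assume V: "V \<in> carrier \<H>"
    then obtain u where u: "u \<in> bounded_seqs H" "V = cls u" by (rule carrier_ultraE)
    show "op_class \<omega> H a V \<in> carrier \<H>"
      using a u apply_bounded_seq by (simp add: op_class_apply)
    show "hnorm \<H> (op_class \<omega> H a V) \<le> C * hnorm \<H> V" by (rule hnorm_op_class_le[OF a V C(2)])
    fix k
    have "(\<lambda>n. a n (k \<odot>\<^bsub>H n\<^esub> u n)) = (\<lambda>n. k \<odot>\<^bsub>H n\<^esub> a n (u n))"
      using F.op_scale[OF ab bounded_seqsD[OF u(1)]] by simp
    then show "op_class \<omega> H a (k \<odot>\<^bsub>\<H>\<^esub> V) = k \<odot>\<^bsub>\<H>\<^esub> op_class \<omega> H a V"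
      using a u apply_bounded_seq[OF a u(1)] by (simp add: op_class_apply smult_ultra)
  next
    fix V W assume "V \<in> carrier \<H>" "W \<in> carrier \<H>"
    then obtain u v where u: "u \<in> bounded_seqs H" "V = cls u" and v: "v \<in> bounded_seqs H" "W = cls v"
      by (elim carrier_ultraE)
    have "(\<lambda>n. a n (u n \<oplus>\<^bsub>H n\<^esub> v n)) = (\<lambda>n. a n (u n) \<oplus>\<^bsub>H n\<^esub> a n (v n))"
      using F.op_add[OF ab bounded_seqsD[OF u(1)] bounded_seqsD[OF v(1)]] by simp
    then show "op_class \<omega> H a (V \<oplus>\<^bsub>\<H>\<^esub> W) = op_class \<omega> H a V \<oplus>\<^bsub>\<H>\<^esub> op_class \<omega> H a W"
      using a u v apply_bounded_seq[OF a u(1)] apply_bounded_seq[OF a v(1)]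
      by (simp add: op_class_apply add_ultra)
  qed (simp add: op_class_def)
qed

lemma op_class_eqI:
  assumes a: "a \<in> bounded_op_seqs" and T: "T \<in> bounded_ops \<H>"
    and eq: "\<And>u. u \<in> bounded_seqs H \<Longrightarrow> T (cls u) = cls (\<lambda>n. a n (u n))"
  shows "op_class \<omega> H a = T"
proof (rule W.op_eqI[OF op_class_bounded[OF a] T])
  fix V assume "V \<in> carrier \<H>"
  then obtain u where u: "u \<in> bounded_seqs H" "V = cls u" by (rule carrier_ultraE)
  then show "op_class \<omega> H a V = T V" using op_class_apply[OF a] eq by simp
qed

lemma op_class_adjoint:
  assumes a: "a \<in> bounded_op_seqs" and b: "b \<in> bounded_op_seqs" "\<And>n. b n = adjoint (H n) (a n)"
  shows "op_class \<omega> H b = adjoint \<H> (op_class \<omega> H a)"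
proof (rule W.adjoint_eqI[symmetric, OF op_class_bounded[OF a] op_class_bounded[OF b(1)]])
  fix V W assume "V \<in> carrier \<H>" "W \<in> carrier \<H>"
  then obtain u v where u: "u \<in> bounded_seqs H" "V = cls u" and v: "v \<in> bounded_seqs H" "W = cls v"
    by (elim carrier_ultraE)
  have eq: "ip (H n) (u n) (b n (v n)) = ip (H n) (a n (u n)) (v n)" for n
    unfolding b(2)
    by (rule F.ip_adjoint_right[OF bounded_op_seqs_mem[OF a] bounded_seqsD[OF u(1)] bounded_seqsD[OF v(1)]])
  have "ip \<H> (cls (\<lambda>n. a n (u n))) (cls v) = ip \<H> (cls u) (cls (\<lambda>n. b n (v n)))"
    by (rule ip_ultra_eqI[OF apply_bounded_seq[OF a u(1)] v(1)])
      (use ip_ultra_tendsto[OF u(1) apply_bounded_seq[OF b(1) v(1)]] eq in simp)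
  then show "ip \<H> (op_class \<omega> H a V) W = ip \<H> V (op_class \<omega> H b W)"
    unfolding u(2) v(2) op_class_apply[OF a u(1)] op_class_apply[OF b(1) v(1)] .
qed

end

subsection \<open>Sequences of represented von Neumann algebras\<close>

locale gns_sequence = hilbert_sequence \<omega> H
  for \<omega> :: "nat filter" and H :: "nat \<Rightarrow> 'h hilbert" +
  fixes K :: "nat \<Rightarrow> 'k hilbert" and M :: "nat \<Rightarrow> ('k \<Rightarrow> 'k) set"
    and \<phi> :: "nat \<Rightarrow> ('k \<Rightarrow> 'k) \<Rightarrow> complex"
    and \<pi> :: "nat \<Rightarrow> ('k \<Rightarrow> 'k) \<Rightarrow> ('h \<Rightarrow> 'h)" and \<xi> :: "nat \<Rightarrow> 'h"
  assumes vna: "\<And>n. von_neumann_algebra (K n) (M n)"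
    and state: "\<And>n. state (K n) (M n) (\<phi> n)"
    and gns: "\<And>n. GNS_triple (K n) (M n) (\<phi> n) (H n) (\<pi> n) (\<xi> n)"
begin

sublocale A: von_neumann_algebra "K n" "M n" for n by (rule vna)

lemma rep_mem [simp]: "T \<in> M n \<Longrightarrow> \<pi> n T \<in> bounded_ops (H n)"
  using GNS_triple.rep[OF gns, of n] by (auto simp: star_hom_def ring_hom_def)

lemma rep_mult: "\<lbrakk>S \<in> M n; T \<in> M n\<rbrakk> \<Longrightarrow>
    \<pi> n (S \<otimes>\<^bsub>op_algebra (K n)\<^esub> T) = \<pi> n S \<otimes>\<^bsub>op_algebra (H n)\<^esub> \<pi> n T"
  using GNS_triple.rep[OF gns, of n] by (auto simp: star_hom_def ring_hom_def)

lemma rep_add: "\<lbrakk>S \<in> M n; T \<in> M n\<rbrakk> \<Longrightarrow>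
    \<pi> n (S \<oplus>\<^bsub>op_algebra (K n)\<^esub> T) = \<pi> n S \<oplus>\<^bsub>op_algebra (H n)\<^esub> \<pi> n T"
  using GNS_triple.rep[OF gns, of n] by (auto simp: star_hom_def ring_hom_def)

lemma rep_smult: "T \<in> M n \<Longrightarrow>
    \<pi> n (c \<odot>\<^bsub>op_algebra (K n)\<^esub> T) = c \<odot>\<^bsub>op_algebra (H n)\<^esub> \<pi> n T"
  using GNS_triple.rep[OF gns, of n] by (auto simp: star_hom_def)

lemma rep_one: "\<pi> n \<one>\<^bsub>op_algebra (K n)\<^esub> = \<one>\<^bsub>op_algebra (H n)\<^esub>"
  using GNS_triple.rep[OF gns, of n] by (auto simp: star_hom_def ring_hom_def)

lemma rep_adjoint: "T \<in> M n \<Longrightarrow> \<pi> n (adjoint (K n) T) = adjoint (H n) (\<pi> n T)"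
  using GNS_triple.rep[OF gns, of n] by (auto simp: star_hom_def)

lemma vector_mem [simp]: "\<xi> n \<in> carrier (H n)"
  by (rule GNS_triple.vector[OF gns])

text \<open>The bridge from states to norms: it turns positivity of the state into contractivity of
  the representation, and the sharp norm into norms of vectors.\<close>

lemma state_square:
  assumes T: "T \<in> M n"
  shows "\<phi> n (adjoint (K n) T \<otimes>\<^bsub>op_algebra (K n)\<^esub> T) = of_real ((hnorm (H n) (\<pi> n T (\<xi> n)))\<^sup>2)"
proof -
  have "adjoint (K n) T \<otimes>\<^bsub>op_algebra (K n)\<^esub> T \<in> M n" using T by (intro A.mult_mem A.adjoint_mem)
  then have "\<phi> n (adjoint (K n) T \<otimes>\<^bsub>op_algebra (K n)\<^esub> T) =
      ip (H n) (adjoint (H n) (\<pi> n T) (\<pi> n T (\<xi> n))) (\<xi> n)"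
    using GNS_triple.implements[OF gns] T by (simp add: rep_mult rep_adjoint)
  also have "\<dots> = ip (H n) (\<pi> n T (\<xi> n)) (\<pi> n T (\<xi> n))"
    by (rule F.ip_adjoint_left) (use T in auto)
  finally show ?thesis using T by (simp add: F.ip_self)
qed

lemma hnorm_vector: "hnorm (H n) (\<xi> n) = 1"
proof -
  have "\<phi> n \<one>\<^bsub>op_algebra (K n)\<^esub> = ip (H n) (\<xi> n) (\<xi> n)"
    using GNS_triple.implements[OF gns A.one_mem] by (simp add: rep_one)
  then have "ip (H n) (\<xi> n) (\<xi> n) = 1" using state[of n] by (simp add: state_def)
  then show ?thesis by (simp add: hnorm_def)
qed

text \<open>The representation is contractive because \<open>\<phi> (S\<^sup>* (C\<^sup>2 - T\<^sup>* T) S) \<ge> 0\<close>.\<close>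

lemma hnorm_rep_le:
  assumes T: "T \<in> M n" and C: "C \<ge> 0" "\<And>x. x \<in> carrier (K n) \<Longrightarrow> hnorm (K n) (T x) \<le> C * hnorm (K n) x"
    and y: "y \<in> carrier (H n)"
  shows "hnorm (H n) (\<pi> n T y) \<le> C * hnorm (H n) y"
proof -
  have Tb: "T \<in> bounded_ops (K n)" using T by simp
  have cyc: "hnorm (H n) (\<pi> n T (\<pi> n S (\<xi> n))) \<le> C * hnorm (H n) (\<pi> n S (\<xi> n))" if S: "S \<in> M n" for S
  proof -
    let ?B = "op_algebra (K n)"
    have Sb: "S \<in> bounded_ops (K n)" using S by simp
    define TS where "TS = T \<otimes>\<^bsub>?B\<^esub> S"
    have TS: "TS \<in> M n" using S T by (simp add: TS_def A.mult_mem)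
    have TSb: "TS \<in> bounded_ops (K n)" using TS by simp
    define P where "P = adjoint (K n) S \<otimes>\<^bsub>?B\<^esub> S"
    define Q where "Q = adjoint (K n) TS \<otimes>\<^bsub>?B\<^esub> TS"
    have PQ: "P \<in> M n" "Q \<in> M n" using S TS by (auto simp: P_def Q_def intro: A.mult_mem)
    \<comment> \<open>R is C^2 - adjoint(T) T, multiplied by S on the right and by its adjoint on
      the left; it is positive because C bounds T.\<close>
    define R where "R = complex_of_real (C\<^sup>2) \<odot>\<^bsub>?B\<^esub> P \<oplus>\<^bsub>?B\<^esub> (-1) \<odot>\<^bsub>?B\<^esub> Q"
    have R: "R \<in> M n" using PQ by (simp add: R_def A.add_mem A.smult_mem)
    have "ip (K n) (R x) x \<in> \<real>\<^sub>\<ge>\<^sub>0" if x: "x \<in> carrier (K n)" for x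
    proof -
      have "ip (K n) (R x) x = complex_of_real (C\<^sup>2) * ip (K n) (P x) x - ip (K n) (Q x) x"
        using x PQ A.op_closed[OF A.mem_bounded[OF PQ(1)] x] A.op_closed[OF A.mem_bounded[OF PQ(2)] x]
        by (simp add: R_def A.ip_add_left A.ip_scale_left)
      also have "ip (K n) (P x) x = of_real ((hnorm (K n) (S x))\<^sup>2)"
        using x Sb A.ip_adjoint_left[OF Sb A.op_closed[OF Sb x] x] by (simp add: P_def A.ip_self)
      also have "ip (K n) (Q x) x = of_real ((hnorm (K n) (TS x))\<^sup>2)"
        using x TSb A.ip_adjoint_left[OF TSb A.op_closed[OF TSb x] x] by (simp add: Q_def A.ip_self)
      finally have eq: "ip (K n) (R x) x = of_real (C\<^sup>2 * (hnorm (K n) (S x))\<^sup>2 - (hnorm (K n) (TS x))\<^sup>2)" by simp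
      have "hnorm (K n) (TS x) \<le> C * hnorm (K n) (S x)" using C(2)[OF A.op_closed[OF Sb x]] x by (simp add: TS_def)
      then have "(hnorm (K n) (TS x))\<^sup>2 \<le> (C * hnorm (K n) (S x))\<^sup>2"
        using x TSb by (intro power_mono) auto
      then show ?thesis unfolding eq by (simp add: complex_nonneg_Reals_iff power_mult_distrib)
    qed
    then have "positive_op (K n) R" using A.mem_bounded[OF R] by (simp add: positive_op_def)
    then have "\<phi> n R \<in> \<real>\<^sub>\<ge>\<^sub>0" using state[of n] R by (simp add: state_def)
    moreover have "\<phi> n R = complex_of_real (C\<^sup>2) * \<phi> n P - \<phi> n Q"
    proof -
      have "\<phi> n R = \<phi> n (complex_of_real (C\<^sup>2) \<odot>\<^bsub>?B\<^esub> P) + \<phi> n ((-1) \<odot>\<^bsub>?B\<^esub> Q)"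
        unfolding R_def using state[of n] PQ A.smult_mem unfolding state_def by blast
      moreover have "\<phi> n (k \<odot>\<^bsub>?B\<^esub> S) = k * \<phi> n S" if "S \<in> M n" for k S
        using state[of n] that unfolding state_def by blast
      ultimately show ?thesis using PQ by simp
    qed
    moreover have "\<phi> n P = of_real ((hnorm (H n) (\<pi> n S (\<xi> n)))\<^sup>2)" unfolding P_def by (rule state_square[OF S])
    moreover have "\<phi> n Q = of_real ((hnorm (H n) (\<pi> n TS (\<xi> n)))\<^sup>2)" unfolding Q_def by (rule state_square[OF TS])
    moreover have "\<pi> n TS (\<xi> n) = \<pi> n T (\<pi> n S (\<xi> n))" using S T by (simp add: TS_def rep_mult)
    ultimately have "(hnorm (H n) (\<pi> n T (\<pi> n S (\<xi> n))))\<^sup>2 \<le> (C * hnorm (H n) (\<pi> n S (\<xi> n)))\<^sup>2"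
      by (simp add: complex_nonneg_Reals_iff power_mult_distrib)
    then show ?thesis by (rule power2_le_imp_le) (use C(1) S in simp)
  qed
  have b: "\<pi> n T \<in> bounded_ops (H n)" using T by simp
  \<comment> \<open>The estimate is known only on the orbit of the cyclic vector. The a priori bound
    D of \<open>\<pi> n T\<close>, possibly larger than C, controls the error of approximating y by
    such vectors.\<close>
  obtain D where D: "D > 0" "\<And>x. x \<in> carrier (H n) \<Longrightarrow> hnorm (H n) (\<pi> n T x) \<le> D * hnorm (H n) x"
    using F.op_bound[OF b] by blast
  show ?thesis
  proof (rule field_le_epsilon)
    fix e :: real assume e: "e > 0"
    then have "e / (C + D) > 0" using C(1) D(1) by simp
    then obtain S where S: "S \<in> M n" "hnorm (H n) (y \<ominus>\<^bsub>H n\<^esub> \<pi> n S (\<xi> n)) < e / (C + D)"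
      using GNS_triple.cyclic[OF gns y] by blast
    define v where "v = \<pi> n S (\<xi> n)"
    have v: "v \<in> carrier (H n)" using S by (simp add: v_def)
    have "hnorm (H n) (\<pi> n T y) \<le> hnorm (H n) (\<pi> n T y \<ominus>\<^bsub>H n\<^esub> \<pi> n T v) + hnorm (H n) (\<pi> n T v)"
      by (rule F.hnorm_le_diff) (use b v y in auto)
    also have "\<pi> n T y \<ominus>\<^bsub>H n\<^esub> \<pi> n T v = \<pi> n T (y \<ominus>\<^bsub>H n\<^esub> v)" by (rule F.op_diff[OF b y v, symmetric])
    also have "hnorm (H n) \<dots> \<le> D * hnorm (H n) (y \<ominus>\<^bsub>H n\<^esub> v)" by (rule D(2)[OF F.M.minus_closed[OF y v]])
    also have "hnorm (H n) (\<pi> n T v) \<le> C * hnorm (H n) v" unfolding v_def by (rule cyc[OF S(1)])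
    also have "C * hnorm (H n) v \<le> C * (hnorm (H n) (v \<ominus>\<^bsub>H n\<^esub> y) + hnorm (H n) y)"
      using C(1) F.hnorm_le_diff[OF v y] by (intro mult_left_mono)
    also have "hnorm (H n) (v \<ominus>\<^bsub>H n\<^esub> y) = hnorm (H n) (y \<ominus>\<^bsub>H n\<^esub> v)" by (rule F.hnorm_minus_commute[OF v y])
    finally have "hnorm (H n) (\<pi> n T y) \<le> C * hnorm (H n) y + (C + D) * hnorm (H n) (y \<ominus>\<^bsub>H n\<^esub> v)"
      by (simp add: algebra_simps)
    also have "(C + D) * hnorm (H n) (y \<ominus>\<^bsub>H n\<^esub> v) \<le> (C + D) * (e / (C + D))"
      using S(2) C(1) D(1) unfolding v_def by (intro mult_left_mono) auto
    also have "(C + D) * (e / (C + D)) = e" using C(1) D(1) by simp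
    finally show "hnorm (H n) (\<pi> n T y) \<le> C * hnorm (H n) y + e" by simp
  qed
qed

section \<open>Bounded sequences and the operators they induce\<close>

abbreviation L :: "(nat \<Rightarrow> 'k \<Rightarrow> 'k) star_algebra" where "L \<equiv> linf_algebra K M"

abbreviation op :: "(nat \<Rightarrow> 'k \<Rightarrow> 'k) \<Rightarrow> (nat \<Rightarrow> 'h) set \<Rightarrow> (nat \<Rightarrow> 'h) set" where
  "op x \<equiv> op_class \<omega> H (\<lambda>n. \<pi> n (x n))"

lemma linf_algebra_simps [simp]:
  "carrier L = linf K M"
  "(x \<otimes>\<^bsub>L\<^esub> y) n = x n \<otimes>\<^bsub>op_algebra (K n)\<^esub> y n"
  "(x \<oplus>\<^bsub>L\<^esub> y) n = x n \<oplus>\<^bsub>op_algebra (K n)\<^esub> y n"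
  "(c \<odot>\<^bsub>L\<^esub> x) n = c \<odot>\<^bsub>op_algebra (K n)\<^esub> x n"
  "\<one>\<^bsub>L\<^esub> n = \<one>\<^bsub>op_algebra (K n)\<^esub>"
  "adj L x n = adjoint (K n) (x n)"
  by (simp_all add: linf_algebra_def)

lemma linf_mem: "x \<in> linf K M \<Longrightarrow> x n \<in> M n"
  by (simp add: linf_def)

lemma linf_bound:
  assumes x: "x \<in> linf K M"
  obtains C where "C > 0" "\<And>n v. v \<in> carrier (K n) \<Longrightarrow> hnorm (K n) (x n v) \<le> C * hnorm (K n) v"
proof -
  obtain C where C: "\<And>n. opnorm (K n) (x n) \<le> C" using x by (auto simp: linf_def)
  show ?thesis
  proof (rule that[of "max C 1"])
    fix n v assume v: "v \<in> carrier (K n)"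
    have "hnorm (K n) (x n v) \<le> opnorm (K n) (x n) * hnorm (K n) v"
      by (rule A.hnorm_op_le[OF A.mem_bounded[OF linf_mem[OF x]] v])
    also have "\<dots> \<le> max C 1 * hnorm (K n) v"
      using C[of n] A.hnorm_nonneg[OF v] by (intro mult_right_mono) auto
    finally show "hnorm (K n) (x n v) \<le> max C 1 * hnorm (K n) v" .
  qed simp
qed

lemma linfI:
  assumes "\<And>n. x n \<in> M n" "C \<ge> 0"
    "\<And>n v. v \<in> carrier (K n) \<Longrightarrow> hnorm (K n) (x n v) \<le> C * hnorm (K n) v"
  shows "x \<in> linf K M"
  unfolding linf_def using assms(1) A.opnorm_le[OF assms(2,3)] by blast

lemma linf_one: "\<one>\<^bsub>L\<^esub> \<in> linf K M"
  by (rule linfI[of _ 1]) (auto intro: A.one_mem)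

lemma linf_smult:
  assumes x: "x \<in> linf K M"
  shows "c \<odot>\<^bsub>L\<^esub> x \<in> linf K M"
proof -
  obtain C where C: "C > 0" "\<And>n v. v \<in> carrier (K n) \<Longrightarrow> hnorm (K n) (x n v) \<le> C * hnorm (K n) v"
    using linf_bound[OF x] by blast
  show ?thesis
  proof (rule linfI[of _ "cmod c * C"])
    fix n v assume v: "v \<in> carrier (K n)"
    show "hnorm (K n) ((c \<odot>\<^bsub>L\<^esub> x) n v) \<le> cmod c * C * hnorm (K n) v"
      using mult_left_mono[OF C(2)[OF v], of "cmod c"] v
        A.hnorm_scale[OF A.op_closed[OF A.mem_bounded[OF linf_mem[OF x]] v]] by (simp add: mult.assoc)
  qed (use C(1) x in \<open>auto intro: A.smult_mem linf_mem\<close>)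
qed

lemma linf_add:
  assumes x: "x \<in> linf K M" and y: "y \<in> linf K M"
  shows "x \<oplus>\<^bsub>L\<^esub> y \<in> linf K M"
proof -
  obtain C where C: "C > 0" "\<And>n v. v \<in> carrier (K n) \<Longrightarrow> hnorm (K n) (x n v) \<le> C * hnorm (K n) v"
    using linf_bound[OF x] by blast
  obtain D where D: "D > 0" "\<And>n v. v \<in> carrier (K n) \<Longrightarrow> hnorm (K n) (y n v) \<le> D * hnorm (K n) v"
    using linf_bound[OF y] by blast
  show ?thesis
  proof (rule linfI[of _ "C + D"])
    fix n v assume v: "v \<in> carrier (K n)"
    have "hnorm (K n) (x n v \<oplus>\<^bsub>K n\<^esub> y n v) \<le> hnorm (K n) (x n v) + hnorm (K n) (y n v)"
      by (rule A.hnorm_triangle) (rule A.op_closed[OF A.mem_bounded[OF linf_mem] v], rule x y)+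
    then show "hnorm (K n) ((x \<oplus>\<^bsub>L\<^esub> y) n v) \<le> (C + D) * hnorm (K n) v"
      using C(2)[OF v] D(2)[OF v] v by (simp add: algebra_simps)
  qed (use C(1) D(1) x y in \<open>auto intro: A.add_mem linf_mem\<close>)
qed

lemma linf_mult:
  assumes x: "x \<in> linf K M" and y: "y \<in> linf K M"
  shows "x \<otimes>\<^bsub>L\<^esub> y \<in> linf K M"
proof -
  obtain C where C: "C > 0" "\<And>n v. v \<in> carrier (K n) \<Longrightarrow> hnorm (K n) (x n v) \<le> C * hnorm (K n) v"
    using linf_bound[OF x] by blast
  obtain D where D: "D > 0" "\<And>n v. v \<in> carrier (K n) \<Longrightarrow> hnorm (K n) (y n v) \<le> D * hnorm (K n) v"
    using linf_bound[OF y] by blast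
  show ?thesis
  proof (rule linfI[of _ "C * D"])
    fix n v assume v: "v \<in> carrier (K n)"
    have "hnorm (K n) (x n (y n v)) \<le> C * hnorm (K n) (y n v)"
      by (rule C(2)[OF A.op_closed[OF A.mem_bounded[OF linf_mem[OF y]] v]])
    also have "\<dots> \<le> C * (D * hnorm (K n) v)" using D(2)[OF v] C(1) by (intro mult_left_mono) auto
    finally show "hnorm (K n) ((x \<otimes>\<^bsub>L\<^esub> y) n v) \<le> C * D * hnorm (K n) v"
      using v by (simp add: mult.assoc)
  qed (use C(1) D(1) x y in \<open>auto intro: A.mult_mem linf_mem\<close>)
qed

lemma linf_adj:
  assumes x: "x \<in> linf K M"
  shows "adj L x \<in> linf K M"
proof -
  obtain C where C: "C > 0" "\<And>n v. v \<in> carrier (K n) \<Longrightarrow> hnorm (K n) (x n v) \<le> C * hnorm (K n) v"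
    using linf_bound[OF x] by blast
  show ?thesis
  proof (rule linfI[of _ C])
    fix n v assume v: "v \<in> carrier (K n)"
    show "hnorm (K n) (adj L x n v) \<le> C * hnorm (K n) v"
      using A.hnorm_adjoint_le[OF A.mem_bounded[OF linf_mem[OF x]] v _ C(2)] C(1) by simp
  qed (use C(1) linf_mem[OF x] in auto)
qed

lemma rep_seq:
  assumes x: "x \<in> linf K M"
  shows "(\<lambda>n. \<pi> n (x n)) \<in> bounded_op_seqs"
proof -
  obtain C where C: "C > 0" "\<And>n v. v \<in> carrier (K n) \<Longrightarrow> hnorm (K n) (x n v) \<le> C * hnorm (K n) v"
    using linf_bound[OF x] by blast
  have "hnorm (H n) (\<pi> n (x n) v) \<le> C * hnorm (H n) v" if "v \<in> carrier (H n)" for n v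
    by (rule hnorm_rep_le[OF linf_mem[OF x] less_imp_le[OF C(1)] C(2) that])
  then show ?thesis using linf_mem[OF x] by (auto simp: bounded_op_seqs_def)
qed

lemma op_bounded [simp]: "x \<in> linf K M \<Longrightarrow> op x \<in> bounded_ops \<H>"
  by (rule op_class_bounded[OF rep_seq])

lemma op_apply: "\<lbrakk>x \<in> linf K M; u \<in> bounded_seqs H\<rbrakk> \<Longrightarrow> op x (cls u) = cls (\<lambda>n. \<pi> n (x n) (u n))"
  by (rule op_class_apply[OF rep_seq])

lemma rep_bounded_seq: "\<lbrakk>x \<in> linf K M; u \<in> bounded_seqs H\<rbrakk> \<Longrightarrow> (\<lambda>n. \<pi> n (x n) (u n)) \<in> bounded_seqs H"
  by (rule apply_bounded_seq[OF rep_seq])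

lemma hnorm_op_le:
  assumes x: "x \<in> linf K M" and V: "V \<in> carrier \<H>" and C: "C \<ge> 0"
    "\<And>n v. v \<in> carrier (K n) \<Longrightarrow> hnorm (K n) (x n v) \<le> C * hnorm (K n) v"
  shows "hnorm \<H> (op x V) \<le> C * hnorm \<H> V"
  by (rule hnorm_op_class_le[OF rep_seq[OF x] V], rule hnorm_rep_le[OF linf_mem[OF x] C])

lemma op_one: "op \<one>\<^bsub>L\<^esub> = \<one>\<^bsub>op_algebra \<H>\<^esub>"
  by (rule op_class_eqI[OF rep_seq[OF linf_one]]) (simp_all add: rep_one bounded_seqsD)

lemma op_mult:
  assumes x: "x \<in> linf K M" and y: "y \<in> linf K M"
  shows "op (x \<otimes>\<^bsub>L\<^esub> y) = op x \<otimes>\<^bsub>op_algebra \<H>\<^esub> op y"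
proof (rule op_class_eqI[OF rep_seq[OF linf_mult[OF x y]]])
  fix u assume u: "u \<in> bounded_seqs H"
  show "(op x \<otimes>\<^bsub>op_algebra \<H>\<^esub> op y) (cls u) = cls (\<lambda>n. \<pi> n ((x \<otimes>\<^bsub>L\<^esub> y) n) (u n))"
    using u x y bounded_seqsD[OF u] rep_bounded_seq[OF y u] linf_mem[OF x] linf_mem[OF y]
    by (simp add: op_apply rep_mult)
qed (use x y in simp)

lemma op_add:
  assumes x: "x \<in> linf K M" and y: "y \<in> linf K M"
  shows "op (x \<oplus>\<^bsub>L\<^esub> y) = op x \<oplus>\<^bsub>op_algebra \<H>\<^esub> op y"
proof (rule op_class_eqI[OF rep_seq[OF linf_add[OF x y]]])
  fix u assume u: "u \<in> bounded_seqs H"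
  show "(op x \<oplus>\<^bsub>op_algebra \<H>\<^esub> op y) (cls u) = cls (\<lambda>n. \<pi> n ((x \<oplus>\<^bsub>L\<^esub> y) n) (u n))"
    using u x y bounded_seqsD[OF u] rep_bounded_seq[OF x u] rep_bounded_seq[OF y u] linf_mem[OF x] linf_mem[OF y]
    by (simp add: op_apply rep_add add_ultra)
qed (use x y in simp)

lemma op_smult:
  assumes x: "x \<in> linf K M"
  shows "op (c \<odot>\<^bsub>L\<^esub> x) = c \<odot>\<^bsub>op_algebra \<H>\<^esub> op x"
proof (rule op_class_eqI[OF rep_seq[OF linf_smult[OF x]]])
  fix u assume u: "u \<in> bounded_seqs H"
  show "(c \<odot>\<^bsub>op_algebra \<H>\<^esub> op x) (cls u) = cls (\<lambda>n. \<pi> n ((c \<odot>\<^bsub>L\<^esub> x) n) (u n))"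
    using u x bounded_seqsD[OF u] rep_bounded_seq[OF x u] linf_mem[OF x]
    by (simp add: op_apply rep_smult smult_ultra)
qed (use x in simp)

lemma op_adj:
  assumes x: "x \<in> linf K M"
  shows "op (adj L x) = adjoint \<H> (op x)"
  by (rule op_class_adjoint[OF rep_seq[OF x] rep_seq[OF linf_adj[OF x]]])
    (simp add: rep_adjoint linf_mem[OF x])

abbreviation N :: "((nat \<Rightarrow> 'h) set \<Rightarrow> (nat \<Rightarrow> 'h) set) set" where
  "N \<equiv> groh_raynaud_ultraproduct \<omega> K M H \<pi>"

sublocale O: operator_star_algebra \<H> "op ` linf K M"
proof unfold_locales
  show "op ` linf K M \<subseteq> bounded_ops \<H>" by auto
  show "\<one>\<^bsub>op_algebra \<H>\<^esub> \<in> op ` linf K M" using op_one linf_one by (metis image_eqI)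
  show "S \<oplus>\<^bsub>op_algebra \<H>\<^esub> T \<in> op ` linf K M" if "S \<in> op ` linf K M" "T \<in> op ` linf K M" for S T
  proof -
    obtain x y where xy: "x \<in> linf K M" "S = op x" "y \<in> linf K M" "T = op y" using \<open>S \<in> _\<close> \<open>T \<in> _\<close> by blast
    show ?thesis unfolding xy op_add[OF xy(1,3), symmetric] by (rule imageI[OF linf_add[OF xy(1,3)]])
  qed
  show "S \<otimes>\<^bsub>op_algebra \<H>\<^esub> T \<in> op ` linf K M" if "S \<in> op ` linf K M" "T \<in> op ` linf K M" for S T
  proof -
    obtain x y where xy: "x \<in> linf K M" "S = op x" "y \<in> linf K M" "T = op y" using \<open>S \<in> _\<close> \<open>T \<in> _\<close> by blast
    show ?thesis unfolding xy op_mult[OF xy(1,3), symmetric] by (rule imageI[OF linf_mult[OF xy(1,3)]])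
  qed
  show "c \<odot>\<^bsub>op_algebra \<H>\<^esub> S \<in> op ` linf K M" if "S \<in> op ` linf K M" for c S
  proof -
    obtain x where x: "x \<in> linf K M" "S = op x" using \<open>S \<in> _\<close> by blast
    show ?thesis unfolding x op_smult[OF x(1), symmetric] by (rule imageI[OF linf_smult[OF x(1)]])
  qed
  show "adj (op_algebra \<H>) S \<in> op ` linf K M" if "S \<in> op ` linf K M" for S
  proof -
    obtain x where x: "x \<in> linf K M" "S = op x" using \<open>S \<in> _\<close> by blast
    show ?thesis unfolding x op_algebra_simps op_adj[OF x(1), symmetric] by (rule imageI[OF linf_adj[OF x(1)]])
  qed
qed

lemma N_eq: "N = sot_closure \<H> (op ` linf K M)"
  unfolding groh_raynaud_ultraproduct_def by (rule arg_cong[where f = "sot_closure \<H>"]) blast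

lemma von_neumann_N: "von_neumann_algebra \<H> N"
  unfolding N_eq by (rule O.von_neumann_sot_closure)

sublocale N: von_neumann_algebra \<H> N by (rule von_neumann_N)

lemma op_mem_N [simp]: "x \<in> linf K M \<Longrightarrow> op x \<in> N"
  unfolding N_eq using O.subset_sot_closure by blast

end

subsection \<open>The support projection of a vector state\<close>

context von_neumann_algebra
begin

text \<open>L is invariant under the commutant, as T (R x) = R (T x), so its projection lies in the
  bicommutant. If the vector state takes the same value at a projection q as at the identity, then q
  \<eta> = \<eta>, so 1 - q kills \<eta> and therefore the range of p; this is minimality.\<close>

lemma vector_support_projection:
  assumes \<eta>: "\<eta> \<in> carrier H"
  obtains p where "is_support_projection H M (\<lambda>T. ip H (T \<eta>) \<eta>) p" "p \<in> M" "adjoint H p = p"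
    "\<And>x. x \<in> carrier H \<Longrightarrow> p (p x) = p x" "p \<eta> = \<eta>"
    "\<And>T x. \<lbrakk>T \<in> M; T \<eta> = \<zero>; x \<in> carrier H\<rbrakk> \<Longrightarrow> T (p x) = \<zero>"
proof -
  define L where "L = {x \<in> carrier H. \<forall>T\<in>M. T \<eta> = \<zero> \<longrightarrow> T x = \<zero>}"
  have L: "closed_subspace L"
    unfolding closed_subspace_def
  proof (intro conjI ballI allI impI)
    show "L \<subseteq> carrier H" "\<zero> \<in> L" by (auto simp: L_def)
    show "x \<oplus> y \<in> L" if "x \<in> L" "y \<in> L" for x y
    proof -
      have "T (x \<oplus> y) = \<zero>" if T: "T \<in> M" "T \<eta> = \<zero>" for T
      proof -
        have "x \<in> carrier H" "y \<in> carrier H" "T x = \<zero>" "T y = \<zero>"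
          using \<open>x \<in> L\<close> \<open>y \<in> L\<close> T unfolding L_def by blast+
        then show ?thesis using op_add[OF mem_bounded[OF T(1)], of x y] by simp
      qed
      then show ?thesis using that by (simp add: L_def)
    qed
    show "c \<odot> x \<in> L" if "x \<in> L" for c x
    proof -
      have "T (c \<odot> x) = \<zero>" if T: "T \<in> M" "T \<eta> = \<zero>" for T
      proof -
        have "x \<in> carrier H" "T x = \<zero>" using \<open>x \<in> L\<close> T unfolding L_def by blast+
        then show ?thesis using op_scale[OF mem_bounded[OF T(1)], of x] by simp
      qed
      then show ?thesis using that by (simp add: L_def)
    qed
    fix x assume x: "x \<in> carrier H" and app: "\<forall>e>0. \<exists>v\<in>L. hnorm H (x \<ominus> v) < e"
    have "T x = \<zero>" if T: "T \<in> M" "T \<eta> = \<zero>" for T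
    proof (rule vec_eq_small)
      have Tb: "T \<in> bounded_ops H" using T by simp
      obtain C where C: "C > 0" "\<And>x. x \<in> carrier H \<Longrightarrow> hnorm H (T x) \<le> C * hnorm H x"
        using op_bound[OF Tb] by blast
      fix e :: real assume "e > 0"
      then have "e / C > 0" using C(1) by simp
      then obtain v where v: "v \<in> L" "hnorm H (x \<ominus> v) < e / C" using app by blast
      have vc: "v \<in> carrier H" "T v = \<zero>" using v T by (auto simp: L_def)
      have "T x = T (x \<ominus> v)" using op_diff[OF Tb x vc(1)] vc x Tb by simp
      then have "hnorm H (T x) \<le> C * hnorm H (x \<ominus> v)" using C(2)[OF M.minus_closed[OF x vc(1)]] by simp
      also have "\<dots> \<le> e" using v(2) C(1) by (simp add: field_simps)
      finally show "hnorm H (T x \<ominus> \<zero>) \<le> e" using x Tb by (simp del: M.minus_closed)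
    qed (use T x in auto)
    then show "x \<in> L" using x by (simp add: L_def)
  qed
  obtain p where pb: "p \<in> bounded_ops H" and pL: "\<And>x. x \<in> carrier H \<Longrightarrow> p x \<in> L"
    and pfix: "\<And>x. x \<in> L \<Longrightarrow> p x = x"
    and psa: "\<And>x y. \<lbrakk>x \<in> carrier H; y \<in> carrier H\<rbrakk> \<Longrightarrow> ip H (p x) y = ip H x (p y)"
    using orthogonal_projection[OF L] by blast
  have invar: "R x \<in> L" if R: "R \<in> commutant H M" and x: "x \<in> L" for R x
  proof -
    have Rb: "R \<in> bounded_ops H" using R by (rule commutant_bounded)
    have xc: "x \<in> carrier H" using x by (simp add: L_def)
    have "T (R x) = \<zero>" if T: "T \<in> M" "T \<eta> = \<zero>" for T
    proof -
      have "T x = \<zero>" using x T unfolding L_def by blast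
      then show ?thesis using commutantD[OF R T(1) xc] Rb by simp
    qed
    then show ?thesis using Rb xc by (simp add: L_def)
  qed
  have "p \<in> commutant H (commutant H M)"
    unfolding commutant_def[of H "commutant H M"]
  proof (intro CollectI conjI ballI)
    fix R x assume R: "R \<in> commutant H M" and x: "x \<in> carrier H"
    have Rb: "R \<in> bounded_ops H" using R by (rule commutant_bounded)
    show "p (R x) = R (p x)"
    proof (rule projection_commute[OF pb pL pfix psa Rb])
      show "adjoint H R \<in> bounded_ops H" using Rb by simp
      show "ip H (R x) y = ip H x (adjoint H R y)" if "x \<in> carrier H" "y \<in> carrier H" for x y
        using ip_adjoint_right[OF Rb that] by simp
    qed (use invar[OF R] invar[OF adjoint_commutant[OF R]] x in auto)
  qed (rule pb)
  then have pM: "p \<in> M" using sot_closed sot_closure_eq_bicommutant by blast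
  have adj: "adjoint H p = p" by (rule adjoint_eqI[OF pb pb psa])
  have idem: "p (p x) = p x" if "x \<in> carrier H" for x using that pL pfix by simp
  have p\<eta>: "p \<eta> = \<eta>" using \<eta> by (intro pfix) (simp add: L_def)
  have ann: "T (p x) = \<zero>" if "T \<in> M" "T \<eta> = \<zero>" "x \<in> carrier H" for T x
    using pL[OF that(3)] that by (simp add: L_def)
  have "is_support_projection H M (\<lambda>T. ip H (T \<eta>) \<eta>) p"
    unfolding is_support_projection_def
  proof (intro conjI ballI impI)
    have "p \<otimes>\<^bsub>op_algebra H\<^esub> p = p" by (rule op_eqI) (use pb idem in auto)
    then show "p \<in> projections H M" using pM adj by (simp add: projections_def)
    show "ip H (p \<eta>) \<eta> = ip H (\<one>\<^bsub>op_algebra H\<^esub> \<eta>) \<eta>" using \<eta> p\<eta> by simp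
    fix q assume q: "q \<in> projections H M" and eq: "ip H (q \<eta>) \<eta> = ip H (\<one>\<^bsub>op_algebra H\<^esub> \<eta>) \<eta>"
    have qM: "q \<in> M" and qq: "q \<otimes>\<^bsub>op_algebra H\<^esub> q = q" and qadj: "adjoint H q = q"
      using q by (auto simp: projections_def)
    have qb: "q \<in> bounded_ops H" using qM by simp
    have "ip H (q \<eta>) (q \<eta>) = ip H (q (q \<eta>)) \<eta>"
      using ip_adjoint_right[OF qb op_closed[OF qb \<eta>] \<eta>] qadj by simp
    also have "q (q \<eta>) = q \<eta>" using fun_cong[OF qq, of \<eta>] \<eta> by simp
    finally have "ip H (q \<eta>) (q \<eta>) = ip H (q \<eta>) \<eta>" .
    \<comment> \<open>As q is a projection, this squared norm is the difference of the two values of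
      the state that are equal by assumption.\<close>
    then have "(hnorm H (\<eta> \<ominus> q \<eta>))\<^sup>2 = 0"
      using hnorm_diff_sq[OF \<eta> op_closed[OF qb \<eta>]] Re_ip_commute[OF \<eta> op_closed[OF qb \<eta>]]
        hnorm_sq[OF \<eta>] hnorm_sq[OF op_closed[OF qb \<eta>]] eq \<eta> by simp
    then have q\<eta>: "\<eta> = q \<eta>" using \<eta> qb hnorm_diff_eq_0[of \<eta> "q \<eta>"] by simp
    define r where "r = \<one>\<^bsub>op_algebra H\<^esub> \<oplus>\<^bsub>op_algebra H\<^esub> (-1) \<odot>\<^bsub>op_algebra H\<^esub> q"
    have r: "r \<in> M" using qM by (simp add: r_def add_mem one_mem smult_mem)
    have rx: "r x = x \<ominus> q x" if "x \<in> carrier H" for x using that qb by (simp add: r_def diff_eq)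
    have "r \<eta> = \<zero>" using rx[OF \<eta>] q\<eta> \<eta> diff_eq_zero[of \<eta> "q \<eta>"] qb by simp
    then have "p x \<ominus> q (p x) = \<zero>" if "x \<in> carrier H" for x
      using ann[OF r _ that] rx[OF op_closed[OF pb that]] by simp
    then have "q (p x) = p x" if "x \<in> carrier H" for x
      using that diff_eq_zero[of "p x" "q (p x)"] qb pb by simp
    then show "q \<otimes>\<^bsub>op_algebra H\<^esub> p = p" using qb pb by (intro op_eqI) auto
  qed
  then show ?thesis using that pM adj idem p\<eta> ann by blast
qed

text \<open>Minimality of each projection gives p q = q and q p = p; the adjoint of one equation
  identifies p and q, which evaluates the definite description.\<close>

lemma support_projection_eq:
  assumes p: "is_support_projection H M f p"
  shows "support_projection H M f = p"
  unfolding support_projection_def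
proof (rule the_equality[of "is_support_projection H M f"])
  fix q assume q: "is_support_projection H M f q"
  have "p \<in> projections H M" "q \<in> projections H M"
    and pq: "p \<otimes>\<^bsub>op_algebra H\<^esub> q = q" and qp: "q \<otimes>\<^bsub>op_algebra H\<^esub> p = p"
    using p q by (simp_all add: is_support_projection_def)
  then have a: "p \<in> bounded_ops H" "q \<in> bounded_ops H" "adjoint H p = p" "adjoint H q = q"
    by (auto simp: projections_def)
  have "q = adjoint H (p \<otimes>\<^bsub>op_algebra H\<^esub> q)" using pq a by simp
  also have "\<dots> = p" using adjoint_mult[OF a(1,2)] a qp by simp
  finally show "q = p" .
qed (rule p)

end

subsection \<open>Lifting to bounded sequences\<close>

context gns_sequence
begin

abbreviation \<Xi> :: "(nat \<Rightarrow> 'h) set" where "\<Xi> \<equiv> cls \<xi>"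

lemma vector_seq [simp]: "\<xi> \<in> bounded_seqs H"
  by (rule bounded_seqsI[of _ 1]) (auto simp: hnorm_vector)

lemma vector_closed [simp]: "\<Xi> \<in> carrier \<H>"
  by simp

lemma hnorm_ultra_vector: "hnorm \<H> \<Xi> = 1"
  using hnorm_ultra_tendsto[OF vector_seq] by (intro ulim_unique[of "\<lambda>n. 1"]) (simp_all add: hnorm_vector)

lemma hnorm_ultra_minus:
  "\<lbrakk>u \<in> bounded_seqs H; v \<in> bounded_seqs H\<rbrakk> \<Longrightarrow>
    ((\<lambda>n. hnorm (H n) (u n \<ominus>\<^bsub>H n\<^esub> v n)) \<longlongrightarrow> hnorm \<H> (cls u \<ominus>\<^bsub>\<H>\<^esub> cls v)) \<omega>"
  using hnorm_ultra_diff[of u v] by (simp add: W.diff_eq)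

text \<open>Saturation over the self-adjoint elements of \<open>M n\<close> with bound C, the defect
  being the sum of the two errors. The bound must not depend on e: it fixes the set of candidates
  and places the resulting sequence in \<open>linf\<close>. Two vectors are provided for because one
  application prescribes values at both \<Xi> and \<eta>.\<close>

lemma lift_vectors:
  assumes c: "Y\<^sub>1 \<in> carrier \<H>" "Y\<^sub>2 \<in> carrier \<H>" "Z\<^sub>1 \<in> carrier \<H>" "Z\<^sub>2 \<in> carrier \<H>" and C: "C \<ge> 0"
    and app: "\<And>e. e > 0 \<Longrightarrow> \<exists>y\<in>linf K M. adj L y = y \<and>
        (\<forall>n. \<forall>v\<in>carrier (K n). hnorm (K n) (y n v) \<le> C * hnorm (K n) v) \<and>
        hnorm \<H> (op y Y\<^sub>1 \<ominus>\<^bsub>\<H>\<^esub> Z\<^sub>1) < e \<and> hnorm \<H> (op y Y\<^sub>2 \<ominus>\<^bsub>\<H>\<^esub> Z\<^sub>2) < e"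
  shows "\<exists>y\<in>linf K M. adj L y = y \<and> op y Y\<^sub>1 = Z\<^sub>1 \<and> op y Y\<^sub>2 = Z\<^sub>2"
proof -
  obtain a1 a2 b1 b2 where a1: "a1 \<in> bounded_seqs H" "Y\<^sub>1 = cls a1" and a2: "a2 \<in> bounded_seqs H" "Y\<^sub>2 = cls a2"
    and b1: "b1 \<in> bounded_seqs H" "Z\<^sub>1 = cls b1" and b2: "b2 \<in> bounded_seqs H" "Z\<^sub>2 = cls b2"
    using c by (elim carrier_ultraE)
  note cc = a1(1)[THEN bounded_seqsD] a2(1)[THEN bounded_seqsD] b1(1)[THEN bounded_seqsD] b2(1)[THEN bounded_seqsD]
  define X where "X n = {T \<in> M n. adjoint (K n) T = T \<and> (\<forall>v\<in>carrier (K n). hnorm (K n) (T v) \<le> C * hnorm (K n) v)}" for n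
  define g where "g n T = hnorm (H n) (\<pi> n T (a1 n) \<ominus>\<^bsub>H n\<^esub> b1 n) + hnorm (H n) (\<pi> n T (a2 n) \<ominus>\<^bsub>H n\<^esub> b2 n)" for n T
  have pos: "0 \<le> hnorm (H n) (\<pi> n T (a1 n) \<ominus>\<^bsub>H n\<^esub> b1 n)" "0 \<le> hnorm (H n) (\<pi> n T (a2 n) \<ominus>\<^bsub>H n\<^esub> b2 n)"
    if "T \<in> X n" for n T
    using that cc by (auto simp: X_def intro!: F.hnorm_nonneg)
  have "\<exists>y. (\<forall>n. y n \<in> X n) \<and> ((\<lambda>n. g n (y n)) \<longlongrightarrow> 0) \<omega>"
  proof (rule saturation)
    show "X n \<noteq> {}" for n
    proof -
      have "0 \<odot>\<^bsub>op_algebra (K n)\<^esub> \<one>\<^bsub>op_algebra (K n)\<^esub> \<in> X n"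
        using C by (auto simp: X_def A.one_mem A.smult_mem A.adjoint_smult)
      then show ?thesis by blast
    qed
    show "0 \<le> g n T" if "T \<in> X n" for n T using pos[OF that] by (simp add: g_def)
    fix e :: real assume "e > 0"
    then have e: "e / 2 > 0" by simp
    then obtain y where y: "y \<in> linf K M" "adj L y = y"
      "\<forall>n. \<forall>v\<in>carrier (K n). hnorm (K n) (y n v) \<le> C * hnorm (K n) v"
      "hnorm \<H> (op y Y\<^sub>1 \<ominus>\<^bsub>\<H>\<^esub> Z\<^sub>1) < e / 2" "hnorm \<H> (op y Y\<^sub>2 \<ominus>\<^bsub>\<H>\<^esub> Z\<^sub>2) < e / 2"
      using app by blast
    have yX: "y n \<in> X n" for n
      using y(1,3) fun_cong[OF y(2), of n] by (simp add: X_def linf_mem)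
    have "eventually (\<lambda>n. hnorm (H n) (\<pi> n (y n) (a1 n) \<ominus>\<^bsub>H n\<^esub> b1 n) < e / 2) \<omega>"
      using y(4) by (intro order_tendstoD(2)[OF hnorm_ultra_minus[OF rep_bounded_seq[OF y(1) a1(1)] b1(1)]])
        (simp add: a1 b1 op_apply[OF y(1) a1(1)])
    moreover have "eventually (\<lambda>n. hnorm (H n) (\<pi> n (y n) (a2 n) \<ominus>\<^bsub>H n\<^esub> b2 n) < e / 2) \<omega>"
      using y(5) by (intro order_tendstoD(2)[OF hnorm_ultra_minus[OF rep_bounded_seq[OF y(1) a2(1)] b2(1)]])
        (simp add: a2 b2 op_apply[OF y(1) a2(1)])
    ultimately show "eventually (\<lambda>n. \<exists>T\<in>X n. g n T < e) \<omega>"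
    proof eventually_elim
      case (elim n)
      then have "g n (y n) < e" by (simp add: g_def)
      then show ?case using yX by blast
    qed
  qed
  then obtain y where yX: "\<And>n. y n \<in> X n" and lim: "((\<lambda>n. g n (y n)) \<longlongrightarrow> 0) \<omega>" by blast
  have y: "y \<in> linf K M" by (rule linfI[OF _ C]) (use yX in \<open>auto simp: X_def\<close>)
  have "op y Y\<^sub>1 = Z\<^sub>1"
    unfolding a1 b1 op_apply[OF y a1(1)]
    by (rule cls_eqI[OF rep_bounded_seq[OF y a1(1)] b1(1)], rule tendsto_zero_mono[OF lim])
      (use pos[OF yX] in \<open>simp_all add: g_def\<close>)
  moreover have "op y Y\<^sub>2 = Z\<^sub>2"
    unfolding a2 b2 op_apply[OF y a2(1)]
    by (rule cls_eqI[OF rep_bounded_seq[OF y a2(1)] b2(1)], rule tendsto_zero_mono[OF lim])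
      (use pos[OF yX] in \<open>simp_all add: g_def\<close>)
  moreover have "adj L y = y" using yX by (auto simp: fun_eq_iff X_def)
  ultimately show ?thesis using y by blast
qed

text \<open>Density yields a bounded sequence whose operator is self-adjoint although its entries
  need not be. Averaging the sequence with its adjoint makes every entry self-adjoint and leaves the
  operator unchanged.\<close>

lemma selfadjoint_approx:
  assumes T: "T \<in> N" "adjoint \<H> T = T" and F: "finite F" "F \<subseteq> carrier \<H>" and e: "e > 0"
  shows "\<exists>c\<in>linf K M. adj L c = c \<and> (\<forall>V\<in>F. hnorm \<H> (T V \<ominus>\<^bsub>\<H>\<^esub> op c V) < e)"
proof -
  obtain x where x: "x \<in> linf K M" "adjoint \<H> (op x) = op x"
    and app: "\<forall>V\<in>F. hnorm \<H> (T V \<ominus>\<^bsub>\<H>\<^esub> op x V) < e"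
    using O.selfadjoint_dense[OF T(1)[unfolded N_eq] T(2) F e] by blast
  define c where "c = (1/2) \<odot>\<^bsub>L\<^esub> (x \<oplus>\<^bsub>L\<^esub> adj L x)"
  have s: "x \<oplus>\<^bsub>L\<^esub> adj L x \<in> linf K M" by (intro linf_add linf_adj x)
  have c: "c \<in> linf K M" unfolding c_def by (rule linf_smult[OF s])
  have "adj L c = c"
  proof
    fix n
    have xb: "x n \<in> bounded_ops (K n)" by (rule A.mem_bounded[OF linf_mem[OF x(1)]])
    show "adj L c n = c n"
      by (rule A.op_eqI[where n = n]) (use xb in \<open>auto simp: c_def A.adjoint_smult A.adjoint_add A.M.a_comm\<close>)
  qed
  moreover have "op c V = op x V" if V: "V \<in> carrier \<H>" for V
  proof (rule W.vec_eqI)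
    fix Z assume Z: "Z \<in> carrier \<H>"
    have o: "op c = (1/2) \<odot>\<^bsub>op_algebra \<H>\<^esub> (op x \<oplus>\<^bsub>op_algebra \<H>\<^esub> op x)"
      unfolding c_def op_smult[OF s] op_add[OF x(1) linf_adj[OF x(1)]] op_adj[OF x(1)] x(2) ..
    show "ip \<H> (op c V) Z = ip \<H> (op x V) Z"
      unfolding o using V Z W.op_closed[OF op_bounded[OF x(1)] V] by (simp add: W.ip_scale_left W.ip_add_left)
  qed (use W.op_closed[OF op_bounded[OF c] V] W.op_closed[OF op_bounded[OF x(1)] V] in auto)
  ultimately show ?thesis using c app F(2) by (intro bexI[OF _ c]) auto
qed

text \<open>The resolvents are taken entry by entry. Their bounds are the same for every n and every
  c, so they form a sequence in \<open>linf\<close>, and relations between sequences become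
  relations between operators since \<open>op\<close> respects sums and products.\<close>

lemma linf_resolvent:
  assumes c: "c \<in> linf K M" "adj L c = c"
  obtains d where "d \<in> linf K M" "adj L d = d" "adj L (c \<otimes>\<^bsub>L\<^esub> d) = c \<otimes>\<^bsub>L\<^esub> d"
    "\<And>n v. v \<in> carrier (K n) \<Longrightarrow> hnorm (K n) (d n v) \<le> hnorm (K n) v"
    "\<And>n v. v \<in> carrier (K n) \<Longrightarrow> 2 * hnorm (K n) (c n (d n v)) \<le> hnorm (K n) v"
    "\<And>V. V \<in> carrier \<H> \<Longrightarrow> op d V \<oplus>\<^bsub>\<H>\<^esub> op c (op c (op d V)) = V"
    "\<And>V. V \<in> carrier \<H> \<Longrightarrow> op d (op c V) = op c (op d V)"
    "\<And>V. V \<in> carrier \<H> \<Longrightarrow> hnorm \<H> (op d V) \<le> hnorm \<H> V"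
    "\<And>V. V \<in> carrier \<H> \<Longrightarrow> 2 * hnorm \<H> (op c (op d V)) \<le> hnorm \<H> V"
proof -
  have cM: "c n \<in> M n" and csa: "adjoint (K n) (c n) = c n" for n
    using linf_mem[OF c(1)] fun_cong[OF c(2), of n] by simp_all
  have cb: "c n \<in> bounded_ops (K n)" for n using cM A.mem_bounded by blast
  have "\<exists>d. d \<in> M n \<and> adjoint (K n) d = d \<and> (\<forall>x\<in>carrier (K n). d x \<oplus>\<^bsub>K n\<^esub> c n (c n (d x)) = x \<and>
      d (c n x) = c n (d x) \<and> hnorm (K n) (d x) \<le> hnorm (K n) x \<and> 2 * hnorm (K n) (c n (d x)) \<le> hnorm (K n) x)" for n
    by (rule A.resolvent_mem[OF cM csa]) blast
  then have "\<forall>n. \<exists>d. d \<in> M n \<and> adjoint (K n) d = d \<and> (\<forall>x\<in>carrier (K n). d x \<oplus>\<^bsub>K n\<^esub> c n (c n (d x)) = x \<and>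
      d (c n x) = c n (d x) \<and> hnorm (K n) (d x) \<le> hnorm (K n) x \<and> 2 * hnorm (K n) (c n (d x)) \<le> hnorm (K n) x)"
    by blast
  then obtain d where d: "\<forall>n. d n \<in> M n \<and> adjoint (K n) (d n) = d n \<and> (\<forall>x\<in>carrier (K n). d n x \<oplus>\<^bsub>K n\<^esub> c n (c n (d n x)) = x \<and>
      d n (c n x) = c n (d n x) \<and> hnorm (K n) (d n x) \<le> hnorm (K n) x \<and> 2 * hnorm (K n) (c n (d n x)) \<le> hnorm (K n) x)"
    by (rule choice[THEN exE])
  have dM: "d n \<in> M n" and dsa: "adjoint (K n) (d n) = d n" for n using d by auto
  have db: "d n \<in> bounded_ops (K n)" for n using dM A.mem_bounded by blast
  have sum: "d n x \<oplus>\<^bsub>K n\<^esub> c n (c n (d n x)) = x" and comm: "d n (c n x) = c n (d n x)"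
    and dn: "hnorm (K n) (d n x) \<le> hnorm (K n) x" and cdn: "2 * hnorm (K n) (c n (d n x)) \<le> hnorm (K n) x"
    if "x \<in> carrier (K n)" for n x
    using d that by auto
  have dl: "d \<in> linf K M" by (rule linfI[of _ 1]) (use dM dn in auto)
  have cd: "c \<otimes>\<^bsub>L\<^esub> d \<in> linf K M" and ccd: "c \<otimes>\<^bsub>L\<^esub> (c \<otimes>\<^bsub>L\<^esub> d) \<in> linf K M" and dc: "d \<otimes>\<^bsub>L\<^esub> c \<in> linf K M"
    by (intro linf_mult c(1) dl)+
  have eq1: "d \<oplus>\<^bsub>L\<^esub> c \<otimes>\<^bsub>L\<^esub> (c \<otimes>\<^bsub>L\<^esub> d) = \<one>\<^bsub>L\<^esub>"
  proof
    fix n show "(d \<oplus>\<^bsub>L\<^esub> c \<otimes>\<^bsub>L\<^esub> (c \<otimes>\<^bsub>L\<^esub> d)) n = \<one>\<^bsub>L\<^esub> n"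
      by (rule A.op_eqI[where n = n]) (use cb[of n] db[of n] sum in auto)
  qed
  have eq2: "d \<otimes>\<^bsub>L\<^esub> c = c \<otimes>\<^bsub>L\<^esub> d"
  proof
    fix n show "(d \<otimes>\<^bsub>L\<^esub> c) n = (c \<otimes>\<^bsub>L\<^esub> d) n"
      by (rule A.op_eqI[where n = n]) (use cb[of n] db[of n] comm in auto)
  qed
  have o1: "op d \<oplus>\<^bsub>op_algebra \<H>\<^esub> op c \<otimes>\<^bsub>op_algebra \<H>\<^esub> (op c \<otimes>\<^bsub>op_algebra \<H>\<^esub> op d) = \<one>\<^bsub>op_algebra \<H>\<^esub>"
    using arg_cong[OF eq1, of op] by (simp only: op_add[OF dl ccd] op_mult[OF c(1) cd] op_mult[OF c(1) dl] op_one)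
  have o2: "op d \<otimes>\<^bsub>op_algebra \<H>\<^esub> op c = op c \<otimes>\<^bsub>op_algebra \<H>\<^esub> op d"
    using arg_cong[OF eq2, of op] by (simp only: op_mult[OF c(1) dl] op_mult[OF dl c(1)])
  show ?thesis
  proof (rule that[OF dl])
    show "adj L d = d" using dsa by (auto simp: fun_eq_iff)
    show "adj L (c \<otimes>\<^bsub>L\<^esub> d) = c \<otimes>\<^bsub>L\<^esub> d"
    proof
      fix n
      have "adj L (c \<otimes>\<^bsub>L\<^esub> d) n = (d \<otimes>\<^bsub>L\<^esub> c) n" using cb db by (simp add: A.adjoint_mult csa dsa)
      then show "adj L (c \<otimes>\<^bsub>L\<^esub> d) n = (c \<otimes>\<^bsub>L\<^esub> d) n" by (simp only: eq2)
    qed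
    fix V assume V: "V \<in> carrier \<H>"
    have Vc: "op d V \<in> carrier \<H>" "op c (op d V) \<in> carrier \<H>"
      using V W.op_closed[OF op_bounded] c(1) dl by auto
    show "op d V \<oplus>\<^bsub>\<H>\<^esub> op c (op c (op d V)) = V" using fun_cong[OF o1, of V] V Vc by simp
    show "op d (op c V) = op c (op d V)" using fun_cong[OF o2, of V] V by simp
    show "hnorm \<H> (op d V) \<le> hnorm \<H> V" using hnorm_op_le[OF dl V, of 1] dn by simp
    have "hnorm \<H> (op (c \<otimes>\<^bsub>L\<^esub> d) V) \<le> 1/2 * hnorm \<H> V"
    proof (rule hnorm_op_le[OF cd V])
      show "hnorm (K n) ((c \<otimes>\<^bsub>L\<^esub> d) n v) \<le> 1/2 * hnorm (K n) v" if v: "v \<in> carrier (K n)" for n v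
        using cdn[OF v] v by simp
    qed simp
    moreover have "op (c \<otimes>\<^bsub>L\<^esub> d) V = op c (op d V)" unfolding op_mult[OF c(1) dl] using V by simp
    ultimately show "2 * hnorm \<H> (op c (op d V)) \<le> hnorm \<H> V" by simp
  qed (use dn cdn in auto)
qed

text \<open>With \<open>c\<close> close to \<open>q\<close> on \<open>\<Xi>\<close> and \<open>\<eta>\<close>, the operator \<open>2 c\<^sup>2 (1 + c\<^sup>2)\<^sup>-\<^sup>1 = 2 (1 - (1 + c\<^sup>2)\<^sup>-\<^sup>1)\<close>
  is bounded independently of \<open>c\<close> and still close to \<open>q\<close> on these vectors.\<close>

lemma lift_projection_vector:
  assumes q: "q \<in> N" "adjoint \<H> q = q" and \<eta>: "\<eta> \<in> carrier \<H>"
    and qv: "q \<Xi> = \<zero>\<^bsub>\<H>\<^esub>" "q \<eta> = \<eta>"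
  shows "\<exists>y\<in>linf K M. adj L y = y \<and> op y \<Xi> = \<zero>\<^bsub>\<H>\<^esub> \<and> op y \<eta> = \<eta>"
\<comment> \<open>The bound 4 is the triangle inequality for 2 (1 - d) with d contractive.\<close>
proof (rule lift_vectors[where C = 4])
  fix e :: real assume "e > 0"
  then have e: "e / 2 > 0" by simp
  obtain c where c: "c \<in> linf K M" "adj L c = c"
    and app: "\<forall>V\<in>{\<Xi>, \<eta>}. hnorm \<H> (q V \<ominus>\<^bsub>\<H>\<^esub> op c V) < e / 2"
    using selfadjoint_approx[OF q _ _ e, of "{\<Xi>, \<eta>}"] \<eta> by auto
  obtain d where d: "d \<in> linf K M" "adj L d = d"
    and dn: "\<And>n v. v \<in> carrier (K n) \<Longrightarrow> hnorm (K n) (d n v) \<le> hnorm (K n) v"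
    and sum: "\<And>V. V \<in> carrier \<H> \<Longrightarrow> op d V \<oplus>\<^bsub>\<H>\<^esub> op c (op c (op d V)) = V"
    and comm: "\<And>V. V \<in> carrier \<H> \<Longrightarrow> op d (op c V) = op c (op d V)"
    and dN: "\<And>V. V \<in> carrier \<H> \<Longrightarrow> hnorm \<H> (op d V) \<le> hnorm \<H> V"
    and cdN: "\<And>V. V \<in> carrier \<H> \<Longrightarrow> 2 * hnorm \<H> (op c (op d V)) \<le> hnorm \<H> V"
    by (rule linf_resolvent[OF c]) (rule that)
  have cb: "op c \<in> bounded_ops \<H>" and db: "op d \<in> bounded_ops \<H>" using c d by simp_all
  define y where "y = 2 \<odot>\<^bsub>L\<^esub> (\<one>\<^bsub>L\<^esub> \<oplus>\<^bsub>L\<^esub> (-1) \<odot>\<^bsub>L\<^esub> d)"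
  have md: "(-1) \<odot>\<^bsub>L\<^esub> d \<in> linf K M" by (rule linf_smult[OF d(1)])
  have s: "\<one>\<^bsub>L\<^esub> \<oplus>\<^bsub>L\<^esub> (-1) \<odot>\<^bsub>L\<^esub> d \<in> linf K M" by (rule linf_add[OF linf_one md])
  have y: "y \<in> linf K M" unfolding y_def by (rule linf_smult[OF s])
  have opy: "op y V = 2 \<odot>\<^bsub>\<H>\<^esub> (V \<ominus>\<^bsub>\<H>\<^esub> op d V)" if V: "V \<in> carrier \<H>" for V
  proof -
    have "op y = 2 \<odot>\<^bsub>op_algebra \<H>\<^esub> (\<one>\<^bsub>op_algebra \<H>\<^esub> \<oplus>\<^bsub>op_algebra \<H>\<^esub> (-1) \<odot>\<^bsub>op_algebra \<H>\<^esub> op d)"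
      unfolding y_def op_smult[OF s] op_add[OF linf_one md] op_smult[OF d(1)] op_one ..
    then show ?thesis using V W.op_closed[OF db V] by (simp add: W.diff_eq)
  qed
  have "adj L y = y"
  proof
    fix n
    have "d n \<in> bounded_ops (K n)" by (rule A.mem_bounded[OF linf_mem[OF d(1)]])
    then show "adj L y n = y n"
      using fun_cong[OF d(2), of n] by (simp add: y_def A.adjoint_smult A.adjoint_add)
  qed
  moreover have "\<forall>n. \<forall>v\<in>carrier (K n). hnorm (K n) (y n v) \<le> 4 * hnorm (K n) v"
  proof (intro allI ballI)
    fix n v assume v: "v \<in> carrier (K n)"
    have dv: "d n v \<in> carrier (K n)" by (rule A.op_closed[OF A.mem_bounded[OF linf_mem[OF d(1)]] v])
    have "hnorm (K n) (y n v) = 2 * hnorm (K n) (v \<ominus>\<^bsub>K n\<^esub> d n v)"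
      using v dv by (simp add: y_def A.diff_eq)
    also have "\<dots> \<le> 2 * (hnorm (K n) v + hnorm (K n) (d n v))"
      using A.hnorm_triangle_diff[OF v dv] by simp
    finally show "hnorm (K n) (y n v) \<le> 4 * hnorm (K n) v" using dn[OF v] by simp
  qed
  moreover have "hnorm \<H> (op y \<Xi> \<ominus>\<^bsub>\<H>\<^esub> \<zero>\<^bsub>\<H>\<^esub>) < e"
  proof -
    have k: "op c \<Xi> \<in> carrier \<H>" "op d \<Xi> \<in> carrier \<H>" "op c (op d \<Xi>) \<in> carrier \<H>" "op d (op c \<Xi>) \<in> carrier \<H>"
      "op c (op d (op c \<Xi>)) \<in> carrier \<H>"
      using cb db by simp_all
    \<comment> \<open>1 - d = c^2 d. Moving one factor c past d puts it next to \<Xi>, where c is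
      small, and leaves c d, whose norm is at most 1/2.\<close>
    have "\<Xi> \<ominus>\<^bsub>\<H>\<^esub> op d \<Xi> = op c (op d (op c \<Xi>))"
    proof (rule W.vec_eqI)
      fix Z assume Z: "Z \<in> carrier \<H>"
      have "ip \<H> \<Xi> Z = ip \<H> (op d \<Xi>) Z + ip \<H> (op c (op c (op d \<Xi>))) Z"
        using arg_cong[OF sum[OF vector_closed], of "\<lambda>v. ip \<H> v Z"] k Z W.op_closed[OF cb k(3)]
        by (simp add: W.ip_add_left)
      then show "ip \<H> (\<Xi> \<ominus>\<^bsub>\<H>\<^esub> op d \<Xi>) Z = ip \<H> (op c (op d (op c \<Xi>))) Z"
        using k Z comm[OF vector_closed] by (simp add: W.ip_diff_left)
    qed (use k in auto)
    then have "hnorm \<H> (op y \<Xi>) = 2 * hnorm \<H> (op c (op d (op c \<Xi>)))" using opy k by simp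
    also have "\<dots> \<le> hnorm \<H> (op c \<Xi>)" by (rule cdN[OF k(1)])
    also have "hnorm \<H> (op c \<Xi>) = hnorm \<H> (q \<Xi> \<ominus>\<^bsub>\<H>\<^esub> op c \<Xi>)"
      using W.hnorm_minus_commute[of "\<zero>\<^bsub>\<H>\<^esub>" "op c \<Xi>"] k W.diff_zero[OF k(1)] by (simp add: qv)
    also have "\<dots> < e / 2" using app by simp
    finally show ?thesis using e W.diff_zero[OF W.op_closed[OF op_bounded[OF y] vector_closed]] by simp
  qed
  moreover have "hnorm \<H> (op y \<eta> \<ominus>\<^bsub>\<H>\<^esub> \<eta>) < e"
  proof -
    define w where "w = op c \<eta> \<ominus>\<^bsub>\<H>\<^esub> \<eta>"
    have k: "op c \<eta> \<in> carrier \<H>" "op d \<eta> \<in> carrier \<H>" "op c (op d \<eta>) \<in> carrier \<H>"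
      "op c (op c (op d \<eta>)) \<in> carrier \<H>" "w \<in> carrier \<H>" "op d w \<in> carrier \<H>" "op c (op d w) \<in> carrier \<H>"
      using cb db \<eta> by (simp_all add: w_def)
    have dw: "op d w = op c (op d \<eta>) \<ominus>\<^bsub>\<H>\<^esub> op d \<eta>"
      unfolding w_def W.op_diff[OF db k(1) \<eta>] comm[OF \<eta>] ..
    have cdw: "op c (op d w) = op c (op c (op d \<eta>)) \<ominus>\<^bsub>\<H>\<^esub> op c (op d \<eta>)"
      unfolding dw by (rule W.op_diff[OF cb k(3) k(2)])
    \<comment> \<open>On \<eta> the error operator is 1 - 2 d = (c^2 - 1) d, factored as (1 + c) d
      (c - 1) so that c - 1, which is small at \<eta>, acts first.\<close>
    have "op y \<eta> \<ominus>\<^bsub>\<H>\<^esub> \<eta> = op d w \<oplus>\<^bsub>\<H>\<^esub> op c (op d w)"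
    proof (rule W.vec_eqI)
      fix Z assume Z: "Z \<in> carrier \<H>"
      have "ip \<H> \<eta> Z = ip \<H> (op d \<eta>) Z + ip \<H> (op c (op c (op d \<eta>))) Z"
        using arg_cong[OF sum[OF \<eta>], of "\<lambda>v. ip \<H> v Z"] k Z by (simp add: W.ip_add_left)
      then show "ip \<H> (op y \<eta> \<ominus>\<^bsub>\<H>\<^esub> \<eta>) Z = ip \<H> (op d w \<oplus>\<^bsub>\<H>\<^esub> op c (op d w)) Z"
        unfolding opy[OF \<eta>] dw cdw[unfolded dw] using k(1-4) Z \<eta> by (simp add: W.ip_simps)
    qed (use k \<eta> op_bounded[OF y] in auto)
    then have "hnorm \<H> (op y \<eta> \<ominus>\<^bsub>\<H>\<^esub> \<eta>) \<le> hnorm \<H> (op d w) + hnorm \<H> (op c (op d w))"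
      using W.hnorm_triangle[OF k(6,7)] by simp
    also have "\<dots> \<le> 2 * hnorm \<H> w" using dN[OF k(5)] cdN[OF k(5)] W.hnorm_nonneg[OF k(5)] by linarith
    also have "hnorm \<H> w = hnorm \<H> (q \<eta> \<ominus>\<^bsub>\<H>\<^esub> op c \<eta>)"
      unfolding w_def qv using W.hnorm_minus_commute[OF k(1) \<eta>] .
    also have "2 * \<dots> < e" using app by simp
    finally show ?thesis .
  qed
  ultimately show "\<exists>y\<in>linf K M. adj L y = y \<and>
      (\<forall>n. \<forall>v\<in>carrier (K n). hnorm (K n) (y n v) \<le> 4 * hnorm (K n) v) \<and>
      hnorm \<H> (op y \<Xi> \<ominus>\<^bsub>\<H>\<^esub> \<zero>\<^bsub>\<H>\<^esub>) < e \<and> hnorm \<H> (op y \<eta> \<ominus>\<^bsub>\<H>\<^esub> \<eta>) < e"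
    using y by blast
qed (use \<eta> in auto)

text \<open>One step of the approximation: with \<open>U = T / 2\<close> the operator \<open>2 U (1 + U\<^sup>2)\<^sup>-\<^sup>1\<close> differs from \<open>T\<close>
  by at most \<open>1/4\<close> in norm, and it is approximated by \<open>2 u (1 + u\<^sup>2)\<^sup>-\<^sup>1\<close>, which is bounded by \<open>1\<close>
  whatever the norm of \<open>u\<close>.\<close>

lemma contraction_step:
  assumes T: "T \<in> N" "adjoint \<H> T = T" "\<And>V. V \<in> carrier \<H> \<Longrightarrow> hnorm \<H> (T V) \<le> hnorm \<H> V"
  obtains T' where "T' \<in> N" "adjoint \<H> T' = T'" "\<And>V. V \<in> carrier \<H> \<Longrightarrow> hnorm \<H> (T' V) \<le> hnorm \<H> V"
    "\<And>e. e > 0 \<Longrightarrow> \<exists>y\<in>linf K M. adj L y = y \<and>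
      (\<forall>n. \<forall>v\<in>carrier (K n). hnorm (K n) (y n v) \<le> hnorm (K n) v) \<and>
      hnorm \<H> (op y \<Xi> \<ominus>\<^bsub>\<H>\<^esub> (T \<Xi> \<ominus>\<^bsub>\<H>\<^esub> (1/4) \<odot>\<^bsub>\<H>\<^esub> T' \<Xi>)) < e"
proof -
  define U where "U = (1/2) \<odot>\<^bsub>op_algebra \<H>\<^esub> T"
  have Tb: "T \<in> bounded_ops \<H>" using T(1) by simp
  have U: "U \<in> N" unfolding U_def by (rule N.smult_mem[OF T(1)])
  have Ub: "U \<in> bounded_ops \<H>" using U by simp
  have Usa: "adjoint \<H> U = U" using Tb T(2) by (simp add: U_def W.adjoint_smult)
  have UV: "U V = (1/2) \<odot>\<^bsub>\<H>\<^esub> T V" if "V \<in> carrier \<H>" for V using that by (simp add: U_def)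
  have Un: "2 * hnorm \<H> (U V) \<le> hnorm \<H> V" if "V \<in> carrier \<H>" for V
    using T(3)[OF that] UV[OF that] W.op_closed[OF Tb that] by simp
  obtain D where D: "D \<in> N" "adjoint \<H> D = D"
    and sum: "\<And>V. V \<in> carrier \<H> \<Longrightarrow> D V \<oplus>\<^bsub>\<H>\<^esub> U (U (D V)) = V"
    and comm: "\<And>V. V \<in> carrier \<H> \<Longrightarrow> D (U V) = U (D V)"
    and UDn: "\<And>V. V \<in> carrier \<H> \<Longrightarrow> 2 * hnorm \<H> (U (D V)) \<le> hnorm \<H> V"
    by (rule N.resolvent_mem[OF U Usa]) (rule that)
  have Db: "D \<in> bounded_ops \<H>" using D(1) by simp
  \<comment> \<open>T - 2 U D = 2 (U - U D) = 2 U^3 D, and the factor 8 normalizes this remainder to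
    T' / 4: since U and U D have norm at most 1/2, the operator 8 U U (U D) is a
    contraction.\<close>
  define T' where "T' = 8 \<odot>\<^bsub>op_algebra \<H>\<^esub> (U \<oplus>\<^bsub>op_algebra \<H>\<^esub> (-1) \<odot>\<^bsub>op_algebra \<H>\<^esub> (U \<otimes>\<^bsub>op_algebra \<H>\<^esub> D))"
  have T'V: "T' V = 8 \<odot>\<^bsub>\<H>\<^esub> (U V \<ominus>\<^bsub>\<H>\<^esub> U (D V))" if "V \<in> carrier \<H>" for V
    using that Ub Db by (simp add: T'_def W.diff_eq)
  have UVd: "U V \<ominus>\<^bsub>\<H>\<^esub> U (D V) = U (U (U (D V)))" if V: "V \<in> carrier \<H>" for V
  proof -
    have k: "D V \<in> carrier \<H>" "U (D V) \<in> carrier \<H>" "U (U (D V)) \<in> carrier \<H>" using V Ub Db by simp_all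
    have "U (U (D V)) = V \<ominus>\<^bsub>\<H>\<^esub> D V"
    proof (rule W.vec_eqI)
      fix Z assume Z: "Z \<in> carrier \<H>"
      show "ip \<H> (U (U (D V))) Z = ip \<H> (V \<ominus>\<^bsub>\<H>\<^esub> D V) Z"
        using arg_cong[OF sum[OF V], of "\<lambda>v. ip \<H> v Z"] k Z V by (simp add: W.ip_add_left W.ip_diff_left algebra_simps)
    qed (use k V in auto)
    then show ?thesis using W.op_diff[OF Ub V k(1)] by simp
  qed
  show ?thesis
  proof (rule that)
    have UD: "U \<otimes>\<^bsub>op_algebra \<H>\<^esub> D \<in> N" by (rule N.mult_mem[OF U D(1)])
    show "T' \<in> N" unfolding T'_def by (intro N.smult_mem N.add_mem U UD)
    have "D \<otimes>\<^bsub>op_algebra \<H>\<^esub> U = U \<otimes>\<^bsub>op_algebra \<H>\<^esub> D"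
      by (rule W.op_eqI) (use Ub Db comm in auto)
    then show "adjoint \<H> T' = T'"
      using Ub Db Usa D(2) by (simp add: T'_def W.adjoint_smult W.adjoint_add W.adjoint_mult)
    show "hnorm \<H> (T' V) \<le> hnorm \<H> V" if V: "V \<in> carrier \<H>" for V
    proof -
      have k: "U (D V) \<in> carrier \<H>" "U (U (D V)) \<in> carrier \<H>" "U (U (U (D V))) \<in> carrier \<H>" using V Ub Db by simp_all
      have "hnorm \<H> (T' V) = 8 * hnorm \<H> (U (U (U (D V))))"
        using k(3) by (simp add: T'V[OF V] UVd[OF V])
      then show ?thesis using Un[OF k(2)] Un[OF k(1)] UDn[OF V] by linarith
    qed
    fix e :: real assume e: "e > 0"
    \<comment> \<open>u has to be close to U at the vectors met when U D \<Xi> is computed: these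
      are a = D \<Xi> and b = U a, and \<Xi> = a + U b.\<close>
    define a where "a = D \<Xi>"
    define b where "b = U a"
    have ab: "a \<in> carrier \<H>" "b \<in> carrier \<H>" "U b \<in> carrier \<H>" using Ub Db by (simp_all add: a_def b_def)
    have abX: "a \<oplus>\<^bsub>\<H>\<^esub> U b = \<Xi>" unfolding b_def a_def by (rule sum[OF vector_closed])
    have "e / 3 > 0" using e by simp
    then obtain u where u: "u \<in> linf K M" "adj L u = u"
      and app: "\<forall>V\<in>{a, b}. hnorm \<H> (U V \<ominus>\<^bsub>\<H>\<^esub> op u V) < e / 3"
      using selfadjoint_approx[OF U Usa, of "{a, b}" "e / 3"] ab by auto
    obtain d where d: "d \<in> linf K M" "adj L (u \<otimes>\<^bsub>L\<^esub> d) = u \<otimes>\<^bsub>L\<^esub> d"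
      and udn: "\<And>n v. v \<in> carrier (K n) \<Longrightarrow> 2 * hnorm (K n) (u n (d n v)) \<le> hnorm (K n) v"
      and sumd: "\<And>V. V \<in> carrier \<H> \<Longrightarrow> op d V \<oplus>\<^bsub>\<H>\<^esub> op u (op u (op d V)) = V"
      and commd: "\<And>V. V \<in> carrier \<H> \<Longrightarrow> op d (op u V) = op u (op d V)"
      and dN: "\<And>V. V \<in> carrier \<H> \<Longrightarrow> hnorm \<H> (op d V) \<le> hnorm \<H> V"
      and udN: "\<And>V. V \<in> carrier \<H> \<Longrightarrow> 2 * hnorm \<H> (op u (op d V)) \<le> hnorm \<H> V"
      by (rule linf_resolvent[OF u]) (rule that)
    have ub: "op u \<in> bounded_ops \<H>" and db: "op d \<in> bounded_ops \<H>" using u d by simp_all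
    have ud: "u \<otimes>\<^bsub>L\<^esub> d \<in> linf K M" by (rule linf_mult[OF u(1) d(1)])
    define y where "y = 2 \<odot>\<^bsub>L\<^esub> (u \<otimes>\<^bsub>L\<^esub> d)"
    have y: "y \<in> linf K M" unfolding y_def by (rule linf_smult[OF ud])
    have "adj L y = y"
    proof
      fix n
      have "(u \<otimes>\<^bsub>L\<^esub> d) n \<in> bounded_ops (K n)" by (rule A.mem_bounded[OF linf_mem[OF ud]])
      then show "adj L y n = y n"
        using fun_cong[OF d(2), of n] by (simp add: y_def A.adjoint_smult)
    qed
    moreover have "\<forall>n. \<forall>v\<in>carrier (K n). hnorm (K n) (y n v) \<le> hnorm (K n) v"
    proof (intro allI ballI)
      fix n v assume v: "v \<in> carrier (K n)"
      have "u n (d n v) \<in> carrier (K n)"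
        by (intro A.op_closed[OF A.mem_bounded[OF linf_mem[OF u(1)]]] A.op_closed[OF A.mem_bounded[OF linf_mem[OF d(1)]]] v)
      then show "hnorm (K n) (y n v) \<le> hnorm (K n) v" using udn[OF v] v by (simp add: y_def)
    qed
    moreover have "hnorm \<H> (op y \<Xi> \<ominus>\<^bsub>\<H>\<^esub> (T \<Xi> \<ominus>\<^bsub>\<H>\<^esub> (1/4) \<odot>\<^bsub>\<H>\<^esub> T' \<Xi>)) < e"
    proof -
      define f where "f = op u a \<ominus>\<^bsub>\<H>\<^esub> b"
      define g where "g = U b \<ominus>\<^bsub>\<H>\<^esub> op u b"
      have k: "op u a \<in> carrier \<H>" "op u b \<in> carrier \<H>" "f \<in> carrier \<H>" "g \<in> carrier \<H>"
        "op d a \<in> carrier \<H>" "op d b \<in> carrier \<H>" "op d (U b) \<in> carrier \<H>"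
        "op u (op d a) \<in> carrier \<H>" "op u (op d b) \<in> carrier \<H>" "op u (op d (U b)) \<in> carrier \<H>"
        "op u (op u (op d b)) \<in> carrier \<H>" "op d f \<in> carrier \<H>" "op d g \<in> carrier \<H>" "op u (op d g) \<in> carrier \<H>"
        using ab ub db by (simp_all add: f_def g_def)
      have X: "T \<Xi> \<in> carrier \<H>" "U \<Xi> \<in> carrier \<H>" "T' \<Xi> \<in> carrier \<H>" "op y \<Xi> \<in> carrier \<H>"
        using Tb Ub Db y by (simp_all add: T'_def)
      have df: "op d f = op u (op d a) \<ominus>\<^bsub>\<H>\<^esub> op d b"
        unfolding f_def W.op_diff[OF db k(1) ab(2)] commd[OF ab(1)] ..
      have udg: "op u (op d g) = op u (op d (U b)) \<ominus>\<^bsub>\<H>\<^esub> op u (op u (op d b))"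
        unfolding g_def W.op_diff[OF db ab(3) k(2)] commd[OF ab(2)] by (rule W.op_diff[OF ub k(7) k(9)])
      have oy: "op y \<Xi> = 2 \<odot>\<^bsub>\<H>\<^esub> (op u (op d a) \<oplus>\<^bsub>\<H>\<^esub> op u (op d (U b)))"
      proof -
        have "op y \<Xi> = 2 \<odot>\<^bsub>\<H>\<^esub> op u (op d (a \<oplus>\<^bsub>\<H>\<^esub> U b))"
          unfolding y_def op_smult[OF ud] op_mult[OF u(1) d(1)] abX by simp
        then show ?thesis
          using W.op_add[OF db ab(1) ab(3)] W.op_add[OF ub k(5) k(7)] by simp
      qed
      \<comment> \<open>The resolvent identity u d - U D = d (u - U) D + u d (U - u) U D, doubled
        and applied to \<Xi>; it places the differences next to a and b.\<close>
      have "op y \<Xi> \<ominus>\<^bsub>\<H>\<^esub> (T \<Xi> \<ominus>\<^bsub>\<H>\<^esub> (1/4) \<odot>\<^bsub>\<H>\<^esub> T' \<Xi>) = 2 \<odot>\<^bsub>\<H>\<^esub> (op d f \<oplus>\<^bsub>\<H>\<^esub> op u (op d g))"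
      proof (rule W.vec_eqI)
        fix Z assume Z: "Z \<in> carrier \<H>"
        have "ip \<H> b Z = ip \<H> (op d b) Z + ip \<H> (op u (op u (op d b))) Z"
          using arg_cong[OF sumd[OF ab(2)], of "\<lambda>v. ip \<H> v Z"] k Z by (simp add: W.ip_add_left)
        moreover have T'Z: "ip \<H> (T' \<Xi>) Z = 8 * (ip \<H> (U \<Xi>) Z - ip \<H> b Z)"
          using T'V[OF vector_closed] X Z ab by (simp add: a_def[symmetric] b_def[symmetric] W.ip_scale_left W.ip_diff_left)
        moreover have "ip \<H> (U \<Xi>) Z = 1/2 * ip \<H> (T \<Xi>) Z"
          using UV[OF vector_closed] X Z by (simp add: W.ip_scale_left)
        ultimately have "ip \<H> (T' \<Xi>) Z =
            4 * (ip \<H> (T \<Xi>) Z - 2 * ip \<H> (op d b) Z - 2 * ip \<H> (op u (op u (op d b))) Z)"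
          by (simp add: algebra_simps)
        then have e1: "ip \<H> (T' \<Xi>) Z / 4 =
            ip \<H> (T \<Xi>) Z - 2 * ip \<H> (op d b) Z - 2 * ip \<H> (op u (op u (op d b))) Z"
          by simp
        show "ip \<H> (op y \<Xi> \<ominus>\<^bsub>\<H>\<^esub> (T \<Xi> \<ominus>\<^bsub>\<H>\<^esub> (1/4) \<odot>\<^bsub>\<H>\<^esub> T' \<Xi>)) Z =
            ip \<H> (2 \<odot>\<^bsub>\<H>\<^esub> (op d f \<oplus>\<^bsub>\<H>\<^esub> op u (op d g))) Z"
          using oy X k Z unfolding df udg
          by (simp add: W.ip_diff_left W.ip_add_left W.ip_scale_left e1 algebra_simps)
      qed (use X k in auto)
      then have "hnorm \<H> (op y \<Xi> \<ominus>\<^bsub>\<H>\<^esub> (T \<Xi> \<ominus>\<^bsub>\<H>\<^esub> (1/4) \<odot>\<^bsub>\<H>\<^esub> T' \<Xi>))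
          = 2 * hnorm \<H> (op d f \<oplus>\<^bsub>\<H>\<^esub> op u (op d g))" using k by simp
      also have "\<dots> \<le> 2 * (hnorm \<H> (op d f) + hnorm \<H> (op u (op d g)))"
        using W.hnorm_triangle[OF k(12) k(14)] by simp
      also have "\<dots> \<le> 2 * hnorm \<H> f + hnorm \<H> g" using dN[OF k(3)] udN[OF k(4)] by simp
      also have "hnorm \<H> f = hnorm \<H> (U a \<ominus>\<^bsub>\<H>\<^esub> op u a)"
        unfolding f_def b_def by (rule W.hnorm_minus_commute) (use k ab in \<open>simp_all add: b_def\<close>)
      also have "2 * hnorm \<H> (U a \<ominus>\<^bsub>\<H>\<^esub> op u a) + hnorm \<H> g < 2 * (e / 3) + e / 3"
        using app unfolding g_def by (intro add_strict_mono mult_strict_left_mono) auto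
      also have "\<dots> = e" by simp
      finally show ?thesis .
    qed
    ultimately show "\<exists>y\<in>linf K M. adj L y = y \<and>
      (\<forall>n. \<forall>v\<in>carrier (K n). hnorm (K n) (y n v) \<le> hnorm (K n) v) \<and>
      hnorm \<H> (op y \<Xi> \<ominus>\<^bsub>\<H>\<^esub> (T \<Xi> \<ominus>\<^bsub>\<H>\<^esub> (1/4) \<odot>\<^bsub>\<H>\<^esub> T' \<Xi>)) < e"
      using y by blast
  qed
qed

text \<open>The remainder T' / 4 of one step is approximated in turn, which divides the error by 4
  each time; the zero sequence starts the induction since \<parallel>T \<Xi>\<parallel> \<le> 1. The
  bound 2 is stable under the recursion because 1 + 2/4 \<le> 2, so it does not depend on m.\<close>

lemma contraction_approx:
  assumes "T \<in> N" "adjoint \<H> T = T" "\<And>V. V \<in> carrier \<H> \<Longrightarrow> hnorm \<H> (T V) \<le> hnorm \<H> V" "e > 0"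
  shows "\<exists>y\<in>linf K M. adj L y = y \<and>
      (\<forall>n. \<forall>v\<in>carrier (K n). hnorm (K n) (y n v) \<le> 2 * hnorm (K n) v) \<and>
      hnorm \<H> (op y \<Xi> \<ominus>\<^bsub>\<H>\<^esub> T \<Xi>) < (1/4) ^ m + e"
  using assms
proof (induction m arbitrary: T e)
  case 0
  define y where "y = 0 \<odot>\<^bsub>L\<^esub> \<one>\<^bsub>L\<^esub>"
  have y: "y \<in> linf K M" unfolding y_def by (rule linf_smult[OF linf_one])
  have "adj L y = y" by (auto simp: y_def fun_eq_iff A.adjoint_smult)
  moreover have "hnorm (K n) (y n v) \<le> 2 * hnorm (K n) v" if "v \<in> carrier (K n)" for n v
    using that by (simp add: y_def)
  moreover have "hnorm \<H> (op y \<Xi> \<ominus>\<^bsub>\<H>\<^esub> T \<Xi>) < (1/4) ^ 0 + e"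
  proof -
    have TX: "T \<Xi> \<in> carrier \<H>" using 0 by simp
    have "op y \<Xi> = \<zero>\<^bsub>\<H>\<^esub>" unfolding y_def op_smult[OF linf_one] op_one by simp
    then have "hnorm \<H> (op y \<Xi> \<ominus>\<^bsub>\<H>\<^esub> T \<Xi>) = hnorm \<H> (T \<Xi>)"
      using W.hnorm_minus_commute[OF W.M.zero_closed TX] W.diff_zero[OF TX] by simp
    then show ?thesis using "0.prems"(3)[OF vector_closed] "0.prems"(4) hnorm_ultra_vector by simp
  qed
  ultimately show ?case using y by blast
next
  case (Suc m)
  obtain T' where T': "T' \<in> N" "adjoint \<H> T' = T'" "\<And>V. V \<in> carrier \<H> \<Longrightarrow> hnorm \<H> (T' V) \<le> hnorm \<H> V"
    and step: "\<And>e. e > 0 \<Longrightarrow> \<exists>y\<in>linf K M. adj L y = y \<and>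
      (\<forall>n. \<forall>v\<in>carrier (K n). hnorm (K n) (y n v) \<le> hnorm (K n) v) \<and>
      hnorm \<H> (op y \<Xi> \<ominus>\<^bsub>\<H>\<^esub> (T \<Xi> \<ominus>\<^bsub>\<H>\<^esub> (1/4) \<odot>\<^bsub>\<H>\<^esub> T' \<Xi>)) < e"
    by (rule contraction_step[OF Suc.prems(1-3)], assumption) (rule that)
  have "e / 2 > 0" using Suc.prems(4) by simp
  from step[OF this] obtain y0 where y0: "y0 \<in> linf K M" "adj L y0 = y0"
    "\<forall>n. \<forall>v\<in>carrier (K n). hnorm (K n) (y0 n v) \<le> hnorm (K n) v"
    "hnorm \<H> (op y0 \<Xi> \<ominus>\<^bsub>\<H>\<^esub> (T \<Xi> \<ominus>\<^bsub>\<H>\<^esub> (1/4) \<odot>\<^bsub>\<H>\<^esub> T' \<Xi>)) < e / 2" by blast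
  from Suc.IH[OF T' Suc.prems(4)] obtain y1 where y1: "y1 \<in> linf K M" "adj L y1 = y1"
    "\<forall>n. \<forall>v\<in>carrier (K n). hnorm (K n) (y1 n v) \<le> 2 * hnorm (K n) v"
    "hnorm \<H> (op y1 \<Xi> \<ominus>\<^bsub>\<H>\<^esub> T' \<Xi>) < (1/4) ^ m + e" by blast
  define y where "y = y0 \<oplus>\<^bsub>L\<^esub> (1/4) \<odot>\<^bsub>L\<^esub> y1"
  have q: "(1/4) \<odot>\<^bsub>L\<^esub> y1 \<in> linf K M" by (rule linf_smult[OF y1(1)])
  have y: "y \<in> linf K M" unfolding y_def by (rule linf_add[OF y0(1) q])
  have b: "y0 n \<in> bounded_ops (K n)" "y1 n \<in> bounded_ops (K n)" for n
    using A.mem_bounded[OF linf_mem[OF y0(1)]] A.mem_bounded[OF linf_mem[OF y1(1)]] by auto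
  have "adj L y = y"
  proof
    fix n show "adj L y n = y n"
      using b[of n] fun_cong[OF y0(2), of n] fun_cong[OF y1(2), of n]
      by (simp add: y_def A.adjoint_add A.adjoint_smult)
  qed
  moreover have "\<forall>n. \<forall>v\<in>carrier (K n). hnorm (K n) (y n v) \<le> 2 * hnorm (K n) v"
  proof (intro allI ballI)
    fix n v assume v: "v \<in> carrier (K n)"
    have k: "y0 n v \<in> carrier (K n)" "y1 n v \<in> carrier (K n)" using A.op_closed[OF b(1) v] A.op_closed[OF b(2) v] by auto
    have "hnorm (K n) (y n v) \<le> hnorm (K n) (y0 n v) + hnorm (K n) ((1/4) \<odot>\<^bsub>K n\<^esub> y1 n v)"
      using A.hnorm_triangle[OF k(1) A.scale_closed[OF k(2)]] v by (simp add: y_def)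
    also have "hnorm (K n) ((1/4) \<odot>\<^bsub>K n\<^esub> y1 n v) = 1/4 * hnorm (K n) (y1 n v)" using k by simp
    finally have "hnorm (K n) (y n v) \<le> hnorm (K n) (y0 n v) + 1/4 * hnorm (K n) (y1 n v)" .
    moreover have "hnorm (K n) (y0 n v) \<le> hnorm (K n) v" "hnorm (K n) (y1 n v) \<le> 2 * hnorm (K n) v"
      using y0(3) y1(3) v by auto
    ultimately show "hnorm (K n) (y n v) \<le> 2 * hnorm (K n) v" using A.hnorm_nonneg[OF v] by linarith
  qed
  moreover have "hnorm \<H> (op y \<Xi> \<ominus>\<^bsub>\<H>\<^esub> T \<Xi>) < (1/4) ^ Suc m + e"
  proof -
    define f where "f = op y0 \<Xi> \<ominus>\<^bsub>\<H>\<^esub> (T \<Xi> \<ominus>\<^bsub>\<H>\<^esub> (1/4) \<odot>\<^bsub>\<H>\<^esub> T' \<Xi>)"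
    define g where "g = op y1 \<Xi> \<ominus>\<^bsub>\<H>\<^esub> T' \<Xi>"
    have X: "T \<Xi> \<in> carrier \<H>" "T' \<Xi> \<in> carrier \<H>" "op y0 \<Xi> \<in> carrier \<H>" "op y1 \<Xi> \<in> carrier \<H>"
      using Suc.prems(1) T'(1) y0(1) y1(1) by simp_all
    have fg: "f \<in> carrier \<H>" "g \<in> carrier \<H>" using X by (simp_all add: f_def g_def)
    have oy: "op y \<Xi> = op y0 \<Xi> \<oplus>\<^bsub>\<H>\<^esub> (1/4) \<odot>\<^bsub>\<H>\<^esub> op y1 \<Xi>"
      unfolding y_def op_add[OF y0(1) q] op_smult[OF y1(1)] by simp
    have "op y \<Xi> \<ominus>\<^bsub>\<H>\<^esub> T \<Xi> = f \<oplus>\<^bsub>\<H>\<^esub> (1/4) \<odot>\<^bsub>\<H>\<^esub> g"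
      unfolding oy f_def g_def by (rule W.vec_eqI) (use X in \<open>simp_all add: W.ip_simps algebra_simps\<close>)
    then have "hnorm \<H> (op y \<Xi> \<ominus>\<^bsub>\<H>\<^esub> T \<Xi>) \<le> hnorm \<H> f + 1/4 * hnorm \<H> g"
      using W.hnorm_triangle[OF fg(1) W.scale_closed[OF fg(2), of "1/4"]] fg by simp
    also have "\<dots> < e / 2 + 1/4 * ((1/4) ^ m + e)"
      using y0(4) y1(4) unfolding f_def g_def by (intro add_strict_mono mult_strict_left_mono) auto
    also have "\<dots> \<le> (1/4) ^ Suc m + e" using Suc.prems(4) by (simp add: field_simps)
    finally show ?thesis .
  qed
  ultimately show ?case using y by blast
qed

lemma lift_selfadjoint:
  assumes T: "T \<in> N" "adjoint \<H> T = T"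
  shows "\<exists>x\<in>linf K M. adj L x = x \<and> op x \<Xi> = T \<Xi>"
proof -
  have Tb: "T \<in> bounded_ops \<H>" using T by simp
  obtain C where C: "C > 0" "\<And>V. V \<in> carrier \<H> \<Longrightarrow> hnorm \<H> (T V) \<le> C * hnorm \<H> V"
    using W.op_bound[OF Tb] by blast
  \<comment> \<open>Dividing by a bound of T reduces to contractions; z undoes this at the
    end.\<close>
  define S where "S = complex_of_real (1 / C) \<odot>\<^bsub>op_algebra \<H>\<^esub> T"
  have S: "S \<in> N" unfolding S_def by (rule N.smult_mem[OF T(1)])
  have Ssa: "adjoint \<H> S = S" using Tb T(2) by (simp add: S_def W.adjoint_smult)
  have SV: "S V = complex_of_real (1 / C) \<odot>\<^bsub>\<H>\<^esub> T V" if "V \<in> carrier \<H>" for V using that by (simp add: S_def)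
  have Sn: "hnorm \<H> (S V) \<le> hnorm \<H> V" if V: "V \<in> carrier \<H>" for V
  proof -
    have "hnorm \<H> (S V) = 1 / C * hnorm \<H> (T V)"
      unfolding SV[OF V] using W.hnorm_scale[OF W.op_closed[OF Tb V]] C(1) by (simp add: norm_divide)
    then have "C * hnorm \<H> (S V) \<le> C * hnorm \<H> V" using C(2)[OF V] C(1) by simp
    then show ?thesis using C(1) by simp
  qed
  \<comment> \<open>Only one vector has to be matched, so it fills both slots of
    \<open>lift_vectors\<close>.\<close>
  have "\<exists>x\<in>linf K M. adj L x = x \<and> op x \<Xi> = S \<Xi> \<and> op x \<Xi> = S \<Xi>"
  proof (rule lift_vectors[where C = 2])
    fix e :: real assume "e > 0"
    then have e: "e / 2 > 0" by simp
    then obtain m where m: "(1/4) ^ m < e / 2" using real_arch_pow_inv[of "e / 2" "1/4"] by auto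
    show "\<exists>y\<in>linf K M. adj L y = y \<and>
        (\<forall>n. \<forall>v\<in>carrier (K n). hnorm (K n) (y n v) \<le> 2 * hnorm (K n) v) \<and>
        hnorm \<H> (op y \<Xi> \<ominus>\<^bsub>\<H>\<^esub> S \<Xi>) < e \<and> hnorm \<H> (op y \<Xi> \<ominus>\<^bsub>\<H>\<^esub> S \<Xi>) < e"
      using contraction_approx[OF S Ssa Sn e, of m] m by fastforce
  qed (use S in auto)
  then obtain x where x: "x \<in> linf K M" "adj L x = x" "op x \<Xi> = S \<Xi>" by blast
  define z where "z = complex_of_real C \<odot>\<^bsub>L\<^esub> x"
  have z: "z \<in> linf K M" unfolding z_def by (rule linf_smult[OF x(1)])
  have "adj L z = z"
  proof
    fix n show "adj L z n = z n"
      using A.mem_bounded[OF linf_mem[OF x(1)]] fun_cong[OF x(2), of n] by (simp add: z_def A.adjoint_smult)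
  qed
  moreover have "op z \<Xi> = T \<Xi>"
    unfolding z_def op_smult[OF x(1)] using C(1) x(3) SV[OF vector_closed] W.op_closed[OF Tb vector_closed]
    by (simp add: W.scale_scale)
  ultimately show ?thesis using z by blast
qed

text \<open>Real and imaginary parts are lifted separately. As x1 and x2 are self-adjoint, x1 - \<i>
  x2 is the adjoint of x1 + \<i> x2, so matching both parts at \<Xi> matches T and its adjoint
  together.\<close>

lemma lift_operator:
  assumes T: "T \<in> N"
  shows "\<exists>x\<in>linf K M. op x \<Xi> = T \<Xi> \<and> adjoint \<H> (op x) \<Xi> = adjoint \<H> T \<Xi>"
proof -
  let ?B = "op_algebra \<H>"
  have Tb: "T \<in> bounded_ops \<H>" using T by simp
  define T\<^sub>1 where "T\<^sub>1 = (1/2) \<odot>\<^bsub>?B\<^esub> (T \<oplus>\<^bsub>?B\<^esub> adjoint \<H> T)"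
  define T\<^sub>2 where "T\<^sub>2 = (- \<i> / 2) \<odot>\<^bsub>?B\<^esub> (T \<oplus>\<^bsub>?B\<^esub> (-1) \<odot>\<^bsub>?B\<^esub> adjoint \<H> T)"
  have T1: "T\<^sub>1 \<in> N" and T2: "T\<^sub>2 \<in> N"
    unfolding T\<^sub>1_def T\<^sub>2_def by (intro N.smult_mem N.add_mem T N.adjoint_mem)+
  have s1: "adjoint \<H> T\<^sub>1 = T\<^sub>1"
    by (rule W.op_eqI) (use Tb in \<open>auto simp: T\<^sub>1_def W.adjoint_smult W.adjoint_add W.M.a_comm\<close>)
  have s2: "adjoint \<H> T\<^sub>2 = T\<^sub>2"
  proof (rule W.op_eqI)
    fix V assume V: "V \<in> carrier \<H>"
    show "adjoint \<H> T\<^sub>2 V = T\<^sub>2 V"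
      by (rule W.vec_eqI)
        (use V Tb in \<open>simp_all add: T\<^sub>2_def W.adjoint_smult W.adjoint_add W.ip_add_left W.ip_scale_left algebra_simps\<close>)
  qed (use Tb in \<open>simp_all add: T\<^sub>2_def\<close>)
  obtain x1 where x1: "x1 \<in> linf K M" "adj L x1 = x1" "op x1 \<Xi> = T\<^sub>1 \<Xi>" using lift_selfadjoint[OF T1 s1] by blast
  obtain x2 where x2: "x2 \<in> linf K M" "adj L x2 = x2" "op x2 \<Xi> = T\<^sub>2 \<Xi>" using lift_selfadjoint[OF T2 s2] by blast
  have a1: "adjoint \<H> (op x1) = op x1" and a2: "adjoint \<H> (op x2) = op x2"
    using op_adj[OF x1(1)] op_adj[OF x2(1)] x1(2) x2(2) by simp_all
  define x where "x = x1 \<oplus>\<^bsub>L\<^esub> \<i> \<odot>\<^bsub>L\<^esub> x2"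
  have ix: "\<i> \<odot>\<^bsub>L\<^esub> x2 \<in> linf K M" by (rule linf_smult[OF x2(1)])
  have x: "x \<in> linf K M" unfolding x_def by (rule linf_add[OF x1(1) ix])
  have ox: "op x = op x1 \<oplus>\<^bsub>?B\<^esub> \<i> \<odot>\<^bsub>?B\<^esub> op x2"
    unfolding x_def op_add[OF x1(1) ix] op_smult[OF x2(1)] ..
  have ob: "op x1 \<in> bounded_ops \<H>" "op x2 \<in> bounded_ops \<H>" using x1 x2 by simp_all
  have k: "T \<Xi> \<in> carrier \<H>" "adjoint \<H> T \<Xi> \<in> carrier \<H>" using Tb by simp_all
  have "op x \<Xi> = T\<^sub>1 \<Xi> \<oplus>\<^bsub>\<H>\<^esub> \<i> \<odot>\<^bsub>\<H>\<^esub> T\<^sub>2 \<Xi>" unfolding ox using x1(3) x2(3) by simp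
  also have "\<dots> = T \<Xi>"
    by (rule W.vec_eqI) (use k in \<open>simp_all add: T\<^sub>1_def T\<^sub>2_def W.ip_add_left W.ip_scale_left algebra_simps\<close>)
  finally have "op x \<Xi> = T \<Xi>" .
  moreover have "adjoint \<H> (op x) \<Xi> = T\<^sub>1 \<Xi> \<oplus>\<^bsub>\<H>\<^esub> (-\<i>) \<odot>\<^bsub>\<H>\<^esub> T\<^sub>2 \<Xi>"
    unfolding ox using ob x1(3) x2(3) by (simp add: W.adjoint_add W.adjoint_smult a1 a2)
  moreover have "T\<^sub>1 \<Xi> \<oplus>\<^bsub>\<H>\<^esub> (-\<i>) \<odot>\<^bsub>\<H>\<^esub> T\<^sub>2 \<Xi> = adjoint \<H> T \<Xi>"
    by (rule W.vec_eqI) (use k in \<open>simp_all add: T\<^sub>1_def T\<^sub>2_def W.ip_add_left W.ip_scale_left algebra_simps\<close>)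
  ultimately show ?thesis using x by auto
qed

end

section \<open>The Ocneanu ultraproduct as a corner\<close>

lemma carrier_quotient_star_algebra:
  "carrier (quotient_star_algebra A I) = (\<lambda>x. I +>\<^bsub>A\<^esub> x) ` carrier A"
  by (auto simp: quotient_star_algebra_def FactRing_def A_RCOSETS_def' a_r_coset_def')

context gns_sequence
begin

text \<open>Unfolding \<open>(x \<otimes> y) n\<close> below the binder hidden in \<open>op\<close> would destroy the left-hand side of \<open>op_mult\<close>
  and its companions.\<close>

declare linf_algebra_simps(2-) [simp del]

abbreviation \<I> :: "(nat \<Rightarrow> 'k \<Rightarrow> 'k) set" where "\<I> \<equiv> ocneanu_ideal \<omega> K M \<phi>"

abbreviation \<M> :: "(nat \<Rightarrow> 'k \<Rightarrow> 'k) set" where "\<M> \<equiv> ocneanu_multiplier \<omega> K M \<phi>"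

abbreviation vector_state :: "((nat \<Rightarrow> 'h) set \<Rightarrow> (nat \<Rightarrow> 'h) set) \<Rightarrow> complex" where
  "vector_state \<equiv> (\<lambda>T. ip \<H> (T \<Xi>) \<Xi>)"

abbreviation p :: "(nat \<Rightarrow> 'h) set \<Rightarrow> (nat \<Rightarrow> 'h) set" where
  "p \<equiv> support_projection \<H> N vector_state"

abbreviation corner :: "((nat \<Rightarrow> 'h) set \<Rightarrow> (nat \<Rightarrow> 'h) set) star_algebra" where
  "corner \<equiv> reduced_algebra \<H> N p"

text \<open>The definite description p is identified with the projection constructed before; the
  facts collected here are all that is used about p afterwards.\<close>

lemma support:
  shows p_support: "is_support_projection \<H> N vector_state p"
    and p_mem [simp]: "p \<in> N"
    and p_adjoint [simp]: "adjoint \<H> p = p"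
    and p_idem: "V \<in> carrier \<H> \<Longrightarrow> p (p V) = p V"
    and p_vector [simp]: "p \<Xi> = \<Xi>"
    and p_annihilates: "\<lbrakk>T \<in> N; T \<Xi> = \<zero>\<^bsub>\<H>\<^esub>; V \<in> carrier \<H>\<rbrakk> \<Longrightarrow> T (p V) = \<zero>\<^bsub>\<H>\<^esub>"
proof -
  obtain e where e: "is_support_projection \<H> N vector_state e" "e \<in> N" "adjoint \<H> e = e"
    "\<And>x. x \<in> carrier \<H> \<Longrightarrow> e (e x) = e x" "e \<Xi> = \<Xi>"
    "\<And>T x. \<lbrakk>T \<in> N; T \<Xi> = \<zero>\<^bsub>\<H>\<^esub>; x \<in> carrier \<H>\<rbrakk> \<Longrightarrow> T (e x) = \<zero>\<^bsub>\<H>\<^esub>"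
    by (rule N.vector_support_projection[OF vector_closed]) (rule that)
  have "p = e" by (rule N.support_projection_eq[OF e(1)])
  then show "is_support_projection \<H> N vector_state p" "p \<in> N" "adjoint \<H> p = p"
    "V \<in> carrier \<H> \<Longrightarrow> p (p V) = p V" "p \<Xi> = \<Xi>"
    "\<lbrakk>T \<in> N; T \<Xi> = \<zero>\<^bsub>\<H>\<^esub>; V \<in> carrier \<H>\<rbrakk> \<Longrightarrow> T (p V) = \<zero>\<^bsub>\<H>\<^esub>"
    using e by simp_all
qed

lemma p_bounded [simp]: "p \<in> bounded_ops \<H>"
  by (rule N.mem_bounded[OF p_mem])

lemma p_closed [simp]: "V \<in> carrier \<H> \<Longrightarrow> p V \<in> carrier \<H>"
  by (rule W.op_closed[OF p_bounded])

lemma op_closed_ultra [simp]: "\<lbrakk>x \<in> linf K M; V \<in> carrier \<H>\<rbrakk> \<Longrightarrow> op x V \<in> carrier \<H>"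
  by (rule W.op_closed[OF op_bounded])

lemma normal_vector_state: "normal_state \<H> N vector_state"
  unfolding normal_state_def
proof
  have TX: "T \<Xi> \<in> carrier \<H>" if "T \<in> N" for T using W.op_closed[OF N.mem_bounded[OF that]] by simp
  have "ip \<H> \<Xi> \<Xi> = 1" using W.ip_self[OF vector_closed] hnorm_ultra_vector by simp
  then show "state \<H> N vector_state"
    unfolding state_def positive_op_def using TX by (auto simp: W.ip_add_left W.ip_scale_left)
  \<comment> \<open>A square-summable family with a single nonzero member represents the vector
    functional.\<close>
  define f where "f k = (if k = 0 then \<Xi> else \<zero>\<^bsub>\<H>\<^esub>)" for k :: nat
  have f: "f k \<in> carrier \<H>" for k by (simp add: f_def)
  have "(\<lambda>k. (hnorm \<H> (f k))\<^sup>2) = (\<lambda>k. if k = 0 then 1 else 0)"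
    by (auto simp: f_def hnorm_ultra_vector fun_eq_iff)
  then have "summable (\<lambda>k. (hnorm \<H> (f k))\<^sup>2)" by simp
  moreover have "(\<lambda>k. ip \<H> (T (f k)) (f k)) sums ip \<H> (T \<Xi>) \<Xi>" if T: "T \<in> N" for T
  proof -
    have "(\<lambda>k. ip \<H> (T (f k)) (f k)) = (\<lambda>k. if k = 0 then ip \<H> (T \<Xi>) \<Xi> else 0)"
      using W.op_closed[OF N.mem_bounded[OF T]] by (auto simp: f_def fun_eq_iff)
    then show ?thesis using sums_single[of 0 "\<lambda>_. ip \<H> (T \<Xi>) \<Xi>"] by simp
  qed
  ultimately show "in_predual \<H> N vector_state"
    unfolding in_predual_def using f by (intro exI[of _ f]) auto
qed

lemma ideal_iff:
  assumes x: "x \<in> linf K M"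
  shows "x \<in> \<I> \<longleftrightarrow> op x \<Xi> = \<zero>\<^bsub>\<H>\<^esub> \<and> adjoint \<H> (op x) \<Xi> = \<zero>\<^bsub>\<H>\<^esub>"
proof -
  let ?s = "\<lambda>n. sharp_norm (K n) (\<phi> n) (x n)"
  let ?a = "hnorm \<H> (op x \<Xi>)" and ?b = "hnorm \<H> (op (adj L x) \<Xi>)"
  have k: "op x \<Xi> \<in> carrier \<H>" "op (adj L x) \<Xi> \<in> carrier \<H>" using x linf_adj[OF x] by simp_all
  have s: "?s n = sqrt ((hnorm (H n) (\<pi> n (x n) (\<xi> n)))\<^sup>2 + (hnorm (H n) (\<pi> n (adj L x n) (\<xi> n)))\<^sup>2)" for n
  proof -
    let ?B = "op_algebra (K n)"
    have xM: "x n \<in> M n" by (rule linf_mem[OF x])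
    have "adjoint (K n) (x n) \<otimes>\<^bsub>?B\<^esub> x n \<in> M n" "x n \<otimes>\<^bsub>?B\<^esub> adjoint (K n) (x n) \<in> M n"
      using xM by (intro A.mult_mem A.adjoint_mem; assumption)+
    then have "\<phi> n (adjoint (K n) (x n) \<otimes>\<^bsub>?B\<^esub> x n \<oplus>\<^bsub>?B\<^esub> x n \<otimes>\<^bsub>?B\<^esub> adjoint (K n) (x n)) =
        \<phi> n (adjoint (K n) (x n) \<otimes>\<^bsub>?B\<^esub> x n) + \<phi> n (x n \<otimes>\<^bsub>?B\<^esub> adjoint (K n) (x n))"
      using state[of n] by (simp add: state_def)
    also have "\<phi> n (x n \<otimes>\<^bsub>?B\<^esub> adjoint (K n) (x n)) = of_real ((hnorm (H n) (\<pi> n (adj L x n) (\<xi> n)))\<^sup>2)"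
      using state_square[OF A.adjoint_mem[OF xM]] A.adjoint_adjoint[OF A.mem_bounded[OF xM]]
      by (simp add: linf_algebra_simps)
    also have "\<phi> n (adjoint (K n) (x n) \<otimes>\<^bsub>?B\<^esub> x n) = of_real ((hnorm (H n) (\<pi> n (x n) (\<xi> n)))\<^sup>2)"
      by (rule state_square[OF xM])
    finally show ?thesis by (simp add: sharp_norm_def linf_algebra_simps)
  qed
  have "((\<lambda>n. hnorm (H n) (\<pi> n (y n) (\<xi> n))) \<longlongrightarrow> hnorm \<H> (op y \<Xi>)) \<omega>" if y: "y \<in> linf K M" for y
    unfolding op_apply[OF y vector_seq] by (rule hnorm_ultra_tendsto[OF rep_bounded_seq[OF y vector_seq]])
  \<comment> \<open>The sharp norms converge for every bounded sequence, so membership in the ideal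
    only asks for the value of the limit.\<close>
  then have lim: "(?s \<longlongrightarrow> sqrt (?a\<^sup>2 + ?b\<^sup>2)) \<omega>"
    unfolding s using x linf_adj[OF x] by (intro tendsto_intros) auto
  have "(?s \<longlongrightarrow> 0) \<omega> \<longleftrightarrow> sqrt (?a\<^sup>2 + ?b\<^sup>2) = 0"
  proof
    assume "(?s \<longlongrightarrow> 0) \<omega>"
    then show "sqrt (?a\<^sup>2 + ?b\<^sup>2) = 0" by (rule ulim_unique[OF lim])
  qed (use lim in simp)
  also have "\<dots> \<longleftrightarrow> ?a = 0 \<and> ?b = 0" by (simp add: sum_power2_eq_zero_iff)
  also have "\<dots> \<longleftrightarrow> op x \<Xi> = \<zero>\<^bsub>\<H>\<^esub> \<and> adjoint \<H> (op x) \<Xi> = \<zero>\<^bsub>\<H>\<^esub>"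
    using W.hnorm_eq_0[OF k(1)] W.hnorm_eq_0[OF k(2)] by (simp only: op_adj[OF x])
  finally show ?thesis using x by (simp add: ocneanu_ideal_def)
qed

lemma ideal_linf: "x \<in> \<I> \<Longrightarrow> x \<in> linf K M"
  by (simp add: ocneanu_ideal_def)

definition commutes_p :: "(nat \<Rightarrow> 'k \<Rightarrow> 'k) \<Rightarrow> bool" where
  "commutes_p x \<longleftrightarrow> x \<in> linf K M \<and> p \<otimes>\<^bsub>op_algebra \<H>\<^esub> op x = op x \<otimes>\<^bsub>op_algebra \<H>\<^esub> p"

lemma commutes_pD:
  assumes "commutes_p x"
  shows "x \<in> linf K M" "V \<in> carrier \<H> \<Longrightarrow> p (op x V) = op x (p V)"
    "V \<in> carrier \<H> \<Longrightarrow> p (adjoint \<H> (op x) V) = adjoint \<H> (op x) (p V)"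
proof -
  show x: "x \<in> linf K M" using assms by (simp add: commutes_p_def)
  have eq: "p \<otimes>\<^bsub>op_algebra \<H>\<^esub> op x = op x \<otimes>\<^bsub>op_algebra \<H>\<^esub> p" using assms by (simp add: commutes_p_def)
  show "V \<in> carrier \<H> \<Longrightarrow> p (op x V) = op x (p V)" using fun_cong[OF eq, of V] by simp
  have "adjoint \<H> (op x) \<otimes>\<^bsub>op_algebra \<H>\<^esub> p = p \<otimes>\<^bsub>op_algebra \<H>\<^esub> adjoint \<H> (op x)"
    using arg_cong[OF eq, of "adjoint \<H>"] x by (simp add: W.adjoint_mult)
  from fun_cong[OF this, of V]
  show "V \<in> carrier \<H> \<Longrightarrow> p (adjoint \<H> (op x) V) = adjoint \<H> (op x) (p V)" by simp
qed

lemma commutes_pI: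
  assumes x: "x \<in> linf K M" and "\<And>V. V \<in> carrier \<H> \<Longrightarrow> p (op x V) = op x (p V)"
  shows "commutes_p x"
  unfolding commutes_p_def by (intro conjI x W.op_eqI) (use assms in auto)

text \<open>If \<open>x\<close> multiplies the ideal and \<open>T\<close> is \<open>op x\<close> or its adjoint, then \<open>T p = p T p\<close>: a vector
  \<open>\<eta> = (1 - p) T p V\<close> is fixed by some self-adjoint \<open>y\<close> in the ideal, and \<open>y T p = 0\<close>.\<close>

lemma corner_vector_eq_zero:
  assumes T: "T \<in> N" and V: "V \<in> carrier \<H>"
    and ann: "\<And>y. \<lbrakk>y \<in> \<I>; adj L y = y\<rbrakk> \<Longrightarrow> op y (T \<Xi>) = \<zero>\<^bsub>\<H>\<^esub>"
  shows "p (T (p V)) = T (p V)"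
proof -
  have Tb: "T \<in> bounded_ops \<H>" using T by simp
  define q where "q = \<one>\<^bsub>op_algebra \<H>\<^esub> \<oplus>\<^bsub>op_algebra \<H>\<^esub> (-1) \<odot>\<^bsub>op_algebra \<H>\<^esub> p"
  have q: "q \<in> N" unfolding q_def by (intro N.add_mem N.one_mem N.smult_mem p_mem)
  have qsa: "adjoint \<H> q = q" by (simp add: q_def W.adjoint_add W.adjoint_smult)
  have qV: "q V = V \<ominus>\<^bsub>\<H>\<^esub> p V" if "V \<in> carrier \<H>" for V using that by (simp add: q_def W.diff_eq)
  define w where "w = T (p V)"
  have w: "w \<in> carrier \<H>" using Tb V by (simp add: w_def)
  define \<eta> where "\<eta> = w \<ominus>\<^bsub>\<H>\<^esub> p w"
  have \<eta>: "\<eta> \<in> carrier \<H>" using w by (simp add: \<eta>_def)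
  have p\<eta>: "p \<eta> = \<zero>\<^bsub>\<H>\<^esub>"
    unfolding \<eta>_def W.op_diff[OF p_bounded w p_closed[OF w]] using w by (simp add: p_idem del: W.M.minus_closed)
  have "q \<Xi> = \<zero>\<^bsub>\<H>\<^esub>" using qV[OF vector_closed] by simp
  moreover have "q \<eta> = \<eta>" using qV[OF \<eta>] p\<eta> W.diff_zero[OF \<eta>] by simp
  ultimately obtain y where y: "y \<in> linf K M" "adj L y = y" "op y \<Xi> = \<zero>\<^bsub>\<H>\<^esub>" "op y \<eta> = \<eta>"
    using lift_projection_vector[OF q qsa \<eta>] by blast
  have yb: "op y \<in> bounded_ops \<H>" using y by simp
  have "adjoint \<H> (op y) = op y" using op_adj[OF y(1)] y(2) by simp
  then have yI: "y \<in> \<I>" using ideal_iff[OF y(1)] y(3) by simp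
  have "op y \<otimes>\<^bsub>op_algebra \<H>\<^esub> T \<in> N" by (intro N.mult_mem op_mem_N y(1) T)
  then have "(op y \<otimes>\<^bsub>op_algebra \<H>\<^esub> T) (p V) = \<zero>\<^bsub>\<H>\<^esub>"
    by (rule p_annihilates) (use ann[OF yI y(2)] V in simp_all)
  then have yw: "op y w = \<zero>\<^bsub>\<H>\<^esub>" using V by (simp add: w_def)
  have yp: "op y (p w) = \<zero>\<^bsub>\<H>\<^esub>" by (rule p_annihilates[OF op_mem_N[OF y(1)] y(3) w])
  have "\<eta> = op y w \<ominus>\<^bsub>\<H>\<^esub> op y (p w)"
    using y(4) W.op_diff[OF yb w p_closed[OF w]] by (simp add: \<eta>_def)
  then have "w \<ominus>\<^bsub>\<H>\<^esub> p w = \<zero>\<^bsub>\<H>\<^esub>" by (simp add: yw yp \<eta>_def)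
  then show ?thesis using W.diff_eq_zero[OF w p_closed[OF w]] by (simp add: w_def)
qed

text \<open>For a multiplier x, products y x in the ideal give x p = p x p, and products x y give
  the same for the adjoint of x, which is p x = p x p after taking adjoints. Conversely, if x
  commutes with p, then x and its adjoint send \<Xi> into the range of p, where operators of the
  ideal and their adjoints vanish.\<close>

lemma multiplier_iff:
  assumes x: "x \<in> linf K M"
  shows "x \<in> \<M> \<longleftrightarrow> commutes_p x"
proof
  have xb: "op x \<in> bounded_ops \<H>" using x by simp
  have xN: "op x \<in> N" "adjoint \<H> (op x) \<in> N" using x by simp_all
  assume m: "x \<in> \<M>"
  have mult: "x \<otimes>\<^bsub>L\<^esub> y \<in> \<I>" "y \<otimes>\<^bsub>L\<^esub> x \<in> \<I>" if "y \<in> \<I>" for y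
    using m that by (auto simp: ocneanu_multiplier_def)
  have 1: "p (op x (p V)) = op x (p V)" if V: "V \<in> carrier \<H>" for V
  proof (rule corner_vector_eq_zero[OF xN(1) V])
    fix y assume y: "y \<in> \<I>"
    have yl: "y \<in> linf K M" by (rule ideal_linf[OF y])
    have "op (y \<otimes>\<^bsub>L\<^esub> x) \<Xi> = \<zero>\<^bsub>\<H>\<^esub>" using mult(2)[OF y] ideal_iff[OF linf_mult[OF yl x]] by blast
    then show "op y (op x \<Xi>) = \<zero>\<^bsub>\<H>\<^esub>" by (simp add: op_mult[OF yl x])
  qed
  have 2: "p (adjoint \<H> (op x) (p V)) = adjoint \<H> (op x) (p V)" if V: "V \<in> carrier \<H>" for V
  proof (rule corner_vector_eq_zero[OF xN(2) V])
    fix y assume y: "y \<in> \<I>" "adj L y = y"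
    have yl: "y \<in> linf K M" by (rule ideal_linf[OF y(1)])
    have ysa: "adjoint \<H> (op y) = op y" using op_adj[OF yl] y(2) by simp
    \<comment> \<open>Since y is self-adjoint, the adjoint of x y is y times the adjoint of
      x.\<close>
    have "adjoint \<H> (op (x \<otimes>\<^bsub>L\<^esub> y)) \<Xi> = \<zero>\<^bsub>\<H>\<^esub>"
      using mult(1)[OF y(1)] ideal_iff[OF linf_mult[OF x yl]] by blast
    then show "op y (adjoint \<H> (op x) \<Xi>) = \<zero>\<^bsub>\<H>\<^esub>"
      using xb yl by (simp add: op_mult[OF x yl] W.adjoint_mult ysa)
  qed
  show "commutes_p x"
  proof (rule commutes_pI[OF x], rule W.vec_eqI)
    fix V Z assume V: "V \<in> carrier \<H>" and Z: "Z \<in> carrier \<H>"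
    have psa: "ip \<H> (p a) b = ip \<H> a (p b)" if "a \<in> carrier \<H>" "b \<in> carrier \<H>" for a b
      using W.ip_adjoint_right[OF p_bounded that] by simp
    have "ip \<H> (p (op x V)) Z = ip \<H> V (adjoint \<H> (op x) (p Z))"
      using psa[of "op x V" Z] W.ip_adjoint_right[OF xb V p_closed[OF Z]] x V Z by simp
    also have "\<dots> = ip \<H> V (p (adjoint \<H> (op x) (p Z)))" by (simp only: 2[OF Z])
    also have "\<dots> = ip \<H> (op x (p V)) (p Z)"
      using psa[of V "adjoint \<H> (op x) (p Z)"] W.ip_adjoint_right[OF xb p_closed[OF V] p_closed[OF Z]] V Z xb by simp
    also have "\<dots> = ip \<H> (op x (p V)) Z" using psa[of "op x (p V)" Z] 1[OF V] V Z x by simp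
    finally show "ip \<H> (p (op x V)) Z = ip \<H> (op x (p V)) Z" .
  qed (use x in auto)
next
  assume c: "commutes_p x"
  have xb: "op x \<in> bounded_ops \<H>" using x by simp
  have "x \<otimes>\<^bsub>L\<^esub> y \<in> \<I> \<and> y \<otimes>\<^bsub>L\<^esub> x \<in> \<I>" if y: "y \<in> \<I>" for y
  proof -
    have yl: "y \<in> linf K M" by (rule ideal_linf[OF y])
    have yb: "op y \<in> bounded_ops \<H>" using yl by simp
    have y0: "op y \<Xi> = \<zero>\<^bsub>\<H>\<^esub>" "adjoint \<H> (op y) \<Xi> = \<zero>\<^bsub>\<H>\<^esub>" using y ideal_iff[OF yl] by auto
    have yN: "op y \<in> N" "adjoint \<H> (op y) \<in> N" using yl by simp_all
    have "op x \<Xi> = p (op x \<Xi>)" "adjoint \<H> (op x) \<Xi> = p (adjoint \<H> (op x) \<Xi>)"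
      using commutes_pD(2,3)[OF c vector_closed] by simp_all
    then have "op y (op x \<Xi>) = \<zero>\<^bsub>\<H>\<^esub>" "adjoint \<H> (op y) (adjoint \<H> (op x) \<Xi>) = \<zero>\<^bsub>\<H>\<^esub>"
      using p_annihilates[OF yN(1) y0(1), of "op x \<Xi>"] p_annihilates[OF yN(2) y0(2), of "adjoint \<H> (op x) \<Xi>"] x xb
      by simp_all
    then show ?thesis
      unfolding ideal_iff[OF linf_mult[OF x yl]] ideal_iff[OF linf_mult[OF yl x]] op_mult[OF x yl] op_mult[OF yl x]
      using xb yb y0 by (simp add: W.adjoint_mult)
  qed
  then show "x \<in> \<M>" using x by (simp add: ocneanu_multiplier_def)
qed

lemma multiplier_linf: "x \<in> \<M> \<Longrightarrow> x \<in> linf K M"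
  by (simp add: ocneanu_multiplier_def)

lemma multiplier_commutes: "x \<in> \<M> \<Longrightarrow> commutes_p x"
  using multiplier_iff multiplier_linf by blast

lemma commutes_multiplier: "commutes_p x \<Longrightarrow> x \<in> \<M>"
  using multiplier_iff commutes_pD(1) by blast

section \<open>The star algebra of multipliers\<close>

lemma multiplier_add:
  assumes "x \<in> \<M>" "y \<in> \<M>"
  shows "x \<oplus>\<^bsub>L\<^esub> y \<in> \<M>"
proof (rule commutes_multiplier, rule commutes_pI)
  note c = assms[THEN multiplier_commutes] and l = assms[THEN multiplier_linf]
  show "x \<oplus>\<^bsub>L\<^esub> y \<in> linf K M" by (intro linf_add l)
  show "p (op (x \<oplus>\<^bsub>L\<^esub> y) V) = op (x \<oplus>\<^bsub>L\<^esub> y) (p V)" if V: "V \<in> carrier \<H>" for V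
    using V l commutes_pD(2)[OF c(1) V] commutes_pD(2)[OF c(2) V] W.op_add[OF p_bounded, of "op x V" "op y V"]
    by (simp add: op_add[OF l])
qed

lemma multiplier_smult:
  assumes "x \<in> \<M>"
  shows "c \<odot>\<^bsub>L\<^esub> x \<in> \<M>"
proof (rule commutes_multiplier, rule commutes_pI)
  note c = assms[THEN multiplier_commutes] and l = assms[THEN multiplier_linf]
  show "c \<odot>\<^bsub>L\<^esub> x \<in> linf K M" by (intro linf_smult l)
  show "p (op (c \<odot>\<^bsub>L\<^esub> x) V) = op (c \<odot>\<^bsub>L\<^esub> x) (p V)" if V: "V \<in> carrier \<H>" for V
    using V l commutes_pD(2)[OF c V] W.op_scale[OF p_bounded, of "op x V"] by (simp add: op_smult[OF l])
qed

lemma multiplier_mult: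
  assumes "x \<in> \<M>" "y \<in> \<M>"
  shows "x \<otimes>\<^bsub>L\<^esub> y \<in> \<M>"
proof (rule commutes_multiplier, rule commutes_pI)
  note c = assms[THEN multiplier_commutes] and l = assms[THEN multiplier_linf]
  show "x \<otimes>\<^bsub>L\<^esub> y \<in> linf K M" by (intro linf_mult l)
  show "p (op (x \<otimes>\<^bsub>L\<^esub> y) V) = op (x \<otimes>\<^bsub>L\<^esub> y) (p V)" if V: "V \<in> carrier \<H>" for V
    using V l commutes_pD(2)[OF c(1), of "op y V"] commutes_pD(2)[OF c(2) V] by (simp add: op_mult[OF l])
qed

lemma multiplier_adj:
  assumes "x \<in> \<M>"
  shows "adj L x \<in> \<M>"
proof (rule commutes_multiplier, rule commutes_pI)
  note c = assms[THEN multiplier_commutes] and l = assms[THEN multiplier_linf]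
  show "adj L x \<in> linf K M" by (intro linf_adj l)
  show "p (op (adj L x) V) = op (adj L x) (p V)" if V: "V \<in> carrier \<H>" for V
    using commutes_pD(3)[OF c V] by (simp only: op_adj[OF l])
qed

lemma multiplier_one: "\<one>\<^bsub>L\<^esub> \<in> \<M>"
  by (rule commutes_multiplier, rule commutes_pI[OF linf_one]) (simp add: op_one)

section \<open>Compression to the corner\<close>

definition compression :: "(nat \<Rightarrow> 'k \<Rightarrow> 'k) \<Rightarrow> (nat \<Rightarrow> 'h) set \<Rightarrow> (nat \<Rightarrow> 'h) set" where
  "compression x = op x \<otimes>\<^bsub>op_algebra \<H>\<^esub> p"

lemma compression_apply: "V \<in> carrier \<H> \<Longrightarrow> compression x V = op x (p V)"
  by (simp add: compression_def)

lemma compression_bounded [simp]: "x \<in> linf K M \<Longrightarrow> compression x \<in> bounded_ops \<H>"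
  by (simp add: compression_def)

lemma compression_eqI:
  assumes "x \<in> linf K M" "T \<in> bounded_ops \<H>" "\<And>V. V \<in> carrier \<H> \<Longrightarrow> op x (p V) = T V"
  shows "compression x = T"
  by (rule W.op_eqI) (use assms in \<open>auto simp: compression_apply\<close>)

text \<open>x y p = x p y p holds because y commutes with p; here y must be a multiplier and not
  just any bounded sequence.\<close>

lemma compression_mult:
  assumes x: "x \<in> \<M>" and y: "y \<in> \<M>"
  shows "compression (x \<otimes>\<^bsub>L\<^esub> y) = compression x \<otimes>\<^bsub>op_algebra \<H>\<^esub> compression y"
proof (rule compression_eqI)
  note l = x[THEN multiplier_linf] y[THEN multiplier_linf]
  show "x \<otimes>\<^bsub>L\<^esub> y \<in> linf K M" by (intro linf_mult l)
  show "compression x \<otimes>\<^bsub>op_algebra \<H>\<^esub> compression y \<in> bounded_ops \<H>" using l by simp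
  show "op (x \<otimes>\<^bsub>L\<^esub> y) (p V) = (compression x \<otimes>\<^bsub>op_algebra \<H>\<^esub> compression y) V" if V: "V \<in> carrier \<H>" for V
    using V l commutes_pD(2)[OF multiplier_commutes[OF y], of "p V"] p_idem[OF V]
    by (simp add: compression_apply op_mult[OF l])
qed

lemma compression_add:
  assumes l: "x \<in> linf K M" "y \<in> linf K M"
  shows "compression (x \<oplus>\<^bsub>L\<^esub> y) = compression x \<oplus>\<^bsub>op_algebra \<H>\<^esub> compression y"
  by (rule compression_eqI) (use l in \<open>auto simp: linf_add compression_apply op_add[OF l]\<close>)

lemma compression_smult:
  assumes l: "x \<in> linf K M"
  shows "compression (c \<odot>\<^bsub>L\<^esub> x) = c \<odot>\<^bsub>op_algebra \<H>\<^esub> compression x"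
  by (rule compression_eqI) (use l in \<open>auto simp: linf_smult compression_apply op_smult[OF l]\<close>)

text \<open>The adjoint of x p is p times the adjoint of x, and commutation moves p back to the
  right.\<close>

lemma compression_adj:
  assumes x: "x \<in> \<M>"
  shows "compression (adj L x) = adjoint \<H> (compression x)"
proof (rule compression_eqI)
  note l = multiplier_linf[OF x]
  show "adj L x \<in> linf K M" by (rule linf_adj[OF l])
  show "adjoint \<H> (compression x) \<in> bounded_ops \<H>" using l by simp
  show "op (adj L x) (p V) = adjoint \<H> (compression x) V" if V: "V \<in> carrier \<H>" for V
    using commutes_pD(3)[OF multiplier_commutes[OF x] V] l V
    by (simp only: op_adj[OF l] compression_def W.adjoint_mult[OF op_bounded[OF l] p_bounded] p_adjoint op_algebra_apply)
qed

lemma compression_one: "compression \<one>\<^bsub>L\<^esub> = p"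
  by (rule compression_eqI) (auto simp: linf_one op_one)

text \<open>The ideal asks that the difference and its adjoint vanish at \<Xi>: the first is
  agreement at \<Xi> = p \<Xi>, and the second follows since compressions of multipliers respect
  adjoints. Conversely, an operator of N that kills \<Xi> kills the range of p.\<close>

lemma compression_eq_iff:
  assumes x: "x \<in> \<M>" and y: "y \<in> \<M>"
  shows "compression x = compression y \<longleftrightarrow> y \<oplus>\<^bsub>L\<^esub> (-1) \<odot>\<^bsub>L\<^esub> x \<in> \<I>"
proof -
  note l = x[THEN multiplier_linf] y[THEN multiplier_linf]
  let ?z = "y \<oplus>\<^bsub>L\<^esub> (-1) \<odot>\<^bsub>L\<^esub> x"
  have mx: "(-1) \<odot>\<^bsub>L\<^esub> x \<in> linf K M" by (rule linf_smult[OF l(1)])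
  have z: "?z \<in> linf K M" by (rule linf_add[OF l(2) mx])
  have b: "op x \<in> bounded_ops \<H>" "op y \<in> bounded_ops \<H>" using l by simp_all
  have oz: "op ?z = op y \<oplus>\<^bsub>op_algebra \<H>\<^esub> (-1) \<odot>\<^bsub>op_algebra \<H>\<^esub> op x"
    unfolding op_add[OF l(2) mx] op_smult[OF l(1)] ..
  have oV: "op ?z V = op y V \<ominus>\<^bsub>\<H>\<^esub> op x V" if "V \<in> carrier \<H>" for V
    unfolding oz using that l by (simp add: W.diff_eq)
  have aX: "adjoint \<H> (op ?z) \<Xi> = adjoint \<H> (op y) \<Xi> \<ominus>\<^bsub>\<H>\<^esub> adjoint \<H> (op x) \<Xi>"
    unfolding oz using b by (simp add: W.adjoint_add W.adjoint_smult W.diff_eq)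
  show ?thesis
  proof
    assume eq: "compression x = compression y"
    have "op x \<Xi> = op y \<Xi>"
      using fun_cong[OF eq, of \<Xi>] by (simp add: compression_apply)
    moreover have "adjoint \<H> (op x) \<Xi> = adjoint \<H> (op y) \<Xi>"
      using fun_cong[OF arg_cong[OF eq, of "adjoint \<H>"], of \<Xi>]
        compression_apply[OF vector_closed, of "adj L x"] compression_apply[OF vector_closed, of "adj L y"]
      by (simp add: compression_adj[OF x, symmetric] compression_adj[OF y, symmetric] op_adj[OF l(1)] op_adj[OF l(2)])
    ultimately show "?z \<in> \<I>"
      unfolding ideal_iff[OF z] oV[OF vector_closed] aX using l b by (simp del: W.M.minus_closed)
  next
    assume "?z \<in> \<I>"
    then have z0: "op ?z \<Xi> = \<zero>\<^bsub>\<H>\<^esub>" using ideal_iff[OF z] by blast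
    show "compression x = compression y"
    proof (rule W.op_eqI)
      fix V assume V: "V \<in> carrier \<H>"
      have "op y (p V) \<ominus>\<^bsub>\<H>\<^esub> op x (p V) = \<zero>\<^bsub>\<H>\<^esub>"
        using p_annihilates[OF op_mem_N[OF z] z0 V] oV[OF p_closed[OF V]] by simp
      then show "compression x V = compression y V"
        using W.diff_eq_zero[of "op y (p V)" "op x (p V)"] V l by (simp add: compression_apply)
    qed (use l in auto)
  qed
qed

text \<open>The bounded sequences are not set up as a ring, so this cancellation is checked entry by
  entry and vector by vector.\<close>

lemma linf_diff_add:
  assumes "x \<in> linf K M" "y \<in> linf K M"
  shows "(y \<oplus>\<^bsub>L\<^esub> (-1) \<odot>\<^bsub>L\<^esub> x) \<oplus>\<^bsub>L\<^esub> x = y"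
proof
  fix n
  have b: "x n \<in> bounded_ops (K n)" "y n \<in> bounded_ops (K n)"
    using assms by (auto intro: A.mem_bounded linf_mem)
  show "((y \<oplus>\<^bsub>L\<^esub> (-1) \<odot>\<^bsub>L\<^esub> x) \<oplus>\<^bsub>L\<^esub> x) n = y n"
  proof (rule A.op_eqI[where n = n])
    fix v assume v: "v \<in> carrier (K n)"
    have k: "x n v \<in> carrier (K n)" "y n v \<in> carrier (K n)" using A.op_closed[OF b(1) v] A.op_closed[OF b(2) v] by auto
    show "((y \<oplus>\<^bsub>L\<^esub> (-1) \<odot>\<^bsub>L\<^esub> x) \<oplus>\<^bsub>L\<^esub> x) n v = y n v"
      by (rule A.vec_eqI[where n = n]) (use k v in \<open>auto simp: linf_algebra_simps A.ip_add_left A.ip_scale_left\<close>)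
  qed (use b in \<open>auto simp: linf_algebra_simps\<close>)
qed

text \<open>The cosets of the ideal are the fibres of the compression map, so that all operations on cosets
  can be computed through it.\<close>

lemma class_eq:
  assumes x: "x \<in> \<M>"
  shows "ocneanu_class \<omega> K M \<phi> x = {y \<in> \<M>. compression y = compression x}"
proof -
  have lx: "x \<in> linf K M" by (rule multiplier_linf[OF x])
  have cls: "ocneanu_class \<omega> K M \<phi> x = (\<lambda>i. i \<oplus>\<^bsub>L\<^esub> x) ` \<I>"
    by (auto simp: ocneanu_class_def multiplier_algebra_def a_r_coset_def')
  have I: "i \<in> \<M> \<and> compression i = \<zero>\<^bsub>op_algebra \<H>\<^esub>" if i: "i \<in> \<I>" for i
  proof -
    have li: "i \<in> linf K M" by (rule ideal_linf[OF i])
    have ib: "op i \<in> bounded_ops \<H>" using li by simp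
    have iN: "op i \<in> N" "adjoint \<H> (op i) \<in> N" using li by simp_all
    have i0: "op i \<Xi> = \<zero>\<^bsub>\<H>\<^esub>" "adjoint \<H> (op i) \<Xi> = \<zero>\<^bsub>\<H>\<^esub>" using i ideal_iff[OF li] by auto
    have ip: "op i (p V) = \<zero>\<^bsub>\<H>\<^esub>" if "V \<in> carrier \<H>" for V by (rule p_annihilates[OF iN(1) i0(1) that])
    \<comment> \<open>The adjoint of \<open>op i\<close> kills \<Xi> and therefore the range of p;
      moving both operators across the inner product turns this into p i = 0.\<close>
    have pi: "p (op i V) = \<zero>\<^bsub>\<H>\<^esub>" if V: "V \<in> carrier \<H>" for V
    proof (rule W.vec_eqI)
      fix Z assume Z: "Z \<in> carrier \<H>"
      have "ip \<H> (p (op i V)) Z = ip \<H> V (adjoint \<H> (op i) (p Z))"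
        using W.ip_adjoint_right[OF p_bounded op_closed_ultra[OF li V] Z] W.ip_adjoint_right[OF ib V p_closed[OF Z]]
        by simp
      then show "ip \<H> (p (op i V)) Z = ip \<H> \<zero>\<^bsub>\<H>\<^esub> Z"
        using p_annihilates[OF iN(2) i0(2) Z] V Z by simp
    qed (use V li in auto)
    have "compression i = \<zero>\<^bsub>op_algebra \<H>\<^esub>" by (rule compression_eqI) (use li ip in auto)
    moreover have "i \<in> \<M>" by (rule commutes_multiplier, rule commutes_pI[OF li]) (simp add: ip pi)
    ultimately show ?thesis by blast
  qed
  show ?thesis
    unfolding cls
  proof (intro equalityI subsetI)
    fix y assume "y \<in> (\<lambda>i. i \<oplus>\<^bsub>L\<^esub> x) ` \<I>"
    then obtain i where i: "i \<in> \<I>" "y = i \<oplus>\<^bsub>L\<^esub> x" by blast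
    have "compression y = \<zero>\<^bsub>op_algebra \<H>\<^esub> \<oplus>\<^bsub>op_algebra \<H>\<^esub> compression x"
      using I[OF i(1)] by (simp add: i(2) compression_add[OF ideal_linf[OF i(1)] lx])
    also have "\<dots> = compression x" by (rule W.op_eqI) (use lx in \<open>auto simp: compression_apply\<close>)
    finally show "y \<in> {y \<in> \<M>. compression y = compression x}"
      using multiplier_add[OF _ x, of i] I[OF i(1)] i(2) by simp
  next
    fix y assume "y \<in> {y \<in> \<M>. compression y = compression x}"
    then have y: "y \<in> \<M>" "compression x = compression y" by auto
    show "y \<in> (\<lambda>i. i \<oplus>\<^bsub>L\<^esub> x) ` \<I>"
      using compression_eq_iff[OF x y(1)] y(2) linf_diff_add[OF lx multiplier_linf[OF y(1)]]
      by (intro image_eqI[of _ _ "y \<oplus>\<^bsub>L\<^esub> (-1) \<odot>\<^bsub>L\<^esub> x"]) auto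
  qed
qed

text \<open>E = p T p is lifted at \<Xi> together with its adjoint. Operators of N that agree at
  \<Xi> agree on the range of p, so x p = E, and the same for adjoints gives p x = E. Hence the lift
  commutes with p without further correction.\<close>

lemma compression_surj:
  assumes T: "T \<in> N"
  shows "\<exists>x\<in>\<M>. compression x = p \<otimes>\<^bsub>op_algebra \<H>\<^esub> T \<otimes>\<^bsub>op_algebra \<H>\<^esub> p"
proof -
  let ?B = "op_algebra \<H>"
  have Tb: "T \<in> bounded_ops \<H>" using T by simp
  define E where "E = p \<otimes>\<^bsub>?B\<^esub> T \<otimes>\<^bsub>?B\<^esub> p"
  have E: "E \<in> N" unfolding E_def by (intro N.mult_mem p_mem T)
  have Eb: "E \<in> bounded_ops \<H>" using E by simp
  have Ep: "E (p V) = E V" if "V \<in> carrier \<H>" for V using that Tb by (simp add: E_def p_idem)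
  have aE: "adjoint \<H> E = p \<otimes>\<^bsub>?B\<^esub> (adjoint \<H> T \<otimes>\<^bsub>?B\<^esub> p)"
    using Tb by (simp add: E_def W.adjoint_mult)
  have aEp: "adjoint \<H> E (p V) = adjoint \<H> E V" if "V \<in> carrier \<H>" for V
    unfolding aE using that Tb by (simp add: p_idem)
  obtain x where x: "x \<in> linf K M" "op x \<Xi> = E \<Xi>" "adjoint \<H> (op x) \<Xi> = adjoint \<H> E \<Xi>"
    using lift_operator[OF E] by blast
  have xb: "op x \<in> bounded_ops \<H>" using x by simp
  have agree: "S (p V) = R (p V)" if S: "S \<in> N" and R: "R \<in> N" and eq: "S \<Xi> = R \<Xi>" and V: "V \<in> carrier \<H>" for S R V
  proof -
    define D where "D = S \<oplus>\<^bsub>?B\<^esub> (-1) \<odot>\<^bsub>?B\<^esub> R"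
    have SRb: "S \<in> bounded_ops \<H>" "R \<in> bounded_ops \<H>" using S R by simp_all
    have D: "D \<in> N" unfolding D_def by (intro N.add_mem N.smult_mem S R)
    have DV: "D Z = S Z \<ominus>\<^bsub>\<H>\<^esub> R Z" if "Z \<in> carrier \<H>" for Z
      using that SRb by (simp add: D_def W.diff_eq)
    have "D \<Xi> = \<zero>\<^bsub>\<H>\<^esub>" using DV[OF vector_closed] eq SRb by (simp del: W.M.minus_closed)
    then have "D (p V) = \<zero>\<^bsub>\<H>\<^esub>" by (rule p_annihilates[OF D _ V])
    then show ?thesis using DV[OF p_closed[OF V]] W.diff_eq_zero[of "S (p V)" "R (p V)"] SRb V by simp
  qed
  have xp: "op x (p V) = E V" if V: "V \<in> carrier \<H>" for V
    using agree[OF op_mem_N[OF x(1)] E x(2) V] Ep[OF V] by simp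
  have ap: "adjoint \<H> (op x) (p V) = adjoint \<H> E V" if V: "V \<in> carrier \<H>" for V
    using agree[of "adjoint \<H> (op x)" "adjoint \<H> E" V] x E V aEp[OF V] by simp
  have px: "p (op x V) = E V" if V: "V \<in> carrier \<H>" for V
  proof (rule W.vec_eqI)
    fix Z assume Z: "Z \<in> carrier \<H>"
    have "ip \<H> (p (op x V)) Z = ip \<H> V (adjoint \<H> (op x) (p Z))"
      using W.ip_adjoint_right[OF p_bounded op_closed_ultra[OF x(1) V] Z] W.ip_adjoint_right[OF xb V p_closed[OF Z]]
      by simp
    also have "\<dots> = ip \<H> (E V) Z" unfolding ap[OF Z] by (rule W.ip_adjoint_right[OF Eb V Z])
    finally show "ip \<H> (p (op x V)) Z = ip \<H> (E V) Z" .
  qed (use x V Eb in auto)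
  have "commutes_p x" by (rule commutes_pI[OF x(1)]) (simp add: px xp)
  moreover have "compression x = E" by (rule compression_eqI[OF x(1) Eb xp])
  ultimately show ?thesis using commutes_multiplier unfolding E_def by blast
qed

section \<open>Operations on cosets\<close>

abbreviation OU :: "(nat \<Rightarrow> 'k \<Rightarrow> 'k) set star_algebra" where
  "OU \<equiv> ocneanu_ultraproduct \<omega> K M \<phi>"

abbreviation oc :: "(nat \<Rightarrow> 'k \<Rightarrow> 'k) \<Rightarrow> (nat \<Rightarrow> 'k \<Rightarrow> 'k) set" where
  "oc \<equiv> ocneanu_class \<omega> K M \<phi>"

lemma oc_self: "x \<in> \<M> \<Longrightarrow> x \<in> oc x"
  by (simp add: class_eq)

lemma oc_cong:
  "\<lbrakk>x \<in> \<M>; y \<in> \<M>; compression x = compression y\<rbrakk> \<Longrightarrow> oc x = oc y"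
  by (simp add: class_eq)

lemma OU_carrier: "carrier OU = oc ` \<M>"
  unfolding ocneanu_ultraproduct_def carrier_quotient_star_algebra
  by (simp add: ocneanu_class_def[abs_def] multiplier_algebra_def)

lemma UN_oc:
  assumes x: "x \<in> \<M>"
    and "\<And>y. \<lbrakk>y \<in> \<M>; compression y = compression x\<rbrakk> \<Longrightarrow> f y = Y"
  shows "(\<Union>y\<in>oc x. f y) = Y"
  using oc_self[OF x] assms(2) unfolding class_eq[OF x] by blast

lemma OU_mult:
  assumes x: "x \<in> \<M>" and y: "y \<in> \<M>"
  shows "oc x \<otimes>\<^bsub>OU\<^esub> oc y = oc (x \<otimes>\<^bsub>L\<^esub> y)"
proof -
  have "oc x \<otimes>\<^bsub>OU\<^esub> oc y = (\<Union>a\<in>oc x. \<Union>b\<in>oc y. oc (a \<otimes>\<^bsub>L\<^esub> b))"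
    by (simp add: ocneanu_ultraproduct_def quotient_star_algebra_def FactRing_def rcoset_mult_def
        ocneanu_class_def multiplier_algebra_def)
  also have "\<dots> = oc (x \<otimes>\<^bsub>L\<^esub> y)"
    by (intro UN_oc x y oc_cong multiplier_mult) (simp_all add: compression_mult x y)
  finally show ?thesis .
qed

text \<open>Addition in the quotient is the elementwise sum of two cosets and not a union of cosets,
  so both inclusions have to be shown; an element z of the target splits as (z - y) + y.\<close>

lemma OU_add:
  assumes x: "x \<in> \<M>" and y: "y \<in> \<M>"
  shows "oc x \<oplus>\<^bsub>OU\<^esub> oc y = oc (x \<oplus>\<^bsub>L\<^esub> y)"
proof -
  have set_add: "oc x \<oplus>\<^bsub>OU\<^esub> oc y = (\<Union>a\<in>oc x. \<Union>b\<in>oc y. {a \<oplus>\<^bsub>L\<^esub> b})"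
    by (simp add: ocneanu_ultraproduct_def quotient_star_algebra_def FactRing_def set_add_def set_mult_def
        multiplier_algebra_def)
  note l = x[THEN multiplier_linf] y[THEN multiplier_linf]
  show ?thesis
    unfolding set_add
  proof (intro equalityI subsetI)
    fix z assume "z \<in> (\<Union>a\<in>oc x. \<Union>b\<in>oc y. {a \<oplus>\<^bsub>L\<^esub> b})"
    then obtain a b where "a \<in> oc x" "b \<in> oc y" and z: "z = a \<oplus>\<^bsub>L\<^esub> b" by blast
    then have a: "a \<in> \<M>" "compression a = compression x"
      and b: "b \<in> \<M>" "compression b = compression y"
      by (simp_all add: class_eq x y)
    have "compression z = compression (x \<oplus>\<^bsub>L\<^esub> y)"
      using a b by (simp only: z compression_add[OF multiplier_linf[OF a(1)] multiplier_linf[OF b(1)]] compression_add[OF l])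
    then show "z \<in> oc (x \<oplus>\<^bsub>L\<^esub> y)"
      unfolding class_eq[OF multiplier_add[OF x y]] using multiplier_add[OF a(1) b(1)] z by simp
  next
    fix z assume "z \<in> oc (x \<oplus>\<^bsub>L\<^esub> y)"
    then have z: "z \<in> \<M>" "compression z = compression (x \<oplus>\<^bsub>L\<^esub> y)"
      by (simp_all add: class_eq multiplier_add[OF x y])
    note lz = multiplier_linf[OF z(1)]
    define a where "a = z \<oplus>\<^bsub>L\<^esub> (-1) \<odot>\<^bsub>L\<^esub> y"
    have a: "a \<in> \<M>" unfolding a_def by (intro multiplier_add multiplier_smult z(1) y)
    have "compression a = compression x"
    proof (rule W.op_eqI)
      fix V assume V: "V \<in> carrier \<H>"
      have k: "compression x V \<in> carrier \<H>" "compression y V \<in> carrier \<H>"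
        using l V by (simp_all add: compression_apply)
      have "compression a = compression z \<oplus>\<^bsub>op_algebra \<H>\<^esub> (-1) \<odot>\<^bsub>op_algebra \<H>\<^esub> compression y"
        unfolding a_def compression_add[OF lz linf_smult[OF l(2)]] compression_smult[OF l(2)] ..
      then have "compression a V = (compression x V \<oplus>\<^bsub>\<H>\<^esub> compression y V) \<oplus>\<^bsub>\<H>\<^esub> (-1) \<odot>\<^bsub>\<H>\<^esub> compression y V"
        using z(2) V by (simp add: compression_add[OF l])
      also have "\<dots> = compression x V"
        by (rule W.vec_eqI) (use k in \<open>simp_all add: W.ip_add_left W.ip_scale_left\<close>)
      finally show "compression a V = compression x V" .
    qed (use l multiplier_linf[OF a] in auto)
    then have "a \<in> oc x" using a by (simp add: class_eq x)
    moreover have "z = a \<oplus>\<^bsub>L\<^esub> y" unfolding a_def by (rule linf_diff_add[OF l(2) lz, symmetric])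
    ultimately show "z \<in> (\<Union>a\<in>oc x. \<Union>b\<in>oc y. {a \<oplus>\<^bsub>L\<^esub> b})" using oc_self[OF y] by blast
  qed
qed

lemma OU_smult:
  assumes x: "x \<in> \<M>"
  shows "c \<odot>\<^bsub>OU\<^esub> oc x = oc (c \<odot>\<^bsub>L\<^esub> x)"
proof -
  have "c \<odot>\<^bsub>OU\<^esub> oc x = (\<Union>a\<in>oc x. oc (c \<odot>\<^bsub>L\<^esub> a))"
    by (simp add: ocneanu_ultraproduct_def quotient_star_algebra_def ocneanu_class_def multiplier_algebra_def)
  also have "\<dots> = oc (c \<odot>\<^bsub>L\<^esub> x)"
    by (intro UN_oc x oc_cong multiplier_smult) (simp_all add: compression_smult multiplier_linf x)
  finally show ?thesis .
qed

lemma OU_adj: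
  assumes x: "x \<in> \<M>"
  shows "adj OU (oc x) = oc (adj L x)"
proof -
  have "adj OU (oc x) = (\<Union>a\<in>oc x. oc (adj L a))"
    by (simp add: ocneanu_ultraproduct_def quotient_star_algebra_def ocneanu_class_def multiplier_algebra_def)
  also have "\<dots> = oc (adj L x)"
    by (intro UN_oc x oc_cong multiplier_adj) (simp_all add: compression_adj x)
  finally show ?thesis .
qed

lemma OU_one: "\<one>\<^bsub>OU\<^esub> = oc \<one>\<^bsub>L\<^esub>"
  by (simp add: ocneanu_ultraproduct_def quotient_star_algebra_def FactRing_def ocneanu_class_def multiplier_algebra_def)

lemma reduced_algebra_simps:
  "mult corner = mult (op_algebra \<H>)" "add corner = add (op_algebra \<H>)"
  "smult corner = smult (op_algebra \<H>)" "adj corner = adjoint \<H>"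
  "one corner = p"
  "carrier corner = {p \<otimes>\<^bsub>op_algebra \<H>\<^esub> T \<otimes>\<^bsub>op_algebra \<H>\<^esub> p | T. T \<in> N}"
  by (simp_all add: reduced_algebra_def)

lemma compression_mem:
  assumes x: "x \<in> \<M>"
  shows "compression x \<in> carrier corner"
proof -
  note l = multiplier_linf[OF x]
  have "compression x = p \<otimes>\<^bsub>op_algebra \<H>\<^esub> op x \<otimes>\<^bsub>op_algebra \<H>\<^esub> p"
    by (rule compression_eqI[OF l])
      (use l commutes_pD(2)[OF multiplier_commutes[OF x]] p_idem in auto)
  then show ?thesis using op_mem_N[OF l] by (auto simp: reduced_algebra_simps)
qed

theorem ocneanu_star_iso:
  "\<exists>\<Phi>\<in>star_iso OU corner. \<forall>x\<in>\<M>. \<Phi> (oc x) = compression x"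
proof -
  \<comment> \<open>Compression is constant on a coset, so the image of a coset is a singleton and
    no representative has to be chosen.\<close>
  define \<Phi> where "\<Phi> X = the_elem (compression ` X)" for X
  have \<Phi>: "\<Phi> (oc x) = compression x" if x: "x \<in> \<M>" for x
  proof -
    have "\<forall>y\<in>oc x. compression y = compression x" by (simp add: class_eq x)
    then have "compression ` oc x = {compression x}" using oc_self[OF x] by blast
    then show ?thesis by (simp add: \<Phi>_def)
  qed
  have "\<Phi> \<in> ring_hom OU corner"
  proof (rule ring_hom_memI)
    show "\<Phi> X \<in> carrier corner" if "X \<in> carrier OU" for X
      using that compression_mem by (auto simp: OU_carrier \<Phi>)
    show "\<Phi> (X \<otimes>\<^bsub>OU\<^esub> Y) = \<Phi> X \<otimes>\<^bsub>corner\<^esub> \<Phi> Y" if "X \<in> carrier OU" "Y \<in> carrier OU" for X Y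
    proof -
      obtain x y where xy: "x \<in> \<M>" "X = oc x" "y \<in> \<M>" "Y = oc y"
        using \<open>X \<in> carrier OU\<close> \<open>Y \<in> carrier OU\<close> by (auto simp: OU_carrier)
      show ?thesis
        by (simp add: xy OU_mult \<Phi> multiplier_mult compression_mult reduced_algebra_simps)
    qed
    show "\<Phi> (X \<oplus>\<^bsub>OU\<^esub> Y) = \<Phi> X \<oplus>\<^bsub>corner\<^esub> \<Phi> Y" if "X \<in> carrier OU" "Y \<in> carrier OU" for X Y
    proof -
      obtain x y where xy: "x \<in> \<M>" "X = oc x" "y \<in> \<M>" "Y = oc y"
        using \<open>X \<in> carrier OU\<close> \<open>Y \<in> carrier OU\<close> by (auto simp: OU_carrier)
      show ?thesis
        by (simp add: xy OU_add \<Phi> multiplier_add compression_add multiplier_linf reduced_algebra_simps)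
    qed
    show "\<Phi> \<one>\<^bsub>OU\<^esub> = \<one>\<^bsub>corner\<^esub>"
      by (simp add: OU_one \<Phi> multiplier_one compression_one reduced_algebra_simps)
  qed
  moreover have "\<Phi> (c \<odot>\<^bsub>OU\<^esub> X) = c \<odot>\<^bsub>corner\<^esub> \<Phi> X" if "X \<in> carrier OU" for c X
    using that by (auto simp: OU_carrier OU_smult \<Phi> multiplier_smult compression_smult multiplier_linf reduced_algebra_simps)
  moreover have "\<Phi> (adj OU X) = adj corner (\<Phi> X)" if "X \<in> carrier OU" for X
    using that by (auto simp: OU_carrier OU_adj \<Phi> multiplier_adj compression_adj reduced_algebra_simps)
  moreover have "bij_betw \<Phi> (carrier OU) (carrier corner)"
  proof (rule bij_betw_imageI)
    show "inj_on \<Phi> (carrier OU)"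
    proof (rule inj_onI)
      fix X Y assume "X \<in> carrier OU" "Y \<in> carrier OU" and eq: "\<Phi> X = \<Phi> Y"
      then obtain x y where xy: "x \<in> \<M>" "X = oc x" "y \<in> \<M>" "Y = oc y" by (auto simp: OU_carrier)
      then have "compression x = compression y" using eq by (simp add: \<Phi>)
      then show "X = Y" unfolding xy(2,4) by (rule oc_cong[OF xy(1,3)])
    qed
    show "\<Phi> ` carrier OU = carrier corner"
    proof (intro equalityI subsetI)
      fix T assume "T \<in> \<Phi> ` carrier OU"
      then show "T \<in> carrier corner" using compression_mem by (auto simp: OU_carrier \<Phi>)
    next
      fix T assume "T \<in> carrier corner"
      then obtain S where S: "S \<in> N" "T = p \<otimes>\<^bsub>op_algebra \<H>\<^esub> S \<otimes>\<^bsub>op_algebra \<H>\<^esub> p"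
        by (auto simp: reduced_algebra_simps)
      then obtain x where x: "x \<in> \<M>" "compression x = T" using compression_surj[OF S(1)] by auto
      then have "T = \<Phi> (oc x)" by (simp add: \<Phi>)
      then show "T \<in> \<Phi> ` carrier OU" using x(1) by (auto simp: OU_carrier)
    qed
  qed
  ultimately have "\<Phi> \<in> star_iso OU corner"
    by (simp add: star_iso_def star_hom_def)
  then show ?thesis using \<Phi> by blast
qed

end

theorem proposition3p15:
  fixes \<omega> :: "nat filter"
    and K :: "nat \<Rightarrow> 'k hilbert" and M :: "nat \<Rightarrow> ('k \<Rightarrow> 'k) set"
    and \<phi> :: "nat \<Rightarrow> ('k \<Rightarrow> 'k) \<Rightarrow> complex"
    and H :: "nat \<Rightarrow> 'h hilbert" and \<pi> :: "nat \<Rightarrow> ('k \<Rightarrow> 'k) \<Rightarrow> ('h \<Rightarrow> 'h)" and \<xi> :: "nat \<Rightarrow> 'h"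
    and H\<omega> :: "(nat \<Rightarrow> 'h) set hilbert"
    and N :: "((nat \<Rightarrow> 'h) set \<Rightarrow> (nat \<Rightarrow> 'h) set) set"
    and \<xi>\<omega> :: "(nat \<Rightarrow> 'h) set"
    and \<phi>\<omega> :: "((nat \<Rightarrow> 'h) set \<Rightarrow> (nat \<Rightarrow> 'h) set) \<Rightarrow> complex"
    and p :: "(nat \<Rightarrow> 'h) set \<Rightarrow> (nat \<Rightarrow> 'h) set"
  assumes "free_ultrafilter \<omega>"
    and "\<And>n. von_neumann_algebra (K n) (M n)"
    and "\<And>n. sigma_finite_vna (K n) (M n)"
    and "\<And>n. normal_state (K n) (M n) (\<phi> n)"
    and "\<And>n. faithful (K n) (M n) (\<phi> n)"
    and "\<And>n. GNS_triple (K n) (M n) (\<phi> n) (H n) (\<pi> n) (\<xi> n)"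
    and "H\<omega> = hilbert_ultraproduct \<omega> H"
    and "N = groh_raynaud_ultraproduct \<omega> K M H \<pi>"
    and "\<xi>\<omega> = vec_class \<omega> H \<xi>"
    and "\<phi>\<omega> = (\<lambda>x. ip H\<omega> (x \<xi>\<omega>) \<xi>\<omega>)"
    and "p = support_projection H\<omega> N \<phi>\<omega>"
  shows "von_neumann_algebra H\<omega> N \<and> normal_state H\<omega> N \<phi>\<omega> \<and> is_support_projection H\<omega> N \<phi>\<omega> p \<and>
    (\<forall>x\<in>linf K M. x \<in> ocneanu_multiplier \<omega> K M \<phi> \<longleftrightarrow>
       p \<otimes>\<^bsub>op_algebra H\<omega>\<^esub> op_class \<omega> H (\<lambda>n. \<pi> n (x n)) =
       op_class \<omega> H (\<lambda>n. \<pi> n (x n)) \<otimes>\<^bsub>op_algebra H\<omega>\<^esub> p) \<and>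
    (\<exists>\<Phi>\<in>star_iso (ocneanu_ultraproduct \<omega> K M \<phi>) (reduced_algebra H\<omega> N p).
       \<forall>x\<in>ocneanu_multiplier \<omega> K M \<phi>.
         \<Phi> (ocneanu_class \<omega> K M \<phi> x) =
         op_class \<omega> H (\<lambda>n. \<pi> n (x n)) \<otimes>\<^bsub>op_algebra H\<omega>\<^esub> p) \<and>
    star_isomorphic (ocneanu_ultraproduct \<omega> K M \<phi>) (reduced_algebra H\<omega> N p)"
proof -
  have H: "\<And>n. hilbert_space (H n)" using assms(6) by (simp add: GNS_triple_def)
  have st: "\<And>n. state (K n) (M n) (\<phi> n)" using assms(4) by (simp add: normal_state_def)
  interpret G: gns_sequence \<omega> H K M \<phi> \<pi> \<xi>
    by (intro gns_sequence.intro hilbert_sequence.intro free_ultrafilter_on_nat.intro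
        hilbert_sequence_axioms.intro gns_sequence_axioms.intro assms(1,2,6) H st)
  have iff: "x \<in> ocneanu_multiplier \<omega> K M \<phi> \<longleftrightarrow> p \<otimes>\<^bsub>op_algebra H\<omega>\<^esub> op_class \<omega> H (\<lambda>n. \<pi> n (x n)) =
      op_class \<omega> H (\<lambda>n. \<pi> n (x n)) \<otimes>\<^bsub>op_algebra H\<omega>\<^esub> p" if "x \<in> linf K M" for x
    unfolding assms(7-11) using G.multiplier_iff[OF that] that by (simp add: G.commutes_p_def)
  have iso: "\<exists>\<Phi>\<in>star_iso (ocneanu_ultraproduct \<omega> K M \<phi>) (reduced_algebra H\<omega> N p).
      \<forall>x\<in>ocneanu_multiplier \<omega> K M \<phi>. \<Phi> (ocneanu_class \<omega> K M \<phi> x) =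
        op_class \<omega> H (\<lambda>n. \<pi> n (x n)) \<otimes>\<^bsub>op_algebra H\<omega>\<^esub> p"
    unfolding assms(7-11) using G.ocneanu_star_iso unfolding G.compression_def .
  then have "star_isomorphic (ocneanu_ultraproduct \<omega> K M \<phi>) (reduced_algebra H\<omega> N p)"
    by (auto simp: star_isomorphic_def)
  moreover have "von_neumann_algebra H\<omega> N" "normal_state H\<omega> N \<phi>\<omega>" "is_support_projection H\<omega> N \<phi>\<omega> p"
    unfolding assms(7-11) by (rule G.von_neumann_N G.normal_vector_state G.p_support)+
  ultimately show ?thesis using iff iso by blast
qed

end
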